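(* Let $n\ge1$ and let $V$ be a lattice of $(\mathbf C^\times)^n$. Then the set $\mathrm{Shin}((\mathbf C^\times)^n/V)$ of Shintani decompositions of $(\mathbf C^\times)^n$ modulo $V$ is not empty.
   Context: A lattice of $(\mathbf C^\times)^n$ is a subgroup $V$ (for coordinatewise multiplication) such that $\mathrm{Log}:(z_1,\dots,z_n)\mapsto(\log|z_1|,\dots,\log|z_n|)$ induces an isomorphism of $V$ onto a lattice of the hyperplane $\{x\in\mathbf R^n:\ \sum_ix_i=0\}$. For $z\in\mathbf C^n$, $\mathrm{Tr}(z)=\sum_iz_i$, $\mathrm N(z)=\prod_iz_i$; products are coordinatewise; $e_1,\dots,e_n$ is the canonical basis. Let $X=\mathbf P^{n-1}(\mathbf C)$, the set of lines of $\mathbf C^n$. Let $\mathcal U\subset X^n$ be the set of $B=(f_1,\dots,f_n)$ such that any $n$ of the vectors $e_1,\dots,e_n,f_1,\dots,f_n$ are linearly independent (for any lifts of the $f_i$ to $\mathbf C^n$), and $\mathbf Z[\mathcal U]$ the free abelian group on $\mathcal U$. For $B=(f_1,\dots,f_n)\in\mathcal U$ set $g_B(z)=\frac{\det B}{\mathrm{Tr}(f_1z)\cdots\mathrm{Tr}(f_nz)}$, computed with any lifts of the $f_i$ to $\mathbf C^n$ (independent of the lifts), and $g_{\mathcal B}=\sum n_Bg_B$ if $\mathcal B=\sum n_BB$. For $v\in(\mathbf C^\times)^n$, $v\mathcal B=\sum n_B\,vB$ with $vB=(vf_1,\dots,vf_n)$. A Shintani decomposition of $(\mathbf C^\times)^n$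 modulo $V$ is an element $\mathcal B\in\mathbf Z[\mathcal U]$ such that $\frac1{\mathrm N(z)}=\sum_{v\in V}g_{v\mathcal B}(z)$ for every $z\in(\mathbf C^\times)^n$ for which the series on the right converges (it converges for almost every $z$). *)

theory Defs
  imports "HOL-Analysis.Analysis" "HOL-Algebra.Free_Abelian_Groups"
begin

text \<open>
  Multiplication and \<open>1\<close> on \<^typ>\<open>complex ^ 'n\<close> are the library's coordinatewise operations,
  and \<open>vec.subspace\<close>, \<open>vec.dim\<close>, \<open>vec.independent\<close> are taken over \<^typ>\<open>complex\<close>; the
  unqualified \<open>independent\<close>, \<open>span\<close> below are over \<^typ>\<open>real\<close>.
\<close>

definition ctorus :: "(complex ^ 'n) monoid" where
  "ctorus = \<lparr>carrier = {z. \<forall>i. z $ i \<noteq> 0}, monoid.mult = (*), one = 1\<rparr>"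

definition log_abs :: "complex ^ 'n \<Rightarrow> real ^ 'n" where
  "log_abs z = (\<chi> i. ln (norm (z $ i)))"

definition trace_zero_hyperplane :: "(real ^ 'n) set" where
  "trace_zero_hyperplane = {x. (\<Sum>i\<in>UNIV. x $ i) = 0}"

text \<open>\<open>L\<close> is a (full) lattice of the real vector space \<open>H\<close>: the integer span of a basis of \<open>H\<close>.\<close>

definition lattice_in :: "'a::euclidean_space set \<Rightarrow> 'a set \<Rightarrow> bool" where
  "lattice_in H L \<longleftrightarrow>
     (\<exists>b. independent b \<and> span b = H \<and> L = {(\<Sum>x\<in>b. of_int (c x) *\<^sub>R x) | c :: 'a \<Rightarrow> int. True})"

text \<open>
  \<^const>\<open>log_abs\<close> is automatically a homomorphism on the torus, so it induces an isomorphism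
  of \<open>V\<close> onto its image as soon as it is injective on \<open>V\<close>.
\<close>

definition ctorus_lattice :: "(complex ^ 'n) set \<Rightarrow> bool" where
  "ctorus_lattice V \<longleftrightarrow>
     subgroup V ctorus \<and> inj_on log_abs V \<and> lattice_in trace_zero_hyperplane (log_abs ` V)"

definition Tr :: "complex ^ 'n \<Rightarrow> complex" where
  "Tr z = (\<Sum>i\<in>UNIV. z $ i)"

definition Nm :: "complex ^ 'n \<Rightarrow> complex" where
  "Nm z = (\<Prod>i\<in>UNIV. z $ i)"

definition proj_space :: "(complex ^ 'n) set set" where
  "proj_space = {L. vec.subspace L \<and> vec.dim L = 1}"

text \<open>An element \<open>(f\<^sub>1, \<dots>, f\<^sub>n)\<close> of \<open>X\<^sup>n\<close> is a function from the index type to lines.\<close>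

definition is_lift :: "('n \<Rightarrow> (complex ^ 'n) set) \<Rightarrow> ('n \<Rightarrow> complex ^ 'n) \<Rightarrow> bool" where
  "is_lift B f \<longleftrightarrow> (\<forall>i. f i \<in> B i \<and> f i \<noteq> 0)"

text \<open>The family \<open>e\<^sub>1, \<dots>, e\<^sub>n, f\<^sub>1, \<dots>, f\<^sub>n\<close>, indexed by two copies of the index type.\<close>

definition with_canonical :: "('n \<Rightarrow> complex ^ 'n) \<Rightarrow> 'n + 'n \<Rightarrow> complex ^ 'n" where
  "with_canonical f = case_sum (\<lambda>i. axis i 1) f"

text \<open>
  Linear independence of a subfamily is independence as a family, hence the injectivity
  requirement in addition to independence of the set of its values.
\<close>

definition Ugen :: "('n \<Rightarrow> (complex ^ 'n) set) set" where
  "Ugen = {B. (\<forall>i. B i \<in> proj_space) \<and>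
      (\<forall>f. is_lift B f \<longrightarrow>
        (\<forall>S :: ('n + 'n) set. card S = CARD('n) \<longrightarrow>
           inj_on (with_canonical f) S \<and> vec.independent (with_canonical f ` S)))}"

definition g_lift :: "('n \<Rightarrow> complex ^ 'n) \<Rightarrow> complex ^ 'n \<Rightarrow> complex" where
  "g_lift f z = det (\<chi> i j. f j $ i) / (\<Prod>i\<in>UNIV. Tr (f i * z))"

text \<open>
  Computed with a chosen lift; lemmas \<open>g_basis_eq\<close> and \<open>regular_at_iff\<close> below show that the
  choice is irrelevant.
\<close>

definition g_basis :: "('n \<Rightarrow> (complex ^ 'n) set) \<Rightarrow> complex ^ 'n \<Rightarrow> complex" where
  "g_basis B z = g_lift (SOME f. is_lift B f) z"

text \<open>
  The denominator of \<open>g\<^sub>B\<close> does not vanish at \<open>z\<close>.  This has to be stated because division by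
  zero is total here.
\<close>

definition regular_at :: "('n \<Rightarrow> (complex ^ 'n) set) \<Rightarrow> complex ^ 'n \<Rightarrow> bool" where
  "regular_at B z \<longleftrightarrow> (\<forall>f. is_lift B f \<longrightarrow> (\<forall>i. Tr (f i * z) \<noteq> 0))"

text \<open>
  \<open>\<int>[\<U>]\<close> is \<open>carrier (free_Abelian_group Ugen)\<close>; its elements are finitely supported
  integer-valued functions with support in \<open>\<U>\<close>.
\<close>

definition g_chain :: "(('n \<Rightarrow> (complex ^ 'n) set) \<Rightarrow>\<^sub>0 int) \<Rightarrow> complex ^ 'n \<Rightarrow> complex" where
  "g_chain c z = (\<Sum>B\<in>Poly_Mapping.keys c. of_int (Poly_Mapping.lookup c B) * g_basis B z)"

definition act :: "complex ^ 'n \<Rightarrow> ('n \<Rightarrow> (complex ^ 'n) set) \<Rightarrow> 'n \<Rightarrow> (complex ^ 'n) set" where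
  "act v B = (\<lambda>i. (*) v ` B i)"

definition act_chain ::
  "complex ^ 'n \<Rightarrow> (('n \<Rightarrow> (complex ^ 'n) set) \<Rightarrow>\<^sub>0 int) \<Rightarrow> (('n \<Rightarrow> (complex ^ 'n) set) \<Rightarrow>\<^sub>0 int)" where
  "act_chain v = frag_extend (\<lambda>B. frag_of (act v B))"

text \<open>
  The series over \<open>V\<close> carries no order, so its convergence at \<open>z\<close> means that every term is
  defined at \<open>z\<close> and that the family of terms is (unconditionally, equivalently absolutely)
  summable.
\<close>

definition series_converges_at ::
  "(complex ^ 'n) set \<Rightarrow> (('n \<Rightarrow> (complex ^ 'n) set) \<Rightarrow>\<^sub>0 int) \<Rightarrow> complex ^ 'n \<Rightarrow> bool" where
  "series_converges_at V c z \<longleftrightarrow>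
     (\<forall>v\<in>V. \<forall>B\<in>Poly_Mapping.keys (act_chain v c). regular_at B z) \<and>
     (\<lambda>v. g_chain (act_chain v c) z) summable_on V"

definition Shin :: "(complex ^ 'n) set \<Rightarrow> (('n \<Rightarrow> (complex ^ 'n) set) \<Rightarrow>\<^sub>0 int) set" where
  "Shin V = {c \<in> carrier (free_Abelian_group Ugen).
     \<forall>z\<in>carrier ctorus. series_converges_at V c z \<longrightarrow>
       1 / Nm z = (\<Sum>\<^sub>\<infinity>v\<in>V. g_chain (act_chain v c) z)}"

lemma group_ctorus: "group (ctorus :: (complex ^ 'n) monoid)"
proof (rule groupI)
  fix x :: "complex ^ 'n" assume "x \<in> carrier ctorus"
  then show "\<exists>y\<in>carrier ctorus. y \<otimes>\<^bsub>ctorus\<^esub> x = \<one>\<^bsub>ctorus\<^esub>"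
    by (intro bexI[of _ "\<chi> i. inverse (x $ i)"]) (auto simp: ctorus_def vec_eq_iff)
qed (auto simp: ctorus_def vec_eq_iff)

lemma proj_space_line:
  assumes L: "L \<in> proj_space" and f: "f \<in> L" "f \<noteq> 0" and h: "h \<in> L" "h \<noteq> 0"
  obtains k where "k \<noteq> 0" "h = k *s f"
proof -
  have "vec.dim L = 1" using L by (simp add: proj_space_def)
  moreover have "vec.independent {f}" using f by simp
  ultimately have "L \<subseteq> vec.span {f}"
    using f by (intro vec.card_ge_dim_independent) auto
  with h(1) obtain k where "h = k *s f" by (auto simp: vec.span_singleton)
  moreover from this h(2) have "k \<noteq> 0" by auto
  ultimately show ?thesis using that by blast
qed

lemma is_lift_scale:
  assumes B: "\<And>i. B i \<in> proj_space" and f: "is_lift B f" and h: "is_lift B h"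
  obtains k where "\<And>i. k i \<noteq> 0" "\<And>i. h i = k i *s f i"
proof -
  have "\<exists>k. k \<noteq> 0 \<and> h i = k *s f i" for i
    using f h unfolding is_lift_def by (metis proj_space_line[OF B[of i]])
  then show ?thesis using that by metis
qed

lemma Tr_scale: "Tr (k *s f * z) = k * Tr (f * z)"
  by (simp add: Tr_def sum_distrib_left mult.assoc)

lemma is_lift_ex:
  assumes "\<And>i. B i \<in> proj_space"
  shows "\<exists>f. is_lift B f"
proof -
  have "\<exists>x. x \<in> B i \<and> x \<noteq> 0" for i
    using assms[of i] vec.dim_eq_0[of "B i"] by (auto simp: proj_space_def)
  then show ?thesis unfolding is_lift_def by metis
qed

lemma g_basis_eq:
  assumes B: "\<And>i. B i \<in> proj_space" and f: "is_lift B f"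
  shows "g_basis B z = g_lift f z"
proof -
  define h where "h = (SOME f. is_lift B f)"
  have h: "is_lift B h" unfolding h_def using f by (rule someI[where P = "is_lift B"])
  obtain k where k: "\<And>i. k i \<noteq> 0" "\<And>i. h i = k i *s f i"
    using is_lift_scale[OF B f h] by metis
  have t: "det (\<chi> i j. g j $ i) = det (\<chi> i. g i)" for g :: "'a \<Rightarrow> complex ^ 'a"
    using det_transpose[of "\<chi> i. g i"] by (simp add: transpose_def)
  have "det (\<chi> i j. h j $ i) = (\<Prod>i\<in>UNIV. k i) * det (\<chi> i j. f j $ i)"
    unfolding t k(2) by (rule det_rows_mul)
  moreover have "(\<Prod>i\<in>UNIV. Tr (h i * z)) = (\<Prod>i\<in>UNIV. k i) * (\<Prod>i\<in>UNIV. Tr (f i * z))"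
    by (simp add: k(2) Tr_scale prod.distrib)
  moreover have "(\<Prod>i\<in>UNIV. k i) \<noteq> 0" using k(1) by simp
  ultimately show ?thesis unfolding g_basis_def h_def[symmetric] g_lift_def by simp
qed

lemma regular_at_iff:
  assumes B: "\<And>i. B i \<in> proj_space" and f: "is_lift B f"
  shows "regular_at B z \<longleftrightarrow> (\<forall>i. Tr (f i * z) \<noteq> 0)"
proof -
  have "Tr (h i * z) \<noteq> 0" if nz: "\<forall>i. Tr (f i * z) \<noteq> 0" and h: "is_lift B h" for h i
  proof -
    obtain k where "\<And>i. k i \<noteq> 0" "\<And>i. h i = k i *s f i"
      using is_lift_scale[OF B f h] by metis
    with nz show ?thesis by (simp add: Tr_scale)
  qed
  then show ?thesis using f unfolding regular_at_def by blast
qed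

end

theory Submission
  imports Defs
begin

text \<open>
  The functions \<open>g\<close> satisfy a cocycle relation (Cramer's rule), so the sum over \<open>V\<close> of the \<open>g\<close> of a
  triangulated fundamental parallelotope does not change when the vertices \<open>x * p\<close>, \<open>x \<in> V\<close>, are replaced
  by the basis vectors \<open>e\<^sub>m\<close> with \<open>norm (x $ m)\<close> maximal, provided that the sum over each simplex
  converges absolutely: the intermediate terms are bounded by the original ones.  What is left is
  \<open>1 / Nm z\<close> times the degree of a labelling of a lattice, which is computed as a volume, as in the
  proof of Sperner's lemma by volumes.

  Convergence of the series for a chain only controls sums of several simplices, which could
  cancel.  Therefore each simplex is used several times, with coefficients of sum \<open>\<plusminus>1\<close> and after
  translations by sparse powers of an element of \<open>V\<close> whose coordinates have distinct absolute values.
  At a given point fewer than \<open>n\<close> vectors in general position can produce small denominators, so one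
  of the copies is seen in isolation, and the sum over each simplex converges absolutely as well.
\<close>

section \<open>Determinants and Cramer relations\<close>

text \<open>Coning faces from their centres gives every vertex a type, and a simplex has one vertex
  of each type. Moving all vertices of type \<open>i\<close> by a common factor \<open>p i\<close>
  is thus compatible with shared faces and with translations by \<open>V\<close>, and leaves enough
  freedom for general position; with a single base point many flags would have repeated rows. The
  basis vector at a maximal coordinate keeps mixed terms under control. The product of the
  coordinates of \<open>x\<close> has absolute value 1, so replacing the row \<open>x * p i\<close>
  by \<open>axis m 1\<close> brings a factor \<open>1 / x $ m\<close>, of size
  \<open>1 / norm x\<close>, while the denominator that is lost is at most a multiple of
  \<open>norm x\<close>. A determinant of basis vectors vanishes unless they are a permutation of
  the basis, and then its denominator is \<open>Nm z\<close>. So the dependence on \<open>z\<close>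
  splits off and the remaining number can be computed at \<open>z = 1\<close>, where the same
  replacement argument turns labels into \<open>R + log_abs x\<close> with negative coordinates set
  to 0. The degree is a sign depending on the orientation of the generators; the coefficients of the
  chain compensate for it.\<close>

abbreviation rows_det :: "('n \<Rightarrow> complex ^ 'n) \<Rightarrow> complex" where
  "rows_det y \<equiv> det (\<chi> i. y i)"

definition g_rows :: "complex ^ 'n \<Rightarrow> ('n \<Rightarrow> complex ^ 'n) \<Rightarrow> complex" where
  "g_rows z y = rows_det y / (\<Prod>i\<in>UNIV. Tr (y i * z))"

lemma g_lift_eq_G: "g_lift y z = g_rows z y"
proof -
  have "(\<chi> i j. y j $ i) = transpose (\<chi> i. y i)"
    by (simp add: transpose_def)
  then show ?thesis by (simp add: g_lift_def g_rows_def)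
qed

lemma rows_det_upd_lin:
  "rows_det (y(k := \<Sum>m\<in>S. c m *s x m)) = (\<Sum>m\<in>S. c m * rows_det (y(k := x m)))"
  if "finite S"
proof -
  have *: "(\<chi> i. (y(k := a)) i) = (\<chi> i. if i = k then a else y i)" for a
    by (simp add: vec_eq_iff)
  have "rows_det (y(k := \<Sum>m\<in>S. c m *s x m)) = (\<Sum>m\<in>S. rows_det (y(k := c m *s x m)))"
    unfolding * using that by (rule det_linear_row_sum)
  also have "\<dots> = (\<Sum>m\<in>S. c m * rows_det (y(k := x m)))"
    unfolding * by (simp add: det_row_mul)
  finally show ?thesis .
qed

lemma rows_det_same: "rows_det y = 0" if "i \<noteq> j" "y i = y j"
  by (rule det_identical_rows[of i j]) (use that in \<open>auto simp: row_def vec_eq_iff\<close>)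

lemma rows_det_swap: "rows_det (y \<circ> Transposition.transpose i j) = - rows_det y" if "i \<noteq> j"
proof -
  have "rows_det (y \<circ> Transposition.transpose i j)
      = det (\<chi> m. (\<chi> i. y i) $ Transposition.transpose i j m)" by simp
  also have "\<dots> = of_int (sign (Transposition.transpose i j)) * rows_det y"
    by (rule det_permute_rows) (simp add: permutes_swap_id)
  finally show ?thesis using that by (simp add: sign_swap_id)
qed

text \<open>For a nonzero determinant this is Cramer's rule. Otherwise the right side must vanish: a
  linear relation \<open>c\<close> among the rows is proportional to the vector of the
  \<open>rows_det (y(l := w))\<close>. The degenerate case matters because label rows often
  coincide.\<close>

lemma rows_det_cramer:
  "rows_det y *s w = (\<Sum>l\<in>UNIV. rows_det (y(l := w)) *s y l)"
proof (cases "rows_det y = 0")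
  case False
  define A where "A = transpose (\<chi> i. y i)"
  have dA: "det A = rows_det y" by (simp add: A_def)
  then have "det A \<noteq> 0" using False by simp
  define x where "x = (\<chi> k. det (\<chi> i j. if j = k then w $ i else A $ i $ j) / det A)"
  have "A *v x = w" using cramer[OF \<open>det A \<noteq> 0\<close>, of x w] by (simp add: x_def)
  have xk: "det A * x $ k = rows_det (y(k := w))" for k
  proof -
    have "(\<chi> i j. if j = k then w $ i else A $ i $ j) = transpose (\<chi> i. (y(k := w)) i)"
      by (auto simp: vec_eq_iff A_def transpose_def)
    then show ?thesis using False dA by (simp add: x_def)
  qed
  have "w = (\<Sum>l\<in>UNIV. x $ l *s y l)"
    using \<open>A *v x = w\<close> by (auto simp: vec_eq_iff matrix_vector_mult_def A_def transpose_def mult.commute)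
  then have "rows_det y *s w = rows_det y *s (\<Sum>l\<in>UNIV. x $ l *s y l)" by simp
  also have "\<dots> = (\<Sum>l\<in>UNIV. (det A * x $ l) *s y l)"
    by (simp add: vec.scale_sum_right dA)
  finally show ?thesis by (simp add: xk)
next
  case True
  then have "\<not> invertible (\<chi> i. y i)" by (simp add: invertible_det_nz)
  then obtain c j where c: "(\<Sum>i\<in>UNIV. c i *s y i) = 0" "c j \<noteq> 0"
    by (auto simp: invertible_right_inverse matrix_right_invertible_independent_rows row_def)
  have key: "c j * rows_det (y(l := w)) = c l * rows_det (y(j := w))" for l
  proof (cases "l = j")
    case False
    \<comment> \<open>Row \<open>j\<close> is replaced by the relation, which is zero; expanding it
      leaves only the terms \<open>j\<close> and \<open>l\<close>, since any other row would then
      occur twice.\<close>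
    have "0 = rows_det ((y(l := w))(j := \<Sum>i\<in>UNIV. c i *s y i))"
      unfolding c(1) by (rule det_zero_row(1)[where i=j, symmetric]) (simp add: row_def vec_eq_iff)
    also have "\<dots> = (\<Sum>i\<in>UNIV. c i * rows_det ((y(l := w))(j := y i)))"
      by (rule rows_det_upd_lin) simp
    also have "\<dots> = (\<Sum>i\<in>{j, l}. c i * rows_det ((y(l := w))(j := y i)))"
    proof (rule sum.mono_neutral_right)
      have "rows_det ((y(l := w))(j := y i)) = 0" if "i \<noteq> j" "i \<noteq> l" for i
        by (rule rows_det_same[of j i]) (use that in auto)
      then show "\<forall>i\<in>UNIV - {j, l}. c i * rows_det ((y(l := w))(j := y i)) = 0" by simp
    qed auto
    also have "\<dots> = c j * rows_det (y(l := w)) + c l * rows_det ((y(l := w))(j := y l))"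
      using False by (simp add: fun_upd_idem del: fun_upd_apply) (simp add: fun_upd_idem)
    also have "(y(l := w))(j := y l) = (y(j := w)) \<circ> Transposition.transpose l j"
      using False by (auto simp: fun_eq_iff Transposition.transpose_def)
    also have "rows_det \<dots> = - rows_det (y(j := w))" using False by (rule rows_det_swap)
    finally show ?thesis by simp
  qed simp
  have "c j *s (\<Sum>l\<in>UNIV. rows_det (y(l := w)) *s y l)
      = (\<Sum>l\<in>UNIV. (c l * rows_det (y(j := w))) *s y l)"
    by (simp add: vec.scale_sum_right key del: fun_upd_apply)
  also have "\<dots> = rows_det (y(j := w)) *s (\<Sum>l\<in>UNIV. c l *s y l)"
    by (simp add: vec.scale_sum_right mult.commute del: fun_upd_apply)
  finally show ?thesis using c(2) unfolding c(1) True by simp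
qed

lemma Tr_sum: "Tr (sum f S) = (\<Sum>s\<in>S. Tr (f s))"
  unfolding Tr_def by (simp add: sum.swap[of _ UNIV])

text \<open>Cramer's relation for \<open>w\<close>, multiplied by \<open>z\<close>, traced, and
  divided by the product of all \<open>CARD('n) + 1\<close> traces: the cocycle relation for a
  simplex with the extra vertex \<open>w\<close>.\<close>

lemma g_rows_replace:
  assumes y: "\<And>i. Tr (y i * z) \<noteq> 0" and w: "Tr (w * z) \<noteq> 0"
  shows "g_rows z y = (\<Sum>l\<in>UNIV. g_rows z (y(l := w)))"
proof -
  let ?P = "\<Prod>i\<in>UNIV. Tr (y i * z)"
  have P: "?P \<noteq> 0" using y by simp
  have "rows_det y * Tr (w * z) = Tr ((rows_det y *s w) * z)" by (simp add: Tr_scale)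
  also have "\<dots> = (\<Sum>l\<in>UNIV. rows_det (y(l := w)) * Tr (y l * z))"
    by (subst rows_det_cramer) (simp add: sum_distrib_right Tr_sum Tr_scale)
  finally have *: "rows_det y * Tr (w * z) = \<dots>" .
  have "g_rows z (y(l := w)) = rows_det (y(l := w)) * Tr (y l * z) / (?P * Tr (w * z))" for l
  proof -
    have "(\<Prod>i\<in>UNIV. Tr ((y(l := w)) i * z)) * Tr (y l * z) = ?P * Tr (w * z)"
      by (subst (1 2) prod.remove[of _ l]) (auto intro!: prod.cong)
    then have "\<dots> = (\<Prod>i\<in>UNIV. Tr ((y(l := w)) i * z)) * Tr (y l * z)" by simp
    then show ?thesis unfolding g_rows_def using y[of l] by (simp del: fun_upd_apply)
  qed
  then have "(\<Sum>l\<in>UNIV. g_rows z (y(l := w))) = (rows_det y * Tr (w * z)) / (?P * Tr (w * z))"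
    by (simp add: sum_divide_distrib[symmetric] *)
  then show ?thesis using w by (simp add: g_rows_def)
qed

lemma rows_det_mult: "rows_det (\<lambda>i. v * y i) = Nm v * rows_det y"
proof -
  have "transpose (\<chi> i. v * y i) = (\<chi> j. v $ j *s (transpose (\<chi> i. y i)) $ j)"
    by (simp add: vec_eq_iff transpose_def)
  then have "det (transpose (\<chi> i. v * y i)) = Nm v * det (transpose (\<chi> i. y i))"
    by (simp add: det_rows_mul Nm_def)
  then show ?thesis by simp
qed

lemma rows_det_scale: "rows_det (\<lambda>i. c i *s y i) = (\<Prod>i\<in>UNIV. c i) * rows_det y"
  by (rule det_rows_mul)

lemma rows_det_zero_coord: "rows_det y = 0" if "\<And>i. y i $ j = 0"
proof -
  have "column j (\<chi> i. y i) = 0" using that by (simp add: column_def vec_eq_iff)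
  then show ?thesis by (rule det_zero_column)
qed

section \<open>Dominant permutations\<close>

text \<open>Exchanging an inverted pair of rows increases the value, so a maximizer is the unique
  order-preserving permutation on \<open>-E\<close>.\<close>

lemma rearrangement_unique:
  fixes \<mu> la :: "'n::finite \<Rightarrow> real"
  assumes al: "inj_on \<alpha> E" and mu: "inj_on \<mu> (- E)" and la: "inj la"
    and p: "p permutes UNIV" "\<forall>k\<in>E. p k = \<alpha> k"
    and q: "q permutes UNIV" "\<forall>k\<in>E. q k = \<alpha> k"
    and pmax: "\<And>s. s permutes UNIV \<Longrightarrow> \<forall>k\<in>E. s k = \<alpha> k \<Longrightarrow>
        (\<Sum>k\<in>-E. \<mu> k * la (s k)) \<le> (\<Sum>k\<in>-E. \<mu> k * la (p k))"
    and qmax: "\<And>s. s permutes UNIV \<Longrightarrow> \<forall>k\<in>E. s k = \<alpha> k \<Longrightarrow>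
        (\<Sum>k\<in>-E. \<mu> k * la (s k)) \<le> (\<Sum>k\<in>-E. \<mu> k * la (q k))"
  shows "p = q"
proof -
  have mono: "la (s k) < la (s l)"
    if s: "s permutes UNIV" "\<forall>k\<in>E. s k = \<alpha> k"
      and smax: "\<And>s'. s' permutes UNIV \<Longrightarrow> \<forall>k\<in>E. s' k = \<alpha> k \<Longrightarrow>
        (\<Sum>k\<in>-E. \<mu> k * la (s' k)) \<le> (\<Sum>k\<in>-E. \<mu> k * la (s k))"
      and kl: "k \<in> -E" "l \<in> -E" "\<mu> k < \<mu> l" for s k l
  proof (rule ccontr)
    assume "\<not> la (s k) < la (s l)"
    moreover have "k \<noteq> l" using kl by auto
    then have "la (s k) \<noteq> la (s l)"
      using la permutes_inj[OF s(1)] by (metis injD)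
    ultimately have lt: "la (s l) < la (s k)" by simp
    let ?s = "s \<circ> Transposition.transpose k l"
    have s': "?s permutes UNIV"
      by (intro permutes_compose s(1) permutes_swap_id) auto
    have "\<forall>m\<in>E. ?s m = \<alpha> m"
    proof
      fix m assume "m \<in> E"
      then have "m \<noteq> k" "m \<noteq> l" using kl by auto
      then show "?s m = \<alpha> m" using s(2) \<open>m \<in> E\<close> by simp
    qed
    from smax[OF s' this]
    have "(\<Sum>m\<in>-E. \<mu> m * la (?s m)) \<le> (\<Sum>m\<in>-E. \<mu> m * la (s m))" .
    moreover have "(\<Sum>m\<in>-E. \<mu> m * la (f m))
        = \<mu> k * la (f k) + (\<mu> l * la (f l) + (\<Sum>m\<in>-E-{k}-{l}. \<mu> m * la (f m)))" for f :: "'n \<Rightarrow> 'n"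
      using kl \<open>k \<noteq> l\<close> by (subst sum.remove[of _ k], simp, simp, subst sum.remove[of _ l]) auto
    moreover have "(\<Sum>m\<in>-E-{k}-{l}. \<mu> m * la (?s m)) = (\<Sum>m\<in>-E-{k}-{l}. \<mu> m * la (s m))"
      by (intro sum.cong) auto
    ultimately have "\<mu> k * la (s l) + \<mu> l * la (s k) \<le> \<mu> k * la (s k) + \<mu> l * la (s l)"
      by simp
    then have "(\<mu> l - \<mu> k) * (la (s k) - la (s l)) \<le> 0" by (simp add: algebra_simps)
    then show False using kl lt by (smt (verit) mult_pos_pos)
  qed
  have iff: "la (s k) < la (s l) \<longleftrightarrow> \<mu> k < \<mu> l"
    if s: "s permutes UNIV" "\<forall>k\<in>E. s k = \<alpha> k"
      and smax: "\<And>s'. s' permutes UNIV \<Longrightarrow> \<forall>k\<in>E. s' k = \<alpha> k \<Longrightarrow>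
        (\<Sum>k\<in>-E. \<mu> k * la (s' k)) \<le> (\<Sum>k\<in>-E. \<mu> k * la (s k))"
      and kl: "k \<in> -E" "l \<in> -E" for s k l
  proof -
    have "\<mu> k < \<mu> l \<or> \<mu> l < \<mu> k \<or> k = l"
      using inj_onD[OF mu _ kl] by fastforce
    then show ?thesis using mono[OF s smax kl] mono[OF s smax kl(2,1)] by fastforce
  qed
  have img: "s ` (-E) = - (\<alpha> ` E)" if "s permutes UNIV" "\<forall>k\<in>E. s k = \<alpha> k" for s
  proof -
    have "bij s" using that(1) by (rule permutes_bij)
    then have "s ` (-E) = - (s ` E)" by (rule bij_image_Compl_eq)
    also have "s ` E = \<alpha> ` E" using that(2) by auto
    finally show ?thesis .
  qed
  \<comment> \<open>By \<open>iff\<close> and \<open>img\<close>, \<open>s\<close> maps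
    \<open>-E\<close>, ordered by \<mu>, onto the complement of the image of \<open>E\<close> and
    preserves the order. So the rank of \<open>k\<close> determines \<open>s k\<close>, and
    \<open>p\<close> and \<open>q\<close> agree.\<close>
  have eq_card: "card {x \<in> - (\<alpha> ` E). la x < la (s k)} = card {l\<in>-E. \<mu> l < \<mu> k}"
    if s: "s permutes UNIV" "\<forall>k\<in>E. s k = \<alpha> k"
      and smax: "\<And>s'. s' permutes UNIV \<Longrightarrow> \<forall>k\<in>E. s' k = \<alpha> k \<Longrightarrow>
        (\<Sum>k\<in>-E. \<mu> k * la (s' k)) \<le> (\<Sum>k\<in>-E. \<mu> k * la (s k))"
      and k: "k \<in> -E" for s k
  proof -
    have "{x \<in> - (\<alpha> ` E). la x < la (s k)} = s ` {l\<in>-E. \<mu> l < \<mu> k}"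
    proof -
      have "la (s l) < la (s k) \<longleftrightarrow> \<mu> l < \<mu> k" if "l \<in> -E" for l
        by (rule iff[OF s smax that k])
      then show ?thesis unfolding img[OF s, symmetric] by blast
    qed
    then show ?thesis
      using card_image[OF inj_on_subset[OF permutes_inj[OF s(1)]]] by simp
  qed
  have card_inj: "x = y"
    if "card {w\<in>S. la w < la x} = card {w\<in>S. la w < la y}" "x \<in> S" "y \<in> S" for x y and S :: "'n set"
  proof (rule ccontr)
    assume "x \<noteq> y"
    then consider "la x < la y" | "la y < la x" using la by (metis injD linorder_neqE)
    then show False
    proof cases
      case 1
      then have "{w\<in>S. la w < la x} \<subset> {w\<in>S. la w < la y}" using that by auto
      from psubset_card_mono[OF _ this] show False using that(1) by simp
    next
      case 2
      then have "{w\<in>S. la w < la y} \<subset> {w\<in>S. la w < la x}" using that by auto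
      from psubset_card_mono[OF _ this] show False using that(1) by simp
    qed
  qed
  show "p = q"
  proof
    fix k
    show "p k = q k"
    proof (cases "k \<in> E")
      case False
      then have "p k \<in> - (\<alpha> ` E)" "q k \<in> - (\<alpha> ` E)" using img[OF p] img[OF q] by blast+
      moreover have "card {x \<in> - (\<alpha> ` E). la x < la (p k)} = card {l\<in>-E. \<mu> l < \<mu> k}"
        by (rule eq_card[OF p pmax]) (use False in auto)
      moreover have "card {x \<in> - (\<alpha> ` E). la x < la (q k)} = card {l\<in>-E. \<mu> l < \<mu> k}"
        by (rule eq_card[OF q qmax]) (use False in auto)
      ultimately show ?thesis using card_inj[of "- (\<alpha> ` E)" "p k" "q k"] by simp
    qed (use p q in simp)
  qed
qed

definition gpow :: "complex ^ 'n \<Rightarrow> int \<Rightarrow> complex ^ 'n" where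
  "gpow g m = (\<chi> i. (g $ i) powi m)"

text \<open>After division by \<open>x p ^ t\<close> all terms except the dominant one tend to 0, so
  the sum tends to \<open>c p\<close>.\<close>

lemma eventually_dominant_sum_nonzero:
  fixes c :: "'a \<Rightarrow> complex" and x :: "'a \<Rightarrow> complex"
  assumes fin: "finite S" and p: "p \<in> S" "c p \<noteq> 0" "x p \<noteq> 0"
    and dom: "\<And>q. q \<in> S \<Longrightarrow> q \<noteq> p \<Longrightarrow> norm (x q) < norm (x p)"
  shows "\<forall>\<^sub>F t in sequentially. (\<Sum>q\<in>S. c q * x q ^ t) \<noteq> 0"
proof -
  have "(\<lambda>t. \<Sum>q\<in>S. c q * (x q / x p) ^ t) \<longlonglongrightarrow> (\<Sum>q\<in>S. if q = p then c p else 0)"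
  proof (rule tendsto_sum)
    fix q assume q: "q \<in> S"
    show "(\<lambda>t. c q * (x q / x p) ^ t) \<longlonglongrightarrow> (if q = p then c p else 0)"
    proof (cases "q = p")
      case False
      then have "norm (x q / x p) < 1" using dom[OF q] p by (simp add: norm_divide divide_less_eq)
      then have "(\<lambda>t. c q * (x q / x p) ^ t) \<longlonglongrightarrow> c q * 0"
        by (intro tendsto_mult tendsto_const LIMSEQ_power_zero)
      then show ?thesis using False by simp
    qed (use p in simp)
  qed
  also have "(\<Sum>q\<in>S. if q = p then c p else 0) = c p" using fin p by simp
  finally have "\<forall>\<^sub>F t in sequentially. (\<Sum>q\<in>S. c q * (x q / x p) ^ t) \<noteq> 0"
    by (rule tendsto_imp_eventually_ne) (rule p)
  then show ?thesis
  proof eventually_elim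
    case (elim t)
    have "(\<Sum>q\<in>S. c q * x q ^ t) = x p ^ t * (\<Sum>q\<in>S. c q * (x q / x p) ^ t)"
      using p by (simp add: sum_distrib_left power_divide)
    then show ?case using elim p by simp
  qed
qed

text \<open>In the Leibniz expansion the basis rows keep only the permutations extending \<alpha>.
  Such a \<open>q\<close> contributes a constant times \<open>X q ^ t\<close>, where
  \<open>ln (norm (X q))\<close> is the sum of \<open>\<mu> k * ln (norm (g $ q k))\<close> over
  \<open>k\<close> outside \<open>E\<close>; by the rearrangement lemma one permutation dominates.
  Both choices of data in general position rest on this lemma.\<close>

lemma eventually_rows_det_nonzero:
  fixes g :: "complex ^ 'n" and x :: "'n \<Rightarrow> complex ^ 'n" and \<mu> :: "'n \<Rightarrow> int"
  assumes g: "\<And>i. g $ i \<noteq> 0" "inj (\<lambda>i. norm (g $ i))"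
    and al: "inj_on \<alpha> E" and mu: "inj_on \<mu> (- E)" and x: "\<And>k i. k \<notin> E \<Longrightarrow> x k $ i \<noteq> 0"
  shows "\<forall>\<^sub>F t in sequentially.
    rows_det (\<lambda>k. if k \<in> E then axis (\<alpha> k) 1 else x k * gpow g (int t * \<mu> k)) \<noteq> 0"
proof -
  define S where "S = {p. p permutes (UNIV :: 'n set) \<and> (\<forall>k\<in>E. p k = \<alpha> k)}"
  define la where "la i = ln (norm (g $ i))" for i
  have la: "inj la"
  proof (rule injI)
    fix i j assume "la i = la j"
    then have "norm (g $ i) = norm (g $ j)" using g(1) by (simp add: la_def)
    then show "i = j" using g(2) by (auto dest: injD)
  qed
  define W where "W p = (\<Sum>k\<in>-E. real_of_int (\<mu> k) * la (p k))" for p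
  have finS: "finite S" unfolding S_def by (rule finite_subset[OF _ finite_permutations[of UNIV]]) auto
  have "S \<noteq> {}"
  proof -
    have "card (- E) = card (- (\<alpha> ` E))" by (simp add: card_image[OF al] Compl_eq_Diff_UNIV card_Diff_subset)
    then obtain h where h: "bij_betw h (- E) (- (\<alpha> ` E))"
      using finite_same_card_bij[of "-E" "- (\<alpha> ` E)"] by auto
    have "bij_betw (\<lambda>k. if k \<in> E then \<alpha> k else h k) (E \<union> - E) (\<alpha> ` E \<union> - (\<alpha> ` E))"
      using al h by (intro bij_betw_disjoint_Un) (auto simp: bij_betw_def)
    then have "(\<lambda>k. if k \<in> E then \<alpha> k else h k) permutes UNIV"
      by (intro bij_imp_permutes) (simp_all add: Un_commute)
    then show ?thesis unfolding S_def by auto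
  qed
  then obtain p where p: "p \<in> S" "\<And>q. q \<in> S \<Longrightarrow> W q \<le> W p"
    using finS obtains_MAX[of S W] by (metis (no_types, lifting) Max_ge finite_imageI imageI)
  have uniq: "W q < W p" if "q \<in> S" "q \<noteq> p" for q
  proof (rule ccontr)
    assume "\<not> W q < W p"
    then have "W q = W p" using p(2)[OF that(1)] by simp
    have "p = q"
    proof (rule rearrangement_unique[OF al _ la])
      show "inj_on (\<lambda>k. real_of_int (\<mu> k)) (- E)" using mu by (auto simp: inj_on_def)
    qed (use p that \<open>W q = W p\<close> in \<open>auto simp: S_def W_def\<close>)
    then show False using that by simp
  qed
  define X where "X q = (\<Prod>k\<in>-E. (g $ q k) powi \<mu> k)" for q
  define c where "c q = (of_int (sign q) * (\<Prod>k\<in>-E. x k $ q k) :: complex)" for q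
  have Xexp: "norm (X q) = exp (W q)" for q
  proof -
    have "norm ((g $ q k) powi \<mu> k) = exp (real_of_int (\<mu> k) * la (q k))" for k
    proof -
      have "norm ((g $ q k) powi \<mu> k) = norm (g $ q k) powi \<mu> k" by (simp add: norm_power_int)
      also have "\<dots> = norm (g $ q k) powr real_of_int (\<mu> k)" using g by (simp add: powr_real_of_int')
      also have "\<dots> = exp (real_of_int (\<mu> k) * la (q k))" using g by (simp add: powr_def la_def)
      finally show ?thesis .
    qed
    then show ?thesis by (simp add: X_def W_def exp_sum flip: prod_norm)
  qed
  have "\<forall>\<^sub>F t in sequentially. (\<Sum>q\<in>S. c q * X q ^ t) \<noteq> 0"
  proof (rule eventually_dominant_sum_nonzero[OF finS p(1)])
    show "c p \<noteq> 0" using x by (simp add: c_def sign_def)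
    have "norm (X p) \<noteq> 0" unfolding Xexp by simp
    then show "X p \<noteq> 0" by simp
  qed (use uniq Xexp in auto)
  moreover have "rows_det (\<lambda>k. if k \<in> E then axis (\<alpha> k) 1 else x k * gpow g (int t * \<mu> k))
      = (\<Sum>q\<in>S. c q * X q ^ t)" for t
  proof -
    let ?y = "\<lambda>k. if k \<in> E then axis (\<alpha> k) 1 else x k * gpow g (int t * \<mu> k)"
    have split: "(\<Prod>k\<in>UNIV. ?y k $ q k) = (\<Prod>k\<in>E. ?y k $ q k) * (\<Prod>k\<in>-E. ?y k $ q k)" for q
      using prod.union_disjoint[of E "-E" "\<lambda>k. ?y k $ q k"] by (simp add: Compl_partition)
    have "rows_det ?y = (\<Sum>q\<in>{q. q permutes UNIV}. of_int (sign q) * (\<Prod>k\<in>UNIV. ?y k $ q k))"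
      by (simp add: det_def)
    also have "\<dots> = (\<Sum>q\<in>S. of_int (sign q) * (\<Prod>k\<in>UNIV. ?y k $ q k))"
    proof (rule sum.mono_neutral_right)
      show "\<forall>q\<in>{q. q permutes UNIV} - S. of_int (sign q) * (\<Prod>k\<in>UNIV. ?y k $ q k) = 0"
      proof
        fix q assume "q \<in> {q. q permutes (UNIV :: 'n set)} - S"
        then obtain k where "k \<in> E" "q k \<noteq> \<alpha> k" by (auto simp: S_def)
        then have "?y k $ q k = 0" by (simp add: axis_def)
        then have "(\<Prod>k\<in>UNIV. ?y k $ q k) = 0" by (intro prod_zero bexI[of _ k]) auto
        then show "of_int (sign q) * (\<Prod>k\<in>UNIV. ?y k $ q k) = 0" by simp
      qed
    qed (auto simp: S_def finite_permutations)
    also have "\<dots> = (\<Sum>q\<in>S. c q * X q ^ t)"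
    proof (rule sum.cong)
      fix q assume q: "q \<in> S"
      have "(\<Prod>k\<in>E. ?y k $ q k) = 1" using q by (intro prod.neutral) (auto simp: S_def axis_def)
      moreover have "(\<Prod>k\<in>-E. ?y k $ q k) = (\<Prod>k\<in>-E. x k $ q k) * X q ^ t"
      proof -
        have "(\<Prod>k\<in>-E. ?y k $ q k) = (\<Prod>k\<in>-E. x k $ q k * ((g $ q k) powi \<mu> k) ^ t)"
          by (intro prod.cong) (auto simp: gpow_def power_int_mult mult.commute[of "int t"])
        then show ?thesis by (simp add: X_def prod.distrib prod_power_distrib)
      qed
      ultimately show "of_int (sign q) * (\<Prod>k\<in>UNIV. ?y k $ q k) = c q * X q ^ t"
        by (subst split) (simp add: c_def)
    qed simp
    finally show ?thesis .
  qed
  ultimately show ?thesis by simp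
qed

section \<open>Flags of a cube and replacement of vertices\<close>

lemma sum_involution_zero:
  fixes h :: "'a \<Rightarrow> complex"
  assumes "\<And>w. w \<in> S \<Longrightarrow> p w \<in> S" "\<And>w. w \<in> S \<Longrightarrow> p (p w) = w" "\<And>w. w \<in> S \<Longrightarrow> h (p w) = - h w"
  shows "sum h S = 0"
proof -
  have "sum h S = (\<Sum>w\<in>S. - h w)"
    by (rule sum.reindex_bij_witness[of S p p]) (use assms in auto)
  then show ?thesis by (simp add: sum_negf)
qed

lemma has_sum_sum:
  fixes f :: "'a \<Rightarrow> 'b \<Rightarrow> 'c::topological_comm_monoid_add"
  assumes "finite W" "\<And>w. w \<in> W \<Longrightarrow> (f w has_sum S w) A"
  shows "((\<lambda>x. \<Sum>w\<in>W. f w x) has_sum (\<Sum>w\<in>W. S w)) A"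
  using assms by (induction W rule: finite_induct) (auto intro: has_sum_add)

text \<open>
  \<open>flags\<close> indexes the top simplices of the cube spanned by the \<open>v k\<close>, each face being coned off from
  its centre.  In the pair \<open>(s, e)\<close> the permutation \<open>s\<close> lists the directions in the order in which they
  are frozen and \<open>e\<close> is the set of directions frozen at the end \<open>1\<close>.  The vertex of type \<open>i\<close> is the
  centre of a face of codimension \<open>r i\<close>; \<open>vert\<close> is the element of \<open>V\<close> by which that face is translated,
  and the direction \<open>i0\<close> is a dummy.
\<close>

locale flag_complex =
  fixes V :: "(complex ^ 'n) set" and r :: "'n \<Rightarrow> nat" and i0 :: 'n
    and v :: "'n \<Rightarrow> complex ^ 'n"
  assumes one_in: "1 \<in> V" and mult_in: "\<And>x y. x \<in> V \<Longrightarrow> y \<in> V \<Longrightarrow> x * y \<in> V"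
    and inverse_in: "\<And>x. x \<in> V \<Longrightarrow> \<exists>y\<in>V. x * y = 1"
    and r_bij: "bij_betw r UNIV {..<CARD('n)}" and r_i0: "r i0 = 0"
    and v_in: "\<And>k. v k \<in> V"
begin

definition front :: "'n \<Rightarrow> 'n set" where "front i = {j. 0 < r j \<and> r j \<le> r i}"

definition flags :: "(('n \<Rightarrow> 'n) \<times> 'n set) set" where
  "flags = {s. s permutes UNIV - {i0}} \<times> Pow (UNIV - {i0})"

definition fsign :: "('n \<Rightarrow> 'n) \<times> 'n set \<Rightarrow> int" where
  "fsign w = sign (fst w) * (- 1) ^ card (snd w)"

definition vert :: "('n \<Rightarrow> 'n) \<times> 'n set \<Rightarrow> 'n \<Rightarrow> complex ^ 'n" where
  "vert w i = (\<Prod>k\<in>snd w \<inter> fst w ` front i. v k)"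

lemma r_eq_iff: "r i = r j \<longleftrightarrow> i = j"
  using r_bij by (auto simp: bij_betw_def dest: injD)

lemma r_less: "r i < CARD('n)"
  using r_bij by (auto simp: bij_betw_def)

lemma r_ex: "m < CARD('n) \<Longrightarrow> \<exists>i. r i = m"
  using r_bij by (metis bij_betw_imp_surj_on imageE lessThan_iff)

lemma finite_flags: "finite flags"
  unfolding flags_def by (intro finite_cartesian_product finite_permutations) auto

lemma prod_in: "finite A \<Longrightarrow> (\<Prod>k\<in>A. v k) \<in> V"
  by (induction A rule: finite_induct) (auto intro: one_in mult_in v_in)

lemma vert_in: "vert w i \<in> V"
  unfolding vert_def by (rule prod_in) simp

lemma bij_mult:
  assumes "w \<in> V"
  shows "bij_betw (\<lambda>x. x * w) V V"
proof -
  obtain y where y: "y \<in> V" "w * y = 1" using inverse_in[OF assms] by blast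
  have c: "x * w * y = x" "x * y * w = x" for x
    using y by (simp_all add: mult.assoc mult.commute[of y])
  show ?thesis
    by (rule bij_betw_byWitness[of _ "\<lambda>x. x * y"]) (use y assms c mult_in in auto)
qed

lemma has_sum_mult:
  assumes "w \<in> V"
  shows "((\<lambda>x. f (x * w)) has_sum S) V \<longleftrightarrow> (f has_sum S) V"
  using has_sum_reindex_bij_betw[OF bij_mult[OF assms], of f S] by simp

text \<open>Exchanges the two ends of the direction \<open>a\<close>, that is, passes to the
  opposite face.\<close>

definition toggle :: "'n \<Rightarrow> 'n set \<Rightarrow> 'n set" where
  "toggle a e = (if a \<in> e then e - {a} else insert a e)"

lemma toggle_toggle: "toggle a (toggle a e) = e"
  by (auto simp: toggle_def)

lemma fsign_toggle: "fsign (s, toggle a e) = - fsign (s, e)"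
proof (cases "a \<in> e")
  case True
  then have "card e = Suc (card (e - {a}))" by (intro card.remove) auto
  then have "(- 1) ^ card e = - ((- 1) ^ card (e - {a}) :: int)"
    by (metis power_Suc mult_minus1)
  then show ?thesis using True by (simp add: fsign_def toggle_def del: card_Diff_insert)
qed (simp add: fsign_def toggle_def)

lemma permutes_i0: "s permutes UNIV - {i0} \<Longrightarrow> a \<noteq> i0 \<Longrightarrow> s a \<noteq> i0"
  by (metis DiffD2 DiffI UNIV_I permutes_in_image singleton_iff)

lemma toggle_in: "(s, e) \<in> flags \<Longrightarrow> a \<noteq> i0 \<Longrightarrow> (s, toggle (s a) e) \<in> flags"
  using permutes_i0 by (auto simp: flags_def toggle_def)

lemma inj_flag: "(s, e) \<in> flags \<Longrightarrow> s a = s b \<longleftrightarrow> a = b"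
  unfolding flags_def using permutes_inj by (auto dest: injD)

text \<open>The face opposite a vertex of type \<open>j \<noteq> i0\<close> lies in two flags of
  opposite sign. If \<open>j\<close> is not the last type, the directions frozen at the steps
  \<open>j\<close> and \<open>j'\<close> can be interchanged; at the last type the flag runs through
  an edge of the cube, whose two ends are interchanged by \<open>toggle\<close>.\<close>

lemma face_cancel:
  assumes j: "j \<noteq> i0" and h: "\<And>w w'. (\<And>m. m \<noteq> j \<Longrightarrow> vert w m = vert w' m) \<Longrightarrow> h w = h w'"
  shows "(\<Sum>w\<in>flags. of_int (fsign w) * h w) = (0 :: complex)"
proof (cases "Suc (r j) < CARD('n)")
  case True
  then obtain j' where j': "r j' = Suc (r j)" using r_ex by blast
  have ne: "j \<noteq> j'" using j' by auto
  have "0 < r j" using j r_i0 r_eq_iff by (metis gr0I)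
  then have j'0: "j' \<noteq> i0" using j' r_i0 by auto
  let ?t = "Transposition.transpose j j'"
  let ?p = "\<lambda>w. (fst w \<circ> ?t, snd w)"
  have tp: "?t permutes UNIV - {i0}" using j j'0 by (intro permutes_swap_id) auto
  show ?thesis
  proof (rule sum_involution_zero[of _ ?p])
    fix w assume w: "w \<in> flags"
    then have s: "fst w permutes UNIV - {i0}" by (auto simp: flags_def)
    show "?p w \<in> flags" using w permutes_compose[OF tp s] by (auto simp: flags_def)
    show "?p (?p w) = w" by (simp add: comp_assoc)
    have "sign (fst w \<circ> ?t) = - sign (fst w)"
      using ne s tp by (subst sign_compose) (auto simp: sign_swap_id permutation_permutes)
    then have "fsign (?p w) = - fsign w" by (simp add: fsign_def)
    moreover have "h (?p w) = h w"
    proof (rule h)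
      fix m assume m: "m \<noteq> j"
      have iff: "j \<in> front m \<longleftrightarrow> j' \<in> front m"
        using m \<open>0 < r j\<close> j' r_eq_iff[of m j] by (auto simp: front_def)
      have "?t ` front m = front m"
      proof -
        have t: "?t x \<in> front m" if "x \<in> front m" for x
        proof -
          have "(x = j \<and> ?t x = j') \<or> (x = j' \<and> ?t x = j) \<or> ?t x = x"
            by (cases "x = j"; cases "x = j'") (simp_all only: transpose_apply_first transpose_apply_second
                transpose_apply_other not_False_eq_True simp_thms)
          then show ?thesis using that iff by metis
        qed
        have "x \<in> ?t ` front m" if "x \<in> front m" for x
          by (rule image_eqI[of _ _ "?t x"]) (use t[OF that] in auto)
        with t show ?thesis by blast
      qed
      then have "(fst w \<circ> ?t) ` front m = fst w ` front m" by (metis image_comp)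
      then show "vert (?p w) m = vert w m" by (simp only: vert_def fst_conv snd_conv)
    qed
    ultimately show "of_int (fsign (?p w)) * h (?p w) = - (of_int (fsign w) * h w)" by simp
  qed
next
  case False
  let ?p = "\<lambda>w. (fst w, toggle (fst w j) (snd w))"
  show ?thesis
  proof (rule sum_involution_zero[of _ ?p])
    fix w assume w: "w \<in> flags"
    obtain s e where se: "w = (s, e)" by (cases w)
    show "?p w \<in> flags" using w toggle_in j by (simp add: se)
    show "?p (?p w) = w" by (simp add: toggle_toggle)
    have "fsign (?p w) = - fsign w" by (simp add: fsign_toggle se)
    moreover have "h (?p w) = h w"
    proof (rule h)
      fix m assume m: "m \<noteq> j"
      then have "r m < r j" using False r_less[of m] r_eq_iff[of m j] by linarith
      then have "j \<notin> front m" by (auto simp: front_def)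
      then have "s j \<notin> s ` front m" using inj_flag w se by auto
      then have "toggle (s j) e \<inter> s ` front m = e \<inter> s ` front m" unfolding toggle_def by (simp split: if_split) blast
      then show "vert (?p w) m = vert w m" by (simp add: vert_def se)
    qed
    ultimately show "of_int (fsign (?p w)) * h (?p w) = - (of_int (fsign w) * h w)" by simp
  qed
qed

text \<open>Without its central vertex a flag becomes a simplex in a facet of the cube. The opposite
  facet is a translate by \<open>v (s i1)\<close> and carries the opposite sign, so a
  translation-invariant \<open>h\<close> cancels in pairs. The type \<open>i1\<close> exists because
  \<open>k \<noteq> i0\<close> forces \<open>1 < CARD('n)\<close>.\<close>

lemma first_face_cancel:
  assumes k: "k \<noteq> i0"
    and h: "\<And>w w' u. u \<in> V \<Longrightarrow> (\<And>m. m \<noteq> i0 \<Longrightarrow> vert w' m = u * vert w m) \<Longrightarrow> h w' = h w"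
  shows "(\<Sum>w\<in>flags. of_int (fsign w) * h w) = (0 :: complex)"
proof -
  have "1 < CARD('n)" using k r_less[of k] r_i0 r_eq_iff[of k i0] by linarith
  then obtain i1 where i1: "r i1 = 1" using r_ex by blast
  then have i10: "i1 \<noteq> i0" using r_i0 by auto
  have add: "h (s, insert (s i1) e) = h (s, e)" if w: "(s, e) \<in> flags" and e: "s i1 \<notin> e" for s e
  proof (rule h[of "v (s i1)"])
    fix m assume "m \<noteq> i0"
    then have "0 < r m" using r_eq_iff r_i0 by (metis gr0I)
    then have "i1 \<in> front m" using i1 by (auto simp: front_def)
    then have "insert (s i1) e \<inter> s ` front m = insert (s i1) (e \<inter> s ` front m)" by auto
    then show "vert (s, insert (s i1) e) m = v (s i1) * vert (s, e) m"
      using e by (simp add: vert_def)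
  qed (rule v_in)
  let ?p = "\<lambda>w. (fst w, toggle (fst w i1) (snd w))"
  show ?thesis
  proof (rule sum_involution_zero[of _ ?p])
    fix w assume w: "w \<in> flags"
    obtain s e where se: "w = (s, e)" by (cases w)
    show pw: "?p w \<in> flags" using w toggle_in i10 by (simp add: se)
    show "?p (?p w) = w" by (simp add: toggle_toggle)
    have "fsign (?p w) = - fsign w" by (simp add: fsign_toggle se)
    moreover have "h (?p w) = h w"
    proof (cases "s i1 \<in> e")
      case True
      then have "(s, e - {s i1}) \<in> flags" "insert (s i1) (e - {s i1}) = e"
        using pw by (auto simp: se toggle_def)
      then show ?thesis using add[of s "e - {s i1}"] True by (simp add: se toggle_def)
    qed (use add w in \<open>simp add: se toggle_def\<close>)
    ultimately show "of_int (fsign (?p w)) * h (?p w) = - (of_int (fsign w) * h w)" by simp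
  qed
qed

section \<open>Replacing the vertices type by type\<close>

abbreviation chain_sum ::
  "complex ^ 'n \<Rightarrow> ('n \<Rightarrow> complex ^ 'n \<Rightarrow> complex ^ 'n) \<Rightarrow> complex ^ 'n \<Rightarrow> complex" where
  "chain_sum z f x \<equiv> \<Sum>w\<in>flags. of_int (fsign w) * g_rows z (\<lambda>i. f i (x * vert w i))"

text \<open>
  By \<open>g_rows_replace\<close> the two sums differ by the terms in which the vertex of another type is
  dropped.  Such a term cancels against a neighbouring flag, except for the central type \<open>i0\<close>, where
  it cancels against a translate by some \<open>v k\<close>; only there summability over \<open>V\<close> is needed.
\<close>

lemma replace_type:
  assumes f: "\<And>i x. x \<in> V \<Longrightarrow> Tr (f i x * z) \<noteq> 0" and e: "\<And>x. x \<in> V \<Longrightarrow> Tr (e x * z) \<noteq> 0"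
    and summ: "\<And>w. k \<noteq> i0 \<Longrightarrow> w \<in> flags \<Longrightarrow>
      (\<lambda>x. g_rows z ((\<lambda>i. f i (x * vert w i))(i0 := e (x * vert w k)))) summable_on V"
    and S: "(chain_sum z f has_sum S) V"
  shows "(chain_sum z (f(k := e)) has_sum S) V"
proof -
  define H where "H j w x = g_rows z ((\<lambda>i. f i (x * vert w i))(j := e (x * vert w k)))" for j w x
  have Hk: "H k w x = g_rows z (\<lambda>i. (f(k := e)) i (x * vert w i))" for w x
    unfolding H_def by (rule arg_cong[of _ _ "g_rows z"]) auto
  have zero: "(\<Sum>w\<in>flags. of_int (fsign w) * H j w x) = 0" if "j \<noteq> k" "j \<noteq> i0" for j x
  proof (rule face_cancel[OF that(2)])
    fix w w' assume "\<And>m. m \<noteq> j \<Longrightarrow> vert w m = vert w' m"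
    with that show "H j w x = H j w' x" unfolding H_def by (intro arg_cong[of _ _ "g_rows z"]) auto
  qed
  have exp: "chain_sum z f x = (\<Sum>j\<in>UNIV. \<Sum>w\<in>flags. of_int (fsign w) * H j w x)" if "x \<in> V" for x
  proof -
    have "g_rows z (\<lambda>i. f i (x * vert w i)) = (\<Sum>j\<in>UNIV. H j w x)" for w
      unfolding H_def by (rule g_rows_replace) (use f e that mult_in vert_in in auto)
    then have "chain_sum z f x = (\<Sum>w\<in>flags. \<Sum>j\<in>UNIV. of_int (fsign w) * H j w x)"
      by (simp add: sum_distrib_left)
    then show ?thesis by (simp add: sum.swap[of _ UNIV])
  qed
  show ?thesis
  proof (cases "k = i0")
    case True
    have "chain_sum z (f(k := e)) x = chain_sum z f x" if "x \<in> V" for x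
    proof -
      have "chain_sum z f x = (\<Sum>j\<in>{k}. \<Sum>w\<in>flags. of_int (fsign w) * H j w x)"
        unfolding exp[OF that] by (rule sum.mono_neutral_right) (use zero True in auto)
      then show ?thesis by (simp add: Hk)
    qed
    then show ?thesis using S has_sum_cong[of V "chain_sum z (f(k := e))" "chain_sum z f"] by simp
  next
    case False
    have *: "chain_sum z (f(k := e)) x = chain_sum z f x - (\<Sum>w\<in>flags. of_int (fsign w) * H i0 w x)"
      if "x \<in> V" for x
    proof -
      have "chain_sum z f x = (\<Sum>j\<in>{k, i0}. \<Sum>w\<in>flags. of_int (fsign w) * H j w x)"
        unfolding exp[OF that] by (rule sum.mono_neutral_right) (use zero in auto)
      then show ?thesis using False by (simp add: Hk)
    qed
    have Hs: "(H i0 w has_sum infsum (H i0 w) V) V" if "w \<in> flags" for w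
      using summ[OF False that] unfolding H_def by (rule has_sum_infsum)
    have "((\<lambda>x. \<Sum>w\<in>flags. of_int (fsign w) * H i0 w x)
        has_sum (\<Sum>w\<in>flags. of_int (fsign w) * infsum (H i0 w) V)) V"
      by (intro has_sum_sum finite_flags has_sum_cmult_right Hs)
    also have "(\<Sum>w\<in>flags. of_int (fsign w) * infsum (H i0 w) V) = 0"
    proof (rule first_face_cancel[OF False])
      fix w w' u assume u: "u \<in> V" "\<And>m. m \<noteq> i0 \<Longrightarrow> vert w' m = u * vert w m"
      \<comment> \<open>Translating all remaining vertices by \<open>u\<close> only reindexes the
        sum over \<open>V\<close>; hence this cancellation takes place after summation and not for
        each \<open>x\<close>.\<close>
      have "H i0 w' x = H i0 w (x * u)" for x
      proof -
        have "(\<lambda>i. f i (x * vert w' i))(i0 := e (x * vert w' k))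
            = (\<lambda>i. f i (x * u * vert w i))(i0 := e (x * u * vert w k))"
          using u(2) False by (simp add: fun_eq_iff mult.assoc)
        then show ?thesis unfolding H_def by simp
      qed
      then have "infsum (H i0 w') V = (\<Sum>\<^sub>\<infinity>x\<in>V. H i0 w (x * u))" by (intro infsum_cong)
      also have "\<dots> = infsum (H i0 w) V" by (rule infsum_reindex_bij_betw[OF bij_mult[OF u(1)]])
      finally show "infsum (H i0 w') V = infsum (H i0 w) V" .
    qed
    finally have "((\<lambda>x. chain_sum z f x - (\<Sum>w\<in>flags. of_int (fsign w) * H i0 w x)) has_sum (S - 0)) V"
      using has_sum_add[OF S has_sum_uminusI] by fastforce
    then show ?thesis using * has_sum_cong[of V "chain_sum z (f(k := e))"] by simp
  qed
qed

text \<open>Types are replaced in the order of \<open>r\<close>, beginning with the central one. At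
  a stage \<open>k \<noteq> i0\<close> the family to be summed is the one in which the central
  vertex is overwritten by the new value at the vertex of type \<open>k\<close>; this explains the
  shape of the summability hypothesis.\<close>

lemma replace_all:
  assumes f: "\<And>i x. x \<in> V \<Longrightarrow> Tr (f i x * z) \<noteq> 0" and e: "\<And>x. x \<in> V \<Longrightarrow> Tr (e x * z) \<noteq> 0"
    and summ: "\<And>k w. k \<noteq> i0 \<Longrightarrow> w \<in> flags \<Longrightarrow>
      (\<lambda>x. g_rows z (\<lambda>i. if i = i0 then e (x * vert w k)
         else if r i < r k then e (x * vert w i) else f i (x * vert w i))) summable_on V"
    and S: "(chain_sum z f has_sum S) V"
  shows "(chain_sum z (\<lambda>i. e) has_sum S) V"
proof -
  define F where "F m = (\<lambda>i. if r i < m then e else f i)" for m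
  have "(chain_sum z (F m) has_sum S) V" if "m \<le> CARD('n)" for m
    using that
  proof (induction m)
    case 0
    then show ?case using S by (simp add: F_def)
  next
    case (Suc m)
    then obtain k where k: "r k = m" using r_ex by (metis Suc_le_lessD)
    have "F (Suc m) = (F m)(k := e)"
      using k r_eq_iff by (auto simp: F_def fun_eq_iff less_Suc_eq)
    moreover have "(chain_sum z ((F m)(k := e)) has_sum S) V"
    proof (rule replace_type)
      fix w assume w: "k \<noteq> i0" "w \<in> flags"
      have "((\<lambda>i. F m i (x * vert w i))(i0 := e (x * vert w k)))
        = (\<lambda>i. if i = i0 then e (x * vert w k)
         else if r i < r k then e (x * vert w i) else f i (x * vert w i))" for x
        using k by (auto simp: F_def fun_eq_iff)
      then show "(\<lambda>x. g_rows z ((\<lambda>i. F m i (x * vert w i))(i0 := e (x * vert w k)))) summable_on V"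
        using summ[OF w] by simp
    qed (use Suc f e in \<open>auto simp: F_def\<close>)
    ultimately show ?case by simp
  qed
  from this[of "CARD('n)"] show ?thesis using r_less by (simp add: F_def)
qed

end

section \<open>Volumes\<close>

text \<open>The library's \<open>measure_linear_image\<close> requires the index type to be well-ordered.\<close>

lemma measure_linear_image_finite:
  fixes f :: "real ^ 'n \<Rightarrow> real ^ 'n"
  assumes "linear f" "S \<in> lmeasurable"
  shows "f ` S \<in> lmeasurable \<and> measure lebesgue (f ` S) = \<bar>det (matrix f)\<bar> * measure lebesgue S"
proof -
  define P where "P f \<longleftrightarrow> (\<forall>S \<in> lmeasurable. f ` S \<in> lmeasurable \<and>
      measure lebesgue (f ` S) = \<bar>det (matrix f)\<bar> * measure lebesgue S)" for f :: "real ^ 'n \<Rightarrow> real ^ 'n"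
  have unimodular: "P h" if h: "linear h" "\<bar>det (matrix h)\<bar> = 1"
      "\<And>a b. cbox a b \<noteq> {} \<Longrightarrow> measure lebesgue (h ` cbox a b) = measure lebesgue (cbox a b)" for h
  proof -
    have "measure lebesgue (h ` cbox a b) = 1 * measure lebesgue (cbox a b)" for a b
      using h(3)[of a b] by (cases "cbox a b = {}") auto
    from measure_linear_sufficient[OF h(1) _ this] show ?thesis
      unfolding P_def h(2) by (metis (no_types, lifting))
  qed
  have "P f"
  proof (rule induct_linear_elementary[OF assms(1)])
    fix f g :: "real ^ 'n \<Rightarrow> real ^ 'n"
    assume "linear f" "linear g" "P f" "P g"
    then show "P (f \<circ> g)"
      unfolding P_def by (simp add: matrix_compose image_comp[symmetric] det_mul abs_mult del: o_apply)
  next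
    fix f :: "real ^ 'n \<Rightarrow> real ^ 'n" and i
    assume f: "linear f" "\<And>x. f x $ i = 0"
    then have "\<not> surj f" by (metis one_index one_neq_zero surjE)
    then have i: "\<not> inj f" using f(1) linear_injective_imp_surjective by blast
    then have "negligible (f ` S)" for S using f(1) by (rule negligible_linear_singular_image[rotated])
    moreover have "det (matrix f) = 0" using i det_nz_iff_inj[OF f(1)] by blast
    ultimately show "P f"
      unfolding P_def by (auto simp: negligible_imp_measurable negligible_imp_measure0)
  next
    fix c :: "'n \<Rightarrow> real"
    have "matrix (\<lambda>x. \<chi> i. c i * x $ i) = (\<chi> i j. if i = j then c i else 0)"
      by (auto simp: matrix_def axis_def vec_eq_iff)
    then have "det (matrix (\<lambda>x. \<chi> i. c i * x $ i)) = prod c UNIV"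
      by (simp add: det_diagonal)
    then show "P (\<lambda>x. \<chi> i. c i * x $ i)"
      unfolding P_def by (simp add: measurable_stretch measure_stretch)
  next
    fix m n :: 'n assume mn: "m \<noteq> n"
    let ?t = "Transposition.transpose m n"
    let ?h = "\<lambda>x :: real ^ 'n. \<chi> i. x $ ?t i"
    show "P ?h"
    proof (rule unimodular)
      show "linear ?h" by (rule linearI) (simp_all add: vec_eq_iff)
      have "matrix ?h = (\<chi> i. mat 1 $ ?t i)"
        by (auto simp: matrix_def mat_def axis_def vec_eq_iff)
      then show "\<bar>det (matrix ?h)\<bar> = 1"
        using mn by (simp add: det_permute_rows permutes_swap_id sign_swap_id)
      fix a b :: "real ^ 'n" assume ne: "cbox a b \<noteq> {}"
      have im: "?h ` cbox a b = cbox (?h a) (?h b)"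
      proof (intro equalityI subsetI)
        fix x assume "x \<in> cbox (?h a) (?h b)"
        then have x: "a $ ?t i \<le> x $ i \<and> x $ i \<le> b $ ?t i" for i by (simp add: mem_box_cart)
        have "?h x \<in> cbox a b" using x[of "?t _"] by (simp add: mem_box_cart)
        moreover have "x = ?h (?h x)" by (simp add: vec_eq_iff)
        ultimately show "x \<in> ?h ` cbox a b" by (rule rev_image_eqI)
      qed (auto simp: mem_box_cart)
      have "(\<Prod>i\<in>UNIV. b $ ?t i - a $ ?t i) = (\<Prod>i\<in>UNIV. b $ i - a $ i)"
        by (rule prod.reindex_bij_betw) (simp add: bij_swap_iff)
      moreover have "cbox (?h a) (?h b) \<noteq> {}" using ne im by blast
      ultimately show "measure lebesgue (?h ` cbox a b) = measure lebesgue (cbox a b)"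
        using ne by (simp add: im content_cbox_cart)
    qed
  next
    fix m n :: 'n assume mn: "m \<noteq> n"
    let ?h = "\<lambda>x :: real ^ 'n. \<chi> i. if i = m then x $ m + x $ n else x $ i"
    show "P ?h"
    proof (rule unimodular)
      show "linear ?h" by (rule linearI) (simp_all add: vec_eq_iff algebra_simps)
      have "matrix ?h = (\<chi> k. if k = m then row m (mat 1) + 1 *s row n (mat 1) else row k (mat 1))"
        by (auto simp: matrix_def mat_def axis_def vec_eq_iff row_def)
      then show "\<bar>det (matrix ?h)\<bar> = 1"
        using det_row_operation[OF mn, of "mat 1 :: real ^ 'n ^ 'n" 1] by (simp del: vector_smult_lid)
      fix a b :: "real ^ 'n" assume ne: "cbox a b \<noteq> {}"
      \<comment> \<open>\<open>measure_shear_interval\<close> wants the \<open>n\<close>-th lower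
        bound of the box to be nonnegative; the translation by \<open>d\<close> makes it 0.\<close>
      define d where "d = (\<chi> i. if i = n then - a $ n else 0)"
      have 1: "0 \<le> (d + a) $ n" by (simp add: d_def)
      have box: "(+) d ` cbox a b = cbox (d + a) (d + b)" by (rule cbox_translation[symmetric])
      have lin: "?h (d + x) = ?h d + ?h x" for x by (simp add: vec_eq_iff)
      have "?h ` cbox (d + a) (d + b) = (+) (?h d) ` ?h ` cbox a b"
        by (simp only: box[symmetric] image_image lin)
      then have "measure lebesgue (?h ` cbox a b) = measure lebesgue (?h ` cbox (d + a) (d + b))"
        by (simp add: measure_translation)
      also have "\<dots> = measure lebesgue (cbox (d + a) (d + b))"
        by (rule measure_shear_interval[OF mn _ 1]) (use ne box in auto)
      also have "\<dots> = measure lebesgue (cbox a b)"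
        by (simp only: box[symmetric] measure_translation)
      finally show "measure lebesgue (?h ` cbox a b) = measure lebesgue (cbox a b)" .
    qed
  qed
  then show ?thesis using assms(2) unfolding P_def by blast
qed

definition corner :: "real \<Rightarrow> (real ^ 'n) set" where
  "corner s = {y. (\<forall>i. 0 \<le> y $ i) \<and> (\<Sum>i\<in>UNIV. y $ i) \<le> s}"

lemma corner_mono: "s \<le> t \<Longrightarrow> corner s \<subseteq> corner t"
  by (auto simp: corner_def)

lemma corner_measure:
  assumes "0 \<le> s"
  shows "(corner s :: (real ^ 'n) set) \<in> lmeasurable" "measure lebesgue (corner s :: (real ^ 'n) set) = s ^ CARD('n) / fact CARD('n)"
proof -
  have sum_Basis: "(\<Sum>i\<in>Basis. y \<bullet> i) = (\<Sum>i\<in>UNIV. y $ i)" for y :: "real ^ 'n"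
    by (simp add: Basis_vec_def sum.UNION_disjoint cart_eq_inner_axis axis_eq_axis)
  have 1: "corner 1 = (convex hull (insert 0 Basis) :: (real ^ 'n) set)"
    unfolding std_simplex sum_Basis corner_def by (auto simp: Basis_vec_def cart_eq_inner_axis)
  have c: "compact (corner 1 :: (real ^ 'n) set)" unfolding 1
    by (intro finite_imp_compact_convex_hull) auto
  have m1: "(corner 1 :: (real ^ 'n) set) \<in> lmeasurable" "measure lebesgue (corner 1 :: (real ^ 'n) set) = 1 / fact CARD('n)"
    using c content_std_simplex[where ?'a = "real ^ 'n"] unfolding 1
    by (auto simp: lmeasurable_compact compact_imp_closed)
  have "corner s = ((\<lambda>x. s *\<^sub>R x) ` corner 1 :: (real ^ 'n) set)"
  proof (cases "s = 0")
    case True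
    have "y = 0" if "y \<in> corner 0" for y :: "real ^ 'n"
    proof -
      have "(\<Sum>i\<in>UNIV. y $ i) = 0" using that by (auto simp: corner_def intro!: antisym sum_nonneg)
      then show ?thesis using that by (auto simp: corner_def vec_eq_iff sum_nonneg_eq_0_iff)
    qed
    moreover have "0 \<in> (corner 1 :: (real ^ 'n) set)" "0 \<in> (corner 0 :: (real ^ 'n) set)" by (auto simp: corner_def)
    ultimately show ?thesis using True by force
  next
    case False
    then have s: "s > 0" using assms by simp
    show ?thesis
    proof (intro equalityI subsetI)
      fix y :: "real ^ 'n" assume y: "y \<in> corner s"
      have "(1 / s) *\<^sub>R y \<in> corner 1"
        using y s by (auto simp: corner_def sum_divide_distrib[symmetric])
      then show "y \<in> (\<lambda>x. s *\<^sub>R x) ` corner 1" using s by (intro rev_image_eqI) auto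
    next
      fix y :: "real ^ 'n" assume "y \<in> (\<lambda>x. s *\<^sub>R x) ` corner 1"
      then show "y \<in> corner s" using s
        by (auto simp: corner_def sum_distrib_left[symmetric] mult_le_cancel_left1)
    qed
  qed
  moreover have "compact ((\<lambda>x. s *\<^sub>R x) ` corner 1 :: (real ^ 'n) set)"
    using c by (rule compact_scaling)
  ultimately show "corner s \<in> (lmeasurable :: (real ^ 'n) set set)" by (simp add: lmeasurable_compact)
  show "measure lebesgue (corner s :: (real ^ 'n) set) = s ^ CARD('n) / fact CARD('n)"
    using measure_lebesgue_affine[of s 0 "corner 1 :: (real ^ 'n) set"] assms m1
    by (simp add: \<open>corner s = _\<close>)
qed

text \<open>The cube is half-open so that its integer translates are disjoint and cover the space;
  it differs from the closed unit cube by a part of the boundary, a null set.\<close>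

lemma halfopen_cube_measure:
  fixes a :: "real ^ 'n"
  shows "{x. \<forall>i. a $ i < x $ i \<and> x $ i \<le> a $ i + 1} \<in> lmeasurable" (is "?C \<in> _")
    "measure lebesgue {x. \<forall>i. a $ i < x $ i \<and> x $ i \<le> a $ i + 1} = 1"
proof -
  have ne: "negligible ((cbox a (a + 1) - ?C) \<union> (?C - cbox a (a + 1)))"
    by (rule negligible_subset[OF negligible_frontier_interval[of a "a + 1"]])
       (auto simp: mem_box_cart less_imp_le)
  have "cbox a (a + 1) \<noteq> {}" by (simp add: interval_ne_empty_cart)
  then have "measure lebesgue (cbox a (a + 1)) = 1" by (simp add: content_cbox_cart)
  then show "?C \<in> lmeasurable" "measure lebesgue ?C = 1"
    using lmeasurable_negligible_symdiff[OF lmeasurable_cbox ne] measure_negligible_symdiff[OF lmeasurable_cbox ne]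
    by auto
qed

section \<open>The lattice of logarithms\<close>

lemma log_abs_mult:
  assumes "\<And>i. x $ i \<noteq> 0" "\<And>i. y $ i \<noteq> 0"
  shows "log_abs (x * y) = log_abs x + log_abs y"
  using assms by (simp add: log_abs_def vec_eq_iff norm_mult ln_mult)

text \<open>The \<open>CARD('n) - 1\<close> generators of \<open>V\<close> are indexed by the whole
  type \<open>'n\<close>, with \<open>v i0 = 1\<close> filling the spare index. Its logarithm is 0,
  so \<open>indep\<close> speaks about the other indices.\<close>

locale log_lattice = flag_complex V r i0 v
  for V :: "(complex ^ 'n) set" and r :: "'n \<Rightarrow> nat" and i0 :: 'n and v :: "'n \<Rightarrow> complex ^ 'n" +
  assumes nz: "\<And>x i. x \<in> V \<Longrightarrow> x $ i \<noteq> 0"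
    and inj_log: "inj_on log_abs V"
    and v_i0: "v i0 = 1"
    and trace0: "\<And>x. x \<in> V \<Longrightarrow> (\<Sum>i\<in>UNIV. log_abs x $ i) = 0"
    and coords: "\<And>x. x \<in> V \<Longrightarrow> \<exists>c :: 'n \<Rightarrow> int. log_abs x = (\<Sum>k\<in>UNIV. of_int (c k) *\<^sub>R log_abs (v k))"
    and coords_ex: "\<And>c :: 'n \<Rightarrow> int. \<exists>x\<in>V. log_abs x = (\<Sum>k\<in>UNIV. of_int (c k) *\<^sub>R log_abs (v k))"
    and indep: "\<And>c k. (\<Sum>k\<in>UNIV. c k *\<^sub>R log_abs (v k)) = 0 \<Longrightarrow> k \<noteq> i0 \<Longrightarrow> c k = 0"
begin

abbreviation l :: "'n \<Rightarrow> real ^ 'n" where "l k \<equiv> log_abs (v k)"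

text \<open>The spare row becomes the all-ones vector, which spans a complement of the trace-zero
  hyperplane. With the generators it forms a basis of the whole space, so the lattice can be
  measured by full determinants and volumes.\<close>

definition frame_row :: "'n \<Rightarrow> real ^ 'n" where "frame_row k = (if k = i0 then 1 else l k)"

definition frame_det :: real where "frame_det = det (\<chi> k. frame_row k)"

definition frame_map :: "real ^ 'n \<Rightarrow> real ^ 'n" where "frame_map c = (\<Sum>k\<in>UNIV. (c $ k) *\<^sub>R frame_row k)"

lemma l_i0: "l i0 = 0"
  by (simp add: v_i0 log_abs_def vec_eq_iff)

lemma frame_map_eq: "frame_map c = (c $ i0) *\<^sub>R 1 + (\<Sum>k\<in>UNIV. (c $ k) *\<^sub>R l k)"
proof -
  have "(\<Sum>k\<in>UNIV. (c $ k) *\<^sub>R l k) = (\<Sum>k\<in>UNIV - {i0}. (c $ k) *\<^sub>R frame_row k)"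
    by (subst sum.remove[of _ i0]) (auto simp: l_i0 frame_row_def intro!: sum.cong)
  then show ?thesis unfolding frame_map_def by (subst sum.remove[of _ i0]) (auto simp: frame_row_def)
qed

lemma l_trace: "(\<Sum>i\<in>UNIV. l k $ i) = 0"
  using trace0 v_in by blast

lemma lsum_trace: "(\<Sum>i\<in>UNIV. (\<Sum>k\<in>UNIV. c k *\<^sub>R l k) $ i) = 0"
proof -
  have "(\<Sum>i\<in>UNIV. (\<Sum>k\<in>UNIV. c k *\<^sub>R l k) $ i) = (\<Sum>k\<in>UNIV. c k * (\<Sum>i\<in>UNIV. l k $ i))"
    by (simp add: sum_distrib_left) (rule sum.swap)
  then show ?thesis by (simp add: l_trace)
qed

lemma frame_map_trace: "(\<Sum>i\<in>UNIV. frame_map c $ i) = of_nat CARD('n) * c $ i0"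
  unfolding frame_map_eq vector_add_component sum.distrib lsum_trace by simp

lemma linear_frame_map: "linear frame_map"
  unfolding frame_map_def by (rule linearI) (simp_all add: scaleR_left_distrib sum.distrib scaleR_sum_right)

lemma inj_frame_map: "inj frame_map"
proof -
  have "c = 0" if "frame_map c = 0" for c
  proof -
    have c0: "c $ i0 = 0" using frame_map_trace[of c] that by simp
    then have "(\<Sum>k\<in>UNIV. (c $ k) *\<^sub>R l k) = 0" using that frame_map_eq[of c] by simp
    then have "c $ k = 0" for k using indep c0 by (cases "k = i0") auto
    then show ?thesis by (simp add: vec_eq_iff)
  qed
  then show ?thesis using linear_injective_0[OF linear_frame_map] by blast
qed

lemma surj_frame_map: "surj frame_map"
  by (rule linear_inj_imp_surj[OF linear_frame_map inj_frame_map])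

lemma det_frame_map: "det (matrix frame_map) = frame_det"
proof -
  have "frame_map (axis k 1) = frame_row k" for k
    by (simp add: frame_map_def axis_def if_distrib[of "\<lambda>x. x *\<^sub>R _"] cong: if_cong)
  then have "matrix frame_map = transpose (\<chi> k. frame_row k)"
    by (simp add: matrix_def transpose_def vec_eq_iff)
  then show ?thesis by (simp add: frame_det_def)
qed

lemma frame_det_nonzero: "frame_det \<noteq> 0"
  using inj_frame_map det_nz_iff_inj[OF linear_frame_map] det_frame_map by simp

section \<open>Integral coordinates, growth and summability\<close>

lemma log_abs_mult_in: "x \<in> V \<Longrightarrow> y \<in> V \<Longrightarrow> log_abs (x * y) = log_abs x + log_abs y"
  by (rule log_abs_mult) (auto simp: nz)

lemma norm_Nm: "x \<in> V \<Longrightarrow> norm (Nm x) = 1"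
proof -
  assume x: "x \<in> V"
  have "norm (x $ i) = exp (log_abs x $ i)" for i using nz[OF x] by (simp add: log_abs_def)
  then have "norm (Nm x) = exp (\<Sum>i\<in>UNIV. log_abs x $ i)"
    by (simp add: Nm_def exp_sum flip: prod_norm)
  then show ?thesis using trace0[OF x] by simp
qed

text \<open>Since \<open>l i0 = 0\<close>, the coefficient at \<open>i0\<close> is not determined by
  \<open>x\<close>; fixing it to be 0 makes the coordinates unique.\<close>

definition coord :: "complex ^ 'n \<Rightarrow> 'n \<Rightarrow> int" where
  "coord x = (SOME c. c i0 = 0 \<and> log_abs x = (\<Sum>k\<in>UNIV. of_int (c k) *\<^sub>R l k))"

lemma coord:
  assumes "x \<in> V"
  shows "coord x i0 = 0" "log_abs x = (\<Sum>k\<in>UNIV. of_int (coord x k) *\<^sub>R l k)"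
proof -
  obtain c :: "'n \<Rightarrow> int" where c: "log_abs x = (\<Sum>k\<in>UNIV. of_int (c k) *\<^sub>R l k)"
    using coords[OF assms] by blast
  have "(\<Sum>k\<in>UNIV. of_int ((c(i0 := 0)) k) *\<^sub>R l k) = (\<Sum>k\<in>UNIV. of_int (c k) *\<^sub>R l k)"
    by (rule sum.cong) (auto simp: l_i0)
  with c have "\<exists>c. c i0 = 0 \<and> log_abs x = (\<Sum>k\<in>UNIV. of_int (c k) *\<^sub>R l k)"
    by (intro exI[of _ "c(i0 := 0)"]) auto
  from someI_ex[OF this] show "coord x i0 = 0" "log_abs x = (\<Sum>k\<in>UNIV. of_int (coord x k) *\<^sub>R l k)"
    unfolding coord_def by auto
qed

lemma log_abs_frame_map: "x \<in> V \<Longrightarrow> log_abs x = frame_map (\<chi> k. of_int (coord x k))"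
  by (simp add: frame_map_eq coord(1) coord(2)[symmetric])

lemma coord_inj: "x \<in> V \<Longrightarrow> y \<in> V \<Longrightarrow> coord x = coord y \<Longrightarrow> x = y"
  by (rule inj_onD[OF inj_log]) (simp_all add: coord(2))

lemma norm_ge_exp: "x \<in> V \<Longrightarrow> exp (log_abs x $ i) \<le> norm x"
  using nz[of x i] Finite_Cartesian_Product.norm_nth_le[of x i] by (simp add: log_abs_def)

text \<open>The entries of a trace-zero vector are bounded in absolute value by
  \<open>CARD('n)\<close> times its largest entry, and \<open>frame_map\<close> is bounded below.
  One factor \<open>CARD('n)\<close> of the constant comes from the first fact, the other two from
  comparing sums of absolute values with the norm and with the largest summand.\<close>

lemma coord_bound:
  obtains \<delta> where "\<delta> > 0"
    "\<And>x. x \<in> V \<Longrightarrow> \<exists>i. \<delta> * (\<Sum>k\<in>UNIV. \<bar>real_of_int (coord x k)\<bar>) \<le> log_abs x $ i"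
proof -
  obtain B where B: "B > 0" "\<And>c. B * norm c \<le> norm (frame_map c)"
    using linear_inj_bounded_below_pos[OF linear_frame_map inj_frame_map] by blast
  let ?n = "real CARD('n)"
  have n: "?n > 0" by simp
  show ?thesis
  proof (rule that)
    show "B / (?n * ?n * ?n) > 0" using B n by simp
    fix x assume x: "x \<in> V"
    define L where "L = log_abs x"
    obtain i where i: "\<And>j. L $ j \<le> L $ i"
    proof -
      have "Max (range (($) L)) \<in> range (($) L)" by (rule Max_in) auto
      then obtain i where "Max (range (($) L)) = L $ i" by blast
      then show ?thesis using that[of i] by (metis Max_ge finite_imageI finite rangeI)
    qed
    have tr: "(\<Sum>j\<in>UNIV. L $ j) = 0" using trace0[OF x] by (simp add: L_def)
    have pos: "L $ i \<ge> 0"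
    proof (rule ccontr)
      assume "\<not> L $ i \<ge> 0"
      moreover have "(\<Sum>j\<in>UNIV. L $ j) \<le> (\<Sum>j\<in>(UNIV :: 'n set). L $ i)"
        by (rule sum_mono) (rule i)
      ultimately show False using tr by (simp add: zero_le_mult_iff)
    qed
    have abs: "\<bar>L $ j\<bar> \<le> ?n * L $ i" for j
    proof -
      have "L $ j + (\<Sum>m\<in>UNIV - {j}. L $ m) = 0" using tr by (simp add: sum.remove[of _ j])
      moreover have "(\<Sum>m\<in>UNIV - {j}. L $ m) \<le> of_nat (card (UNIV - {j})) * L $ i"
        by (rule sum_bounded_above) (use i in auto)
      moreover have "of_nat (card (UNIV - {j})) * L $ i \<le> ?n * L $ i"
        using pos by (intro mult_right_mono) (auto simp: card_mono)
      moreover have "L $ i \<le> ?n * L $ i" using pos n by (simp add: mult_le_cancel_right1)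
      ultimately show ?thesis using i[of j] by linarith
    qed
    let ?c = "(\<chi> k. of_int (coord x k)) :: real ^ 'n"
    have "(\<Sum>k\<in>UNIV. \<bar>real_of_int (coord x k)\<bar>) \<le> ?n * norm ?c"
      using sum_bounded_above[of UNIV "\<lambda>k. \<bar>?c $ k\<bar>" "norm ?c"] component_le_norm_cart[of ?c] by simp
    then have "B * (\<Sum>k\<in>UNIV. \<bar>real_of_int (coord x k)\<bar>) \<le> ?n * (B * norm ?c)"
      using B(1) by (simp add: mult_ac)
    also have "\<dots> \<le> ?n * norm L"
      using B(2)[of ?c] by (simp add: L_def log_abs_frame_map[OF x])
    also have "norm L \<le> (\<Sum>j\<in>UNIV. \<bar>L $ j\<bar>)" by (rule norm_le_l1_cart)
    also have "\<dots> \<le> ?n * (?n * L $ i)" using sum_bounded_above[of UNIV "\<lambda>j. \<bar>L $ j\<bar>"] abs by simp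
    finally have "B * (\<Sum>k\<in>UNIV. \<bar>real_of_int (coord x k)\<bar>) \<le> ?n * (?n * (?n * L $ i))" by simp
    then have "B / (?n * ?n * ?n) * (\<Sum>k\<in>UNIV. \<bar>real_of_int (coord x k)\<bar>) \<le> L $ i"
      using n by (simp add: divide_le_eq mult_ac)
    then show "\<exists>i. B / (?n * ?n * ?n) * (\<Sum>k\<in>UNIV. \<bar>real_of_int (coord x k)\<bar>) \<le> log_abs x $ i"
      unfolding L_def by blast
  qed
qed

lemma finite_bounded_coord: "finite {x \<in> V. \<forall>k. \<bar>coord x k\<bar> \<le> m}"
proof (rule inj_on_finite[of coord])
  show "inj_on coord {x \<in> V. \<forall>k. \<bar>coord x k\<bar> \<le> m}"
    by (rule inj_onI) (auto intro: coord_inj)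
  show "coord ` {x \<in> V. \<forall>k. \<bar>coord x k\<bar> \<le> m} \<subseteq> PiE UNIV (\<lambda>_. {-m..m})"
    by (auto simp: PiE_UNIV_domain abs_le_iff) (metis minus_le_iff)+
  show "finite (PiE (UNIV :: 'n set) (\<lambda>_. {-m..m}))" by (rule finite_PiE) auto
qed

lemma finite_log_le: "finite {x \<in> V. \<forall>i. log_abs x $ i \<le> R}"
proof -
  obtain d where d: "d > 0"
    "\<And>x. x \<in> V \<Longrightarrow> \<exists>i. d * (\<Sum>k\<in>UNIV. \<bar>real_of_int (coord x k)\<bar>) \<le> log_abs x $ i"
    using coord_bound by blast
  have "{x \<in> V. \<forall>i. log_abs x $ i \<le> R} \<subseteq> {x \<in> V. \<forall>k. \<bar>coord x k\<bar> \<le> \<lfloor>R / d\<rfloor>}"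
  proof safe
    fix x k assume x: "x \<in> V" "\<forall>i. log_abs x $ i \<le> R"
    obtain i where "d * (\<Sum>k\<in>UNIV. \<bar>real_of_int (coord x k)\<bar>) \<le> log_abs x $ i" using d(2)[OF x(1)] by blast
    then have "d * (\<Sum>k\<in>UNIV. \<bar>real_of_int (coord x k)\<bar>) \<le> R" using x(2) by (meson order_trans)
    moreover have "\<bar>real_of_int (coord x k)\<bar> \<le> (\<Sum>k\<in>UNIV. \<bar>real_of_int (coord x k)\<bar>)"
      by (rule member_le_sum) auto
    ultimately have "d * \<bar>real_of_int (coord x k)\<bar> \<le> R" using d(1) by (meson mult_left_mono order_trans less_imp_le)
    then have "real_of_int \<bar>coord x k\<bar> \<le> R / d" using d(1) by (simp add: le_divide_eq mult.commute)
    then show "\<bar>coord x k\<bar> \<le> \<lfloor>R / d\<rfloor>" by (simp add: le_floor_iff)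
  qed
  then show ?thesis using finite_bounded_coord finite_subset by blast
qed

lemma finite_log_ge: "finite {x \<in> V. \<forall>i. - R \<le> log_abs x $ i}"
proof -
  have "{x \<in> V. \<forall>i. - R \<le> log_abs x $ i} \<subseteq> {x \<in> V. \<forall>i. log_abs x $ i \<le> real CARD('n) * \<bar>R\<bar>}"
  proof safe
    fix x i assume x: "x \<in> V" "\<forall>i. - R \<le> log_abs x $ i"
    have "log_abs x $ i + (\<Sum>m\<in>UNIV - {i}. log_abs x $ m) = 0"
      using trace0[OF x(1)] by (simp add: sum.remove[of _ i])
    moreover have "of_nat (card (UNIV - {i})) * - \<bar>R\<bar> \<le> (\<Sum>m\<in>UNIV - {i}. log_abs x $ m)"
    proof (rule sum_bounded_below)
      fix m show "- \<bar>R\<bar> \<le> log_abs x $ m" using x(2)[rule_format, of m] by linarith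
    qed
    moreover have "real (card (UNIV - {i})) * \<bar>R\<bar> \<le> real CARD('n) * \<bar>R\<bar>"
      by (intro mult_right_mono) (auto simp: card_mono)
    ultimately show "log_abs x $ i \<le> real CARD('n) * \<bar>R\<bar>" by simp
  qed
  then show ?thesis using finite_log_le finite_subset by blast
qed

lemma sum_int_power_le:
  assumes "0 < q" "q < (1::real)"
  shows "(\<Sum>j\<in>{-int m..int m}. q ^ nat \<bar>j\<bar>) \<le> 2 / (1 - q)"
proof -
  have g: "(\<Sum>i\<in>{..m}. q ^ i) \<le> 1 / (1 - q)"
    using sum_le_suminf[of "\<lambda>i. q ^ i" "{..m}"] assms by (simp add: suminf_geometric summable_geometric)
  have "{-int m..int m} \<subseteq> int ` {..m} \<union> (\<lambda>i. - int i) ` {..m}"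
  proof
    fix j assume j: "j \<in> {-int m..int m}"
    show "j \<in> int ` {..m} \<union> (\<lambda>i. - int i) ` {..m}"
    proof (cases "j \<ge> 0")
      case True
      then have "j = int (nat j)" "nat j \<le> m" using j by auto
      then show ?thesis by blast
    next
      case False
      then have "j = - int (nat (- j))" "nat (- j) \<le> m" using j by auto
      then show ?thesis by blast
    qed
  qed
  then have "(\<Sum>j\<in>{-int m..int m}. q ^ nat \<bar>j\<bar>)
      \<le> (\<Sum>j\<in>int ` {..m} \<union> (\<lambda>i. - int i) ` {..m}. q ^ nat \<bar>j\<bar>)"
    using assms by (intro sum_mono2) auto
  also have "\<dots> \<le> (\<Sum>j\<in>int ` {..m}. q ^ nat \<bar>j\<bar>) + (\<Sum>j\<in>(\<lambda>i. - int i) ` {..m}. q ^ nat \<bar>j\<bar>)"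
    using assms sum.union_inter[of "int ` {..m}" "(\<lambda>i. - int i) ` {..m}" "\<lambda>j. q ^ nat \<bar>j\<bar>"]
      sum_nonneg[of "int ` {..m} \<inter> (\<lambda>i. - int i) ` {..m}" "\<lambda>j. q ^ nat \<bar>j\<bar>"]
    by (simp add: zero_le_power)
  also have "\<dots> = (\<Sum>i\<in>{..m}. q ^ i) + (\<Sum>i\<in>{..m}. q ^ i)"
    by (simp add: sum.reindex inj_on_def)
  finally show ?thesis using g by simp
qed

text \<open>By \<open>coord_bound\<close> a term is at most \<open>q\<close> to the power of the sum
  of the absolute values of the coordinates, and these powers form a product of geometric series.
  Finite partial sums are enlarged to boxes, where sum and product can be exchanged.\<close>

lemma summable_inverse_norm: "(\<lambda>x. 1 / norm x) summable_on V"
proof -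
  obtain d where d: "d > 0"
    "\<And>x. x \<in> V \<Longrightarrow> \<exists>i. d * (\<Sum>k\<in>UNIV. \<bar>real_of_int (coord x k)\<bar>) \<le> log_abs x $ i"
    using coord_bound by blast
  define q where "q = exp (- d)"
  have q: "0 < q" "q < 1" using d by (auto simp: q_def)
  have le: "1 / norm x \<le> (\<Prod>k\<in>UNIV. q ^ nat \<bar>coord x k\<bar>)" if x: "x \<in> V" for x
  proof -
    obtain i where "d * (\<Sum>k\<in>UNIV. \<bar>real_of_int (coord x k)\<bar>) \<le> log_abs x $ i" using d(2)[OF x] by blast
    then have *: "exp (d * (\<Sum>k\<in>UNIV. \<bar>real_of_int (coord x k)\<bar>)) \<le> norm x"
      using norm_ge_exp[OF x, of i] by (meson exp_le_cancel_iff order_trans)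
    have "(\<Prod>k\<in>UNIV. q ^ nat \<bar>coord x k\<bar>) = exp (\<Sum>k\<in>UNIV. - d * \<bar>real_of_int (coord x k)\<bar>)"
      by (simp add: q_def exp_sum flip: exp_of_nat_mult) (simp add: mult.commute)
    also have "\<dots> = inverse (exp (d * (\<Sum>k\<in>UNIV. \<bar>real_of_int (coord x k)\<bar>)))"
      by (simp add: sum_negf sum_distrib_left exp_minus)
    finally show ?thesis using le_imp_inverse_le[OF *] by (simp add: divide_inverse)
  qed
  show ?thesis
  proof (rule nonneg_bdd_above_summable_on)
    show "bdd_above (sum (\<lambda>x. 1 / norm x) ` {F. F \<subseteq> V \<and> finite F})"
    proof (rule bdd_aboveI2)
      fix F assume "F \<in> {F. F \<subseteq> V \<and> finite F}"
      then have F: "F \<subseteq> V" "finite F" by auto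
      define m where "m = nat (Max (insert 0 ((\<lambda>(x, k). \<bar>coord x k\<bar>) ` (F \<times> UNIV))))"
      have m: "\<bar>coord x k\<bar> \<le> int m" if "x \<in> F" for x k
      proof -
        have "\<bar>coord x k\<bar> \<in> insert 0 ((\<lambda>(x, k). \<bar>coord x k\<bar>) ` (F \<times> UNIV))" using that by force
        then have "\<bar>coord x k\<bar> \<le> Max (insert 0 ((\<lambda>(x, k). \<bar>coord x k\<bar>) ` (F \<times> UNIV)))"
          by (intro Max_ge) (use F in auto)
        then show ?thesis unfolding m_def by linarith
      qed
      have inj: "inj_on coord F" using F by (auto intro!: inj_onI coord_inj)
      have "(\<Sum>x\<in>F. 1 / norm x) \<le> (\<Sum>x\<in>F. \<Prod>k\<in>UNIV. q ^ nat \<bar>coord x k\<bar>)"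
        using le F by (intro sum_mono) auto
      also have "\<dots> = (\<Sum>c\<in>coord ` F. \<Prod>k\<in>UNIV. q ^ nat \<bar>c k\<bar>)"
        by (simp add: sum.reindex[OF inj])
      also have "\<dots>  \<le> (\<Sum>c\<in>PiE (UNIV :: 'n set) (\<lambda>_. {-int m..int m}). \<Prod>k\<in>UNIV. q ^ nat \<bar>c k\<bar>)"
      proof (rule sum_mono2)
        show "coord ` F \<subseteq> PiE UNIV (\<lambda>_. {-int m..int m})"
          using m by (auto simp: PiE_UNIV_domain abs_le_iff minus_le_iff)
      qed (use q in \<open>auto intro!: finite_PiE prod_nonneg\<close>)
      also have "\<dots> = (\<Prod>k\<in>(UNIV :: 'n set). \<Sum>j\<in>{-int m..int m}. q ^ nat \<bar>j\<bar>)"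
        by (rule prod_sum_PiE[symmetric]) auto
      also have "\<dots> \<le> (\<Prod>k\<in>(UNIV :: 'n set). 2 / (1 - q))"
        using sum_int_power_le[OF q] q by (intro prod_mono) (auto intro!: sum_nonneg)
      finally show "(\<Sum>x\<in>F. 1 / norm x) \<le> (\<Prod>k\<in>(UNIV :: 'n set). 2 / (1 - q))" .
    qed
  qed auto
qed

end

section \<open>Counting lattice points in a large simplex\<close>

lemma tendsto_shift_ratio: "((\<lambda>r. (r + a) / r) \<longlongrightarrow> (1::real)) at_top"
proof -
  have "((\<lambda>r. 1 + a * inverse r) \<longlongrightarrow> 1 + a * 0) at_top"
    by (intro tendsto_intros tendsto_inverse_0_at_top filterlim_ident)
  moreover have "\<forall>\<^sub>F r in at_top. 1 + a * inverse r = (r + a) / r"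
    using eventually_gt_at_top[of 0] by eventually_elim (simp add: field_simps)
  ultimately show ?thesis by (simp add: tendsto_cong)
qed

text \<open>The telescoping factorisation of a difference of powers has \<open>n\<close> products,
  each of which tends to 1 after division by \<open>r ^ (n - 1)\<close>.\<close>

lemma tendsto_power_diff_ratio:
  assumes "n \<ge> 1"
  shows "((\<lambda>r. ((r + a + 1) ^ n - (r + a) ^ n) / r ^ (n - 1)) \<longlongrightarrow> real n) at_top"
proof -
  have "((\<lambda>r. \<Sum>i<n. ((r + a) / r) ^ (n - Suc i) * ((r + (a + 1)) / r) ^ i) \<longlongrightarrow>
      (\<Sum>i<n. 1 ^ (n - Suc i) * 1 ^ i)) at_top"
    by (intro tendsto_intros tendsto_shift_ratio)
  moreover have "\<forall>\<^sub>F r in at_top. (\<Sum>i<n. ((r + a) / r) ^ (n - Suc i) * ((r + (a + 1)) / r) ^ i)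
      = ((r + a + 1) ^ n - (r + a) ^ n) / r ^ (n - 1)"
    using eventually_gt_at_top[of 0]
  proof eventually_elim
    case (elim r)
    have "((r + a) / r) ^ (n - Suc i) * ((r + (a + 1)) / r) ^ i
        = (r + a) ^ (n - Suc i) * (r + a + 1) ^ i / r ^ (n - 1)" if "i < n" for i
    proof -
      have "r ^ (n - Suc i) * r ^ i = r ^ (n - 1)" using that by (simp flip: power_add)
      then show ?thesis by (simp add: power_divide add.assoc)
    qed
    then have "(\<Sum>i<n. ((r + a) / r) ^ (n - Suc i) * ((r + (a + 1)) / r) ^ i)
        = (\<Sum>i<n. (r + a) ^ (n - Suc i) * (r + a + 1) ^ i) / r ^ (n - 1)"
      by (simp add: sum_divide_distrib)
    then show ?case using power_diff_sumr2[of "r + a + 1" n "r + a"] by simp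
  qed
  ultimately show ?thesis by (simp add: tendsto_cong)
qed

context log_lattice
begin

text \<open>The lattice points in a simplex of size \<open>R\<close> of the trace-zero hyperplane;
  on it, clipping logarithms at \<open>- R\<close> has no effect.\<close>

definition pts :: "real \<Rightarrow> (complex ^ 'n) set" where
  "pts R = {x \<in> V. \<forall>i. - R \<le> log_abs x $ i}"

definition diam :: real where "diam = (\<Sum>k\<in>UNIV. \<Sum>i\<in>UNIV. \<bar>l k $ i\<bar>)"

text \<open>The parallelotope at \<open>x\<close>, thickened along the all-ones vector: as
  \<open>coord x i0 = 0\<close>, its height coordinate runs through (0, 1]. Counting points of a
  lattice of smaller rank thus becomes a comparison of volumes in the full space.\<close>

definition cell :: "complex ^ 'n \<Rightarrow> (real ^ 'n) set" where
  "cell x = frame_map ` {c. \<forall>k. (\<chi> k. of_int (coord x k)) $ k < c $ k \<and> c $ k \<le> (\<chi> k. of_int (coord x k)) $ k + 1}"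

lemma finite_pts: "finite (pts R)"
  unfolding pts_def by (rule finite_log_ge)

lemma diam_nonneg: "0 \<le> diam"
  unfolding diam_def by (intro sum_nonneg) auto

lemma small_combination:
  assumes "\<And>k. \<bar>e k\<bar> \<le> 1"
  shows "\<bar>(\<Sum>k\<in>UNIV. e k *\<^sub>R l k) $ i\<bar> \<le> diam"
proof -
  have "\<bar>(\<Sum>k\<in>UNIV. e k *\<^sub>R l k) $ i\<bar> \<le> (\<Sum>k\<in>UNIV. \<bar>e k * l k $ i\<bar>)"
    by (simp add: sum_abs)
  also have "\<dots> \<le> (\<Sum>k\<in>UNIV. \<Sum>i\<in>UNIV. \<bar>l k $ i\<bar>)"
  proof (rule sum_mono)
    fix k
    have "\<bar>e k * l k $ i\<bar> \<le> 1 * \<bar>l k $ i\<bar>"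
      unfolding abs_mult by (intro mult_right_mono assms) simp
    also have "\<dots> \<le> (\<Sum>i\<in>UNIV. \<bar>l k $ i\<bar>)"
      using member_le_sum[of i UNIV "\<lambda>i. \<bar>l k $ i\<bar>"] by simp
    finally show "\<bar>e k * l k $ i\<bar> \<le> (\<Sum>i\<in>UNIV. \<bar>l k $ i\<bar>)" .
  qed
  finally show ?thesis by (simp add: diam_def)
qed

lemma measure_cell: "cell x \<in> lmeasurable" "measure lebesgue (cell x) = \<bar>frame_det\<bar>"
  using measure_linear_image_finite[OF linear_frame_map halfopen_cube_measure(1)[of "\<chi> k. of_int (coord x k)"]]
  unfolding cell_def halfopen_cube_measure(2) det_frame_map by auto

lemma cell_disjoint:
  assumes "x \<in> V" "y \<in> V" "x \<noteq> y"
  shows "cell x \<inter> cell y = {}"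
proof (rule ccontr)
  assume "cell x \<inter> cell y \<noteq> {}"
  then obtain c d where *: "frame_map c = frame_map d"
    "\<And>k. of_int (coord x k) < c $ k \<and> c $ k \<le> of_int (coord x k) + 1"
    "\<And>k. of_int (coord y k) < d $ k \<and> d $ k \<le> of_int (coord y k) + 1"
    by (auto simp: cell_def)
  then have "c = d" using inj_frame_map by (simp add: inj_eq)
  have "coord x k = coord y k" for k
  proof -
    have "real_of_int (coord x k) < of_int (coord y k) + 1" "real_of_int (coord y k) < of_int (coord x k) + 1"
      using *(2,3)[of k] unfolding \<open>c = d\<close> by linarith+
    then show ?thesis by linarith
  qed
  then show False using coord_inj assms by blast
qed

lemma frame_map_near:
  assumes x: "x \<in> V" and c: "\<And>k. of_int (coord x k) < c $ k \<and> c $ k \<le> of_int (coord x k) + 1"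
  shows "\<bar>frame_map c $ i - c $ i0 - log_abs x $ i\<bar> \<le> diam"
proof -
  have "frame_map c $ i - c $ i0 - log_abs x $ i = (\<Sum>k\<in>UNIV. (c $ k - of_int (coord x k)) *\<^sub>R l k) $ i"
    by (simp add: frame_map_eq coord(2)[OF x] left_diff_distrib sum_subtractf)
  also have "\<bar>\<dots>\<bar> \<le> diam"
  proof (rule small_combination)
    fix k show "\<bar>c $ k - real_of_int (coord x k)\<bar> \<le> 1" using c[of k] by linarith
  qed
  finally show ?thesis .
qed

lemma measure_cells: "measure lebesgue (\<Union>x\<in>pts R. cell x) = card (pts R) * \<bar>frame_det\<bar>"
proof -
  have "measure lebesgue (\<Union>x\<in>pts R. cell x) = (\<Sum>x\<in>pts R. measure lebesgue (cell x))"
  proof (rule measure_UNION'[OF finite_pts measure_cell(1)])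
    show "pairwise (\<lambda>x y. disjnt (cell x) (cell y)) (pts R)"
      using cell_disjoint by (auto simp: pairwise_def disjnt_def pts_def)
  qed
  then show ?thesis by (simp add: measure_cell)
qed

lemma cells_measurable: "(\<Union>x\<in>pts R. cell x) \<in> lmeasurable"
  by (intro fmeasurable.finite_UN finite_pts measure_cell)

text \<open>This is the set of nonnegative vectors whose trace divided by \<open>CARD('n)\<close>
  lies in \<open>(a, a + 1]\<close>. Subtracting \<open>a\<close> times the all-ones vector moves it
  to height coordinates in (0, 1], the range occupied by the cells.\<close>

lemma measure_slab:
  assumes "0 \<le> a"
  shows "corner (real CARD('n) * (a + 1)) - corner (real CARD('n) * a) \<in> (lmeasurable :: (real ^ 'n) set set)"
    "measure lebesgue (corner (real CARD('n) * (a + 1)) - corner (real CARD('n) * a) :: (real ^ 'n) set)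
      = real CARD('n) ^ CARD('n) / fact CARD('n) * ((a + 1) ^ CARD('n) - a ^ CARD('n))"
proof -
  let ?n = "real CARD('n)"
  have le: "?n * a \<le> ?n * (a + 1)" by (simp add: mult_left_mono)
  have nn: "0 \<le> ?n * a" "0 \<le> ?n * (a + 1)" using assms by auto
  note m = corner_measure[where 'n = 'n, OF nn(1)] corner_measure[where 'n = 'n, OF nn(2)]
  show "corner (?n * (a + 1)) - corner (?n * a) \<in> (lmeasurable :: (real ^ 'n) set set)"
    using m by (intro fmeasurable_Diff) (auto intro: fmeasurableD)
  have "measure lebesgue (corner (?n * (a + 1)) - corner (?n * a) :: (real ^ 'n) set)
     = measure lebesgue (corner (?n * (a + 1)) :: (real ^ 'n) set) - measure lebesgue (corner (?n * a) :: (real ^ 'n) set)"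
    using m corner_mono[OF le] by (intro measurable_measure_Diff) (auto intro: fmeasurableD)
  also have "\<dots> = ?n ^ CARD('n) / fact CARD('n) * ((a + 1) ^ CARD('n) - a ^ CARD('n))"
    unfolding m by (simp add: power_mult_distrib diff_divide_distrib right_diff_distrib)
  finally show "measure lebesgue (corner (?n * (a + 1)) - corner (?n * a) :: (real ^ 'n) set)
      = ?n ^ CARD('n) / fact CARD('n) * ((a + 1) ^ CARD('n) - a ^ CARD('n))" .
qed

text \<open>The shift by \<open>R + diam\<close> absorbs the error in \<open>frame_map_near\<close>,
  so all coordinates become nonnegative and the disjoint cells fit into the slab.\<close>

lemma count_upper:
  assumes "0 \<le> R"
  shows "card (pts R) * \<bar>frame_det\<bar> \<le> real CARD('n) ^ CARD('n) / fact CARD('n) *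
    ((R + diam + 1) ^ CARD('n) - (R + diam) ^ CARD('n))"
proof -
  let ?n = "real CARD('n)" let ?a = "R + diam"
  let ?D = "corner (?n * (?a + 1)) - corner (?n * ?a) :: (real ^ 'n) set"
  have a: "0 \<le> ?a" using assms diam_nonneg by simp
  have "(+) (?a *\<^sub>R 1) ` (\<Union>x\<in>pts R. cell x) \<subseteq> ?D"
  proof clarify
    fix x y assume x: "x \<in> pts R" and "y \<in> cell x"
    then obtain c where y: "y = frame_map c" and c: "\<And>k. of_int (coord x k) < c $ k \<and> c $ k \<le> of_int (coord x k) + 1"
      by (auto simp: cell_def)
    have xV: "x \<in> V" using x by (simp add: pts_def)
    have c0: "0 < c $ i0" "c $ i0 \<le> 1" using c[of i0] coord(1)[OF xV] by auto
    have pos: "0 \<le> (?a *\<^sub>R 1 + y) $ i" for i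
    proof -
      have "- R \<le> log_abs x $ i" using x by (simp add: pts_def)
      then show ?thesis using frame_map_near[OF xV c, of i] c0 by (simp add: y)
    qed
    have s: "(\<Sum>i\<in>UNIV. (?a *\<^sub>R 1 + y) $ i) = ?n * (?a + c $ i0)"
      by (simp add: y sum.distrib frame_map_trace algebra_simps)
    have "?n * ?a < ?n * (?a + c $ i0)" "?n * (?a + c $ i0) \<le> ?n * (?a + 1)" using c0 by auto
    then show "?a *\<^sub>R 1 + y \<in> ?D" unfolding corner_def Diff_iff mem_Collect_eq s using pos by auto
  qed
  then have "measure lebesgue ((+) (?a *\<^sub>R 1) ` (\<Union>x\<in>pts R. cell x)) \<le> measure lebesgue ?D"
    using measure_slab(1)[OF a] cells_measurable
    by (intro measure_mono_fmeasurable fmeasurableD[OF measurable_translation]) auto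
  then show ?thesis using measure_slab(2)[OF a] measure_cells by (simp add: measure_translation)
qed

text \<open>The slab for \<open>R - diam - 1\<close>, moved back, is covered by the cells of
  \<open>pts R\<close>. Besides \<open>diam\<close> one unit is lost, because the height coordinate
  can be as large as 1.\<close>

lemma count_lower:
  assumes "diam + 1 \<le> R"
  shows "real CARD('n) ^ CARD('n) / fact CARD('n) *
    ((R - diam) ^ CARD('n) - (R - diam - 1) ^ CARD('n)) \<le> card (pts R) * \<bar>frame_det\<bar>"
proof -
  let ?n = "real CARD('n)" let ?a = "R - diam - 1"
  let ?D = "corner (?n * (?a + 1)) - corner (?n * ?a) :: (real ^ 'n) set"
  have a: "0 \<le> ?a" using assms by simp
  have "(+) ((- ?a) *\<^sub>R 1) ` ?D \<subseteq> (\<Union>x\<in>pts R. cell x)"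
  proof clarify
    fix y :: "real ^ 'n" assume y: "y \<in> corner (?n * (?a + 1))" "y \<notin> corner (?n * ?a)"
    obtain c where c: "(- ?a) *\<^sub>R 1 + y = frame_map c" using surj_frame_map by (metis surjD)
    have pos: "0 \<le> y $ i" for i using y by (simp add: corner_def)
    have s: "?n * ?a < (\<Sum>i\<in>UNIV. y $ i)" "(\<Sum>i\<in>UNIV. y $ i) \<le> ?n * (?a + 1)"
      using y by (auto simp: corner_def)
    have "(\<Sum>i\<in>UNIV. frame_map c $ i) = (\<Sum>i\<in>UNIV. y $ i) - ?n * ?a"
      unfolding c[symmetric] by (simp add: sum_subtractf sum.distrib sum_negf algebra_simps)
    then have "0 < ?n * c $ i0" "?n * c $ i0 \<le> ?n * 1"
      using s unfolding frame_map_trace distrib_left by linarith+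
    then have c0: "0 < c $ i0" "c $ i0 \<le> 1" by (auto simp: zero_less_mult_iff mult_le_cancel_left)
    \<comment> \<open>Rounding up and subtracting 1 matches the half-open cells; as
      \<open>c $ i0\<close> lies in (0, 1], this gives 0 at \<open>i0\<close>, in agreement with
      \<open>coord\<close>.\<close>
    define m where "m k = \<lceil>c $ k\<rceil> - 1" for k
    have m0: "m i0 = 0" using c0 by (simp add: m_def ceiling_eq_iff)
    obtain x where x: "x \<in> V" "log_abs x = (\<Sum>k\<in>UNIV. of_int (m k) *\<^sub>R l k)"
      using coords_ex by blast
    have "frame_map (\<chi> k. of_int (coord x k)) = frame_map (\<chi> k. of_int (m k))"
      using x coord(1)[OF x(1)] m0 by (simp add: frame_map_eq flip: coord(2)[OF x(1)])
    then have "(\<chi> k. of_int (coord x k)) = ((\<chi> k. of_int (m k)) :: real ^ 'n)"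
      using inj_frame_map by (simp add: inj_eq)
    then have cm: "coord x k = m k" for k by (simp add: vec_eq_iff)
    have cc: "of_int (coord x k) < c $ k \<and> c $ k \<le> of_int (coord x k) + 1" for k
      unfolding cm m_def by linarith
    have "- R \<le> log_abs x $ i" for i
    proof -
      have "frame_map c $ i = - ?a + y $ i" unfolding c[symmetric] by simp
      then show ?thesis using frame_map_near[OF x(1) cc, of i] c0 pos[of i] by linarith
    qed
    then have "x \<in> pts R" using x by (simp add: pts_def)
    moreover have "frame_map c \<in> cell x" using cc by (auto simp: cell_def)
    ultimately show "(- ?a) *\<^sub>R 1 + y \<in> (\<Union>x\<in>pts R. cell x)" unfolding c by blast
  qed
  then have "measure lebesgue ((+) ((- ?a) *\<^sub>R 1) ` ?D) \<le> measure lebesgue (\<Union>x\<in>pts R. cell x)"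
    using measure_slab(1)[OF a] cells_measurable
    by (intro measure_mono_fmeasurable fmeasurableD[OF measurable_translation]) auto
  then show ?thesis using measure_slab(2)[OF a] measure_cells by (simp add: measure_translation)
qed

definition density :: real where
  "density = real CARD('n) ^ CARD('n) * real CARD('n) / (fact CARD('n) * \<bar>frame_det\<bar>)"

text \<open>Both bounds have the same leading term whatever the shift \<open>K\<close>. Hence the
  number of points between \<open>pts (R - diam)\<close> and \<open>pts (R + diam)\<close> is
  negligible against \<open>R ^ (CARD('n) - 1)\<close>.\<close>

lemma pts_asymptotics:
  "((\<lambda>R. real (card (pts (R + K))) / R ^ (CARD('n) - 1)) \<longlongrightarrow> density) at_top"
proof -
  let ?n = "CARD('n)" let ?k = "real ?n ^ ?n / fact ?n"
  have D: "\<bar>frame_det\<bar> > 0" using frame_det_nonzero by simp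
  have lim: "((\<lambda>R. ?k * (((R + a + 1) ^ ?n - (R + a) ^ ?n) / R ^ (?n - 1)) / \<bar>frame_det\<bar>) \<longlongrightarrow> density) at_top" for a
  proof -
    have "((\<lambda>R. ?k * (((R + a + 1) ^ ?n - (R + a) ^ ?n) / R ^ (?n - 1)) / \<bar>frame_det\<bar>) \<longlongrightarrow>
       ?k * real ?n / \<bar>frame_det\<bar>) at_top"
      by (intro tendsto_intros tendsto_power_diff_ratio) (use D in auto)
    then show ?thesis by (simp add: density_def)
  qed
  show ?thesis
  proof (rule tendsto_sandwich[OF _ _ lim[of "K - diam - 1"] lim[of "K + diam"]])
    show "\<forall>\<^sub>F R in at_top. ?k * (((R + (K - diam - 1) + 1) ^ ?n - (R + (K - diam - 1)) ^ ?n) / R ^ (?n - 1)) / \<bar>frame_det\<bar>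
        \<le> real (card (pts (R + K))) / R ^ (?n - 1)"
      using eventually_ge_at_top[of "max 1 (diam + 1 - K)"]
    proof eventually_elim
      case (elim R)
      then have R: "R > 0" "diam + 1 \<le> R + K" by auto
      have "?k * ((R + K - diam) ^ ?n - (R + K - diam - 1) ^ ?n) / (\<bar>frame_det\<bar> * R ^ (?n - 1))
          \<le> card (pts (R + K)) * \<bar>frame_det\<bar> / (\<bar>frame_det\<bar> * R ^ (?n - 1))"
        using R(1) D by (intro divide_right_mono count_lower R(2)) auto
      then show ?case using D by (simp add: algebra_simps)
    qed
    show "\<forall>\<^sub>F R in at_top. real (card (pts (R + K))) / R ^ (?n - 1)
       \<le> ?k * (((R + (K + diam) + 1) ^ ?n - (R + (K + diam)) ^ ?n) / R ^ (?n - 1)) / \<bar>frame_det\<bar>"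
      using eventually_ge_at_top[of "max 1 (- K)"]
    proof eventually_elim
      case (elim R)
      then have R: "R > 0" "0 \<le> R + K" by auto
      have "card (pts (R + K)) * \<bar>frame_det\<bar> / (\<bar>frame_det\<bar> * R ^ (?n - 1))
        \<le> ?k * ((R + K + diam + 1) ^ ?n - (R + K + diam) ^ ?n) / (\<bar>frame_det\<bar> * R ^ (?n - 1))"
        using R(1) D by (intro divide_right_mono count_upper R(2)) auto
      then show ?case using D by (simp add: algebra_simps)
    qed
  qed
qed

end

section \<open>The degree of the labelling\<close>

text \<open>A permutation that never increases the numbering \<open>r\<close> must be the identity,
  since it preserves the sum of all values of \<open>r\<close>; only its Leibniz term
  survives.\<close>

lemma det_unitriangular:
  fixes W :: "'a::comm_ring_1 ^ 'n ^ 'n" and r :: "'n \<Rightarrow> nat"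
  assumes r: "inj r" and diag: "\<And>i. W $ i $ i = 1" and tri: "\<And>i j. W $ i $ j \<noteq> 0 \<Longrightarrow> r j \<le> r i"
  shows "det W = 1"
proof -
  have id: "p = id" if p: "p permutes UNIV" and le: "\<And>i. r (p i) \<le> r i" for p
  proof (rule ccontr)
    assume "p \<noteq> id"
    then obtain i where "p i \<noteq> i" by (auto simp: fun_eq_iff)
    then have "r (p i) < r i" using le[of i] r by (metis injD le_neq_implies_less)
    then have "(\<Sum>i\<in>UNIV. r (p i)) < (\<Sum>i\<in>UNIV. r i)"
      using le by (intro sum_strict_mono_ex1) auto
    moreover have "(\<Sum>i\<in>UNIV. r (p i)) = (\<Sum>i\<in>UNIV. r i)"
      using sum.permute[OF p, of r] by (simp add: comp_def)
    ultimately show False by simp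
  qed
  have "det W = (\<Sum>p\<in>{p. p permutes UNIV}. of_int (sign p) * (\<Prod>i\<in>UNIV. W $ i $ p i))"
    by (simp add: det_def)
  also have "\<dots> = (\<Sum>p\<in>{id}. of_int (sign p) * (\<Prod>i\<in>UNIV. W $ i $ p i))"
  proof (rule sum.mono_neutral_right)
    show "\<forall>p\<in>{p. p permutes UNIV} - {id}. of_int (sign p) * (\<Prod>i\<in>UNIV. W $ i $ p i) = 0"
    proof
      fix p assume "p \<in> {p. p permutes (UNIV :: 'n set)} - {id}"
      then obtain i where "\<not> r (p i) \<le> r i" using id by blast
      then have "W $ i $ p i = 0" using tri by blast
      then have "(\<Prod>i\<in>UNIV. W $ i $ p i) = 0" by (intro prod_zero) auto
      then show "of_int (sign p) * (\<Prod>i\<in>UNIV. W $ i $ p i) = 0" by simp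
    qed
  qed (auto simp: finite_permutations permutes_id)
  finally show ?thesis by (simp add: diag)
qed

definition cvec :: "real ^ 'n \<Rightarrow> complex ^ 'n" where "cvec y = (\<chi> i. of_real (y $ i))"

lemma rows_det_cvec: "rows_det (\<lambda>i. cvec (y i)) = of_real (det (\<chi> i. y i))"
  by (simp add: det_def cvec_def)

lemma Tr_cvec: "Tr (cvec y * 1) = of_real (\<Sum>i\<in>UNIV. y $ i)"
  by (simp add: Tr_def cvec_def)

lemma norm_det_le:
  fixes y :: "'n \<Rightarrow> 'a::real_normed_field ^ 'n"
  assumes "\<And>i j. norm (y i $ j) \<le> b i"
  shows "norm (det (\<chi> i. y i)) \<le> fact CARD('n) * (\<Prod>i\<in>UNIV. b i)"
proof -
  have "norm (det (\<chi> i. y i)) \<le> (\<Sum>p\<in>{p. p permutes UNIV}. norm (of_int (sign p) * (\<Prod>i\<in>UNIV. y i $ p i)))"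
    unfolding det_def by (simp add: norm_sum)
  also have "\<dots> \<le> (\<Sum>p\<in>{p. p permutes (UNIV :: 'n set)}. \<Prod>i\<in>UNIV. b i)"
  proof (rule sum_mono)
    fix p
    have "norm (of_int (sign p) * (\<Prod>i\<in>UNIV. y i $ p i)) = (\<Prod>i\<in>UNIV. norm (y i $ p i))"
      by (simp add: norm_mult sign_def flip: prod_norm)
    also have "\<dots> \<le> (\<Prod>i\<in>UNIV. b i)" by (intro prod_mono) (use assms in auto)
    finally show "norm (of_int (sign p) * (\<Prod>i\<in>UNIV. y i $ p i)) \<le> (\<Prod>i\<in>UNIV. b i)" .
  qed
  also have "\<dots> = fact CARD('n) * (\<Prod>i\<in>UNIV. b i)"
    by (simp add: card_permutations[of UNIV "CARD('n)"])
  finally show ?thesis .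
qed

lemma summable_on_finite_support:
  assumes "finite A" "\<And>x. x \<in> V \<Longrightarrow> x \<notin> A \<Longrightarrow> h x = 0"
  shows "h summable_on V"
proof -
  have "h summable_on V \<longleftrightarrow> h summable_on (V \<inter> A)"
    by (rule summable_on_cong_neutral) (use assms in auto)
  then show ?thesis using assms by (simp add: summable_on_finite)
qed

section \<open>Labels and clipped logarithms\<close>

definition max_index :: "complex ^ 'n \<Rightarrow> 'n" where
  "max_index x = (SOME i. \<forall>j. norm (x $ j) \<le> norm (x $ i))"

lemma max_index: "norm (x $ j) \<le> norm (x $ max_index x)"
proof -
  have "Max (range (\<lambda>i. norm (x $ i))) \<in> range (\<lambda>i. norm (x $ i))" by (rule Max_in) auto
  then obtain i where "Max (range (\<lambda>i. norm (x $ i))) = norm (x $ i)" by blast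
  then have "\<forall>j. norm (x $ j) \<le> norm (x $ i)" by (metis Max_ge finite_imageI finite rangeI)
  then have "\<forall>j. norm (x $ j) \<le> norm (x $ max_index x)" unfolding max_index_def by (rule someI)
  then show ?thesis by blast
qed

definition label :: "complex ^ 'n \<Rightarrow> complex ^ 'n" where "label x = axis (max_index x) 1"

lemma Tr_axis: "Tr (axis i 1 * z) = z $ i"
proof -
  have "Tr (axis i 1 * z) = (\<Sum>j\<in>UNIV. if j = i then z $ j else 0)"
    unfolding Tr_def by (rule sum.cong) (auto simp: axis_def)
  then show ?thesis by simp
qed

context log_lattice
begin

lemma inj_r: "inj r" using r_eq_iff by (auto intro: injI)

lemma log_abs_vert: "log_abs (vert w i) = (\<Sum>k\<in>snd w \<inter> fst w ` front i. l k)"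
proof -
  have "log_abs (\<Prod>k\<in>A. v k) = (\<Sum>k\<in>A. l k)" for A
  proof (induction A rule: infinite_finite_induct)
    case (insert k A)
    then show ?case using log_abs_mult_in[OF v_in prod_in] by simp
  qed (auto simp: log_abs_def vec_eq_iff)
  then show ?thesis by (simp add: vert_def)
qed

lemma log_abs_vert_bound: "\<bar>log_abs (vert w m) $ i\<bar> \<le> diam"
proof -
  have "(\<Sum>k\<in>A. l k) = (\<Sum>k\<in>UNIV. (if k \<in> A then 1 else 0) *\<^sub>R l k)" for A
    by (simp add: if_distrib[of "\<lambda>t. t *\<^sub>R _"] sum.If_cases cong: if_cong)
  then have "log_abs (vert w m) = (\<Sum>k\<in>UNIV. (if k \<in> snd w \<inter> fst w ` front m then 1 else 0) *\<^sub>R l k)"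
    unfolding log_abs_vert .
  then show ?thesis using small_combination[of "\<lambda>k. if k \<in> snd w \<inter> fst w ` front m then 1 else 0"] by simp
qed

text \<open>On \<open>pts R\<close> this is the affine function \<open>R + log_abs x\<close>, whose
  determinants are volumes. Where a logarithm drops below \<open>- R\<close> the corresponding
  coordinate vanishes, and on \<open>V\<close> the trace stays at least \<open>CARD('n) * R\<close>,
  so no denominator vanishes for \<open>R > 0\<close>.\<close>

definition clip :: "real \<Rightarrow> complex ^ 'n \<Rightarrow> real ^ 'n" where
  "clip R x = (\<chi> i. max 0 (log_abs x $ i + R))"

lemma clip_trace:
  assumes "x \<in> V"
  shows "real CARD('n) * R \<le> (\<Sum>i\<in>UNIV. clip R x $ i)"
proof -
  have "real CARD('n) * R = (\<Sum>i\<in>UNIV. log_abs x $ i + R)"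
    using trace0[OF assms] by (simp add: sum.distrib)
  also have "\<dots> \<le> (\<Sum>i\<in>UNIV. clip R x $ i)" by (rule sum_mono) (simp add: clip_def)
  finally show ?thesis .
qed

lemma Tr_clip: "x \<in> V \<Longrightarrow> R > 0 \<Longrightarrow> Tr (cvec (clip R x) * 1) \<noteq> 0"
  unfolding Tr_cvec of_real_eq_0_iff using clip_trace[of x R]
  by (metis mult_pos_pos not_le of_nat_0_less_iff zero_less_card_finite)

lemma log_abs_max_index: "x \<in> V \<Longrightarrow> log_abs x $ max_index x \<ge> 0"
proof (rule ccontr)
  assume x: "x \<in> V" and "\<not> log_abs x $ max_index x \<ge> 0"
  moreover have "log_abs x $ i \<le> log_abs x $ max_index x" for i
    using max_index[of x i] nz[OF x] by (simp add: log_abs_def)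
  then have "(\<Sum>i\<in>UNIV. log_abs x $ i) \<le> (\<Sum>i\<in>(UNIV :: 'n set). log_abs x $ max_index x)"
    by (intro sum_mono)
  ultimately show False using trace0[OF x] by (simp add: zero_le_mult_iff)
qed

lemma outside_pts:
  assumes "x \<in> V" "x \<notin> pts (R + diam)"
  obtains i where "\<And>w m. log_abs (x * vert w m) $ i < - R"
proof -
  obtain i where "log_abs x $ i < - (R + diam)" using assms by (auto simp: pts_def not_le)
  then have "log_abs (x * vert w m) $ i < - R" for w m
    using log_abs_vert_bound[of w m i] by (simp add: log_abs_mult_in assms vert_in)
  then show ?thesis by (rule that)
qed

lemma clip_zero: "log_abs x $ i < - R \<Longrightarrow> cvec (clip R x) $ i = 0"
  by (simp add: cvec_def clip_def)

text \<open>A product of absolute value 1 forces the largest coordinate to have a nonnegative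
  logarithm, so the index \<open>i\<close> cannot be the label.\<close>

lemma label_zero:
  assumes "x \<in> V" "R > 0" "log_abs x $ i < - R"
  shows "label x $ i = 0"
  using log_abs_max_index[OF assms(1)] assms(2,3) by (auto simp: label_def axis_def)

lemma clip_has_sum:
  assumes R: "R > 0" and S: "(chain_sum 1 (\<lambda>i. label) has_sum S) V"
  shows "(chain_sum 1 (\<lambda>i x. cvec (clip R x)) has_sum S) V"
proof (rule replace_all[OF _ _ _ S])
  show "Tr (label x * 1) \<noteq> 0" for x unfolding label_def Tr_axis by simp
  show "Tr (cvec (clip R x) * 1) \<noteq> 0" if "x \<in> V" for x using Tr_clip[OF that R] .
  fix k w
  show "(\<lambda>x. g_rows 1 (\<lambda>i. if i = i0 then cvec (clip R (x * vert w k))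
         else if r i < r k then cvec (clip R (x * vert w i)) else label (x * vert w i))) summable_on V"
  proof (rule summable_on_finite_support[OF finite_pts[of "R + diam"]])
    fix x assume x: "x \<in> V" "x \<notin> pts (R + diam)"
    obtain i where i: "\<And>w m. log_abs (x * vert w m) $ i < - R" using outside_pts[OF x] by blast
    have "rows_det (\<lambda>i. if i = i0 then cvec (clip R (x * vert w k))
         else if r i < r k then cvec (clip R (x * vert w i)) else label (x * vert w i)) = 0"
      by (rule rows_det_zero_coord[of _ i])
        (auto simp: clip_zero i intro!: label_zero[OF mult_in[OF x(1) vert_in] R])
    then show "g_rows 1 (\<lambda>i. if i = i0 then cvec (clip R (x * vert w k))
         else if r i < r k then cvec (clip R (x * vert w i)) else label (x * vert w i)) = 0"
      by (simp add: g_rows_def)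
  qed
qed

lemma clip_outside:
  assumes "x \<in> V" "x \<notin> pts (R + diam)"
  shows "chain_sum 1 (\<lambda>i x. cvec (clip R x)) x = 0"
proof -
  obtain i where i: "\<And>w m. log_abs (x * vert w m) $ i < - R" using outside_pts[OF assms] by blast
  have "rows_det (\<lambda>m. cvec (clip R (x * vert w m))) = 0" for w
    by (rule rows_det_zero_coord[of _ i]) (simp add: clip_zero i)
  then show ?thesis by (simp add: g_rows_def)
qed

text \<open>Passing to successive differences of the rows is a unitriangular change.\<close>

lemma det_partial_sums:
  fixes a :: "real ^ 'n" and u :: "'n \<Rightarrow> real ^ 'n"
  shows "det (\<chi> m. a + (\<Sum>j\<in>front m. u j)) = det (\<chi> m. if m = i0 then a else u m)"
proof -
  let ?W = "(\<chi> m j. if r j \<le> r m then 1 else 0) :: real ^ 'n ^ 'n"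
  let ?B = "(\<chi> m. if m = i0 then a else u m) :: real ^ 'n ^ 'n"
  have le: "{j. r j \<le> r m} = insert i0 (front m)" for m
  proof -
    have "r j \<le> r m \<longleftrightarrow> j = i0 \<or> 0 < r j \<and> r j \<le> r m" for j
      using r_eq_iff[of j i0] r_i0 by (cases "j = i0") auto
    then show ?thesis by (auto simp: front_def)
  qed
  have "(a + (\<Sum>j\<in>front m. u j)) $ k = (\<Sum>j\<in>UNIV. ?W $ m $ j * ?B $ j $ k)" for m k
  proof -
    have "(\<Sum>j\<in>UNIV. ?W $ m $ j * ?B $ j $ k) = (\<Sum>j\<in>{j. r j \<le> r m}. ?B $ j $ k)"
      by (simp add: if_distrib[of "\<lambda>t. t * _"] sum.If_cases cong: if_cong)
    also have "\<dots> = a $ k + (\<Sum>j\<in>front m. ?B $ j $ k)"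
      unfolding le by (subst sum.insert) (auto simp: front_def r_i0)
    also have "(\<Sum>j\<in>front m. ?B $ j $ k) = (\<Sum>j\<in>front m. u j $ k)"
      by (rule sum.cong) (auto simp: front_def r_i0)
    finally show ?thesis by simp
  qed
  then have "(\<chi> m. a + (\<Sum>j\<in>front m. u j)) = ?W ** ?B"
    by (simp add: vec_eq_iff matrix_matrix_mult_def)
  moreover have "det ?W = 1" by (rule det_unitriangular[OF inj_r]) (auto split: if_splits)
  ultimately show ?thesis by (simp add: det_mul)
qed

text \<open>For the clipped vertices of one simplex all rows on the right except that of type
  \<open>i0\<close> are bounded, so the determinant grows at most linearly in
  \<open>R\<close>.\<close>

lemma det_differences:
  fixes y :: "'n \<Rightarrow> real ^ 'n"
  shows "det (\<chi> m. y m) = det (\<chi> m. if m = i0 then y i0 else y m - y i0)"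
proof -
  let ?W = "(\<chi> m j. if j = m \<or> j = i0 then 1 else 0) :: real ^ 'n ^ 'n"
  let ?B = "(\<chi> m. if m = i0 then y i0 else y m - y i0) :: real ^ 'n ^ 'n"
  have "y m $ k = (\<Sum>j\<in>UNIV. ?W $ m $ j * ?B $ j $ k)" for m k
  proof -
    have "(\<Sum>j\<in>UNIV. ?W $ m $ j * ?B $ j $ k) = (\<Sum>j\<in>{j. j = m \<or> j = i0}. ?B $ j $ k)"
      by (simp add: if_distrib[of "\<lambda>t. t * _"] sum.If_cases cong: if_cong)
    also have "{j. j = m \<or> j = i0} = {m, i0}" by auto
    finally show ?thesis by (cases "m = i0") auto
  qed
  then have "(\<chi> m. y m) = ?W ** ?B"
    by (simp add: vec_eq_iff matrix_matrix_mult_def)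
  moreover have "det ?W = 1"
    by (rule det_unitriangular[OF inj_r]) (auto simp: r_i0 split: if_splits)
  ultimately show ?thesis by (simp add: det_mul)
qed

text \<open>The logarithms of the vertices are partial sums along the order \<open>s\<close>, and a
  direction frozen at the end 0 gives a zero difference. Only the flags with all directions frozen
  at the end 1 survive: they form the triangulation of the cube by orderings of its directions. The
  summand \<open>log_abs x\<close> lies in the span of the generators and can be removed from the
  row of type \<open>i0\<close>.\<close>

lemma det_flag:
  assumes w: "(s, e) \<in> flags" and x: "x \<in> V"
  shows "det (\<chi> m. (R *\<^sub>R 1 + log_abs x) + (\<Sum>k\<in>e \<inter> s ` front m. l k))
    = (if e = UNIV - {i0} then of_int (sign s) * (R * frame_det) else 0)"
proof -
  have s: "s permutes UNIV - {i0}" and e: "e \<subseteq> UNIV - {i0}" using w by (auto simp: flags_def)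
  have si0: "s i0 = i0" using s by (simp add: permutes_def)
  have s': "s permutes UNIV" using s by (rule permutes_subset) auto
  let ?a = "R *\<^sub>R 1 + log_abs x"
  define u where "u j = (if s j \<in> e then l (s j) else 0)" for j
  have "(\<Sum>k\<in>e \<inter> s ` front m. l k) = (\<Sum>j\<in>front m. u j)" for m
  proof -
    have "(\<Sum>j\<in>front m. u j) = (\<Sum>k\<in>s ` front m. if k \<in> e then l k else 0)"
      unfolding u_def by (rule sum.reindex_cong[OF permutes_inj_on[OF s], symmetric]) auto
    also have "\<dots> = (\<Sum>k\<in>e \<inter> s ` front m. l k)"
      by (simp add: sum.If_cases Int_commute)
    finally show ?thesis by simp
  qed
  then have "det (\<chi> m. ?a + (\<Sum>k\<in>e \<inter> s ` front m. l k)) = det (\<chi> m. if m = i0 then ?a else u m)"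
    using det_partial_sums[of ?a u] by simp
  also have "\<dots> = (if e = UNIV - {i0} then of_int (sign s) * (R * frame_det) else 0)"
  proof (cases "e = UNIV - {i0}")
    case False
    then obtain k where k: "k \<noteq> i0" "k \<notin> e" using e by blast
    obtain m where m: "s m = k" using permutes_surj[OF s'] by (metis surjD)
    have "m \<noteq> i0" using m k si0 by auto
    then have "row m (\<chi> m. if m = i0 then ?a else u m) = 0"
      using m k by (simp add: row_def u_def vec_eq_iff)
    then show ?thesis using False by (simp add: det_zero_row)
  next
    case True
    let ?B = "(\<chi> k. if k = i0 then ?a else l k) :: real ^ 'n ^ 'n"
    have "(\<chi> m. if m = i0 then ?a else u m) = (\<chi> m. ?B $ s m)"
    proof -
      have "s m \<noteq> i0" if "m \<noteq> i0" for m using that si0 permutes_inj[OF s'] by (metis injD)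
      then show ?thesis using True si0 by (simp add: vec_eq_iff u_def)
    qed
    then have "det (\<chi> m. if m = i0 then ?a else u m) = of_int (sign s) * det ?B"
      by (simp only: det_permute_rows[OF s'])
    also have "det ?B = R * frame_det"
    proof -
      let ?A = "(\<chi> k. if k = i0 then R *s 1 else l k) :: real ^ 'n ^ 'n"
      have "log_abs x \<in> vec.span {row j ?A | j. j \<noteq> i0}"
      proof -
        have "(\<Sum>k\<in>UNIV. of_int (coord x k) *s l k) \<in> vec.span {row j ?A | j. j \<noteq> i0}"
        proof (intro vec.span_sum vec.span_scale)
          fix k show "l k \<in> vec.span {row j ?A | j. j \<noteq> i0}"
          proof (cases "k = i0")
            case False
            then have "l k = row k ?A" by (simp add: row_def vec_eq_iff)
            then show ?thesis using False by (intro vec.span_base) blast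
          qed (simp add: l_i0 vec.span_zero)
        qed
        then show ?thesis by (simp add: coord(2)[OF x] scalar_mult_eq_scaleR)
      qed
      from det_row_span[OF this]
      have "det (\<chi> k. if k = i0 then row i0 ?A + log_abs x else row k ?A) = det ?A" .
      moreover have "(\<chi> k. if k = i0 then row i0 ?A + log_abs x else row k ?A) = ?B"
        by (simp add: vec_eq_iff row_def)
      moreover have "det ?A = R * det (\<chi> k. if k = i0 then 1 else l k)"
        by (rule det_row_mul)
      ultimately show ?thesis by (simp add: frame_det_def frame_row_def)
    qed
    finally show ?thesis using True by simp
  qed
  finally show ?thesis .
qed

text \<open>No coordinate is clipped, so every factor of the denominators equals
  \<open>CARD('n) * R\<close>, and the sign of \<open>s\<close> in the determinant cancels the one
  in \<open>fsign\<close>: all \<open>fact (CARD('n) - 1)\<close> nondegenerate simplices contribute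
  the same amount.\<close>

lemma clip_inside:
  assumes R: "R > 0" and x: "x \<in> pts (R - diam)"
  shows "chain_sum 1 (\<lambda>i x. cvec (clip R x)) x
    = of_real ((-1) ^ (CARD('n) - 1) * fact (CARD('n) - 1) * (R * frame_det) / (real CARD('n) * R) ^ CARD('n))"
proof -
  let ?n = "CARD('n)"
  have xV: "x \<in> V" using x by (simp add: pts_def)
  have clip: "clip R (x * vert w m) = R *\<^sub>R 1 + log_abs x + log_abs (vert w m)" for w m
  proof -
    have "0 \<le> R + log_abs x $ i + log_abs (vert w m) $ i" for i
    proof -
      have "- (R - diam) \<le> log_abs x $ i" using x by (simp add: pts_def)
      then show ?thesis using log_abs_vert_bound[of w m i] by linarith
    qed
    then show ?thesis
      by (simp add: vec_eq_iff clip_def log_abs_mult_in xV vert_in add_ac)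
  qed
  have inner: "g_rows 1 (\<lambda>m. cvec (clip R (x * vert w m))) =
     of_real ((if snd w = UNIV - {i0} then of_int (sign (fst w)) * (R * frame_det) else 0) / (real ?n * R) ^ ?n)"
    if "w \<in> flags" for w
  proof -
    have "Tr (cvec (clip R (x * vert w m)) * 1) = of_real (real ?n * R)" for m
      unfolding Tr_cvec clip
      using trace0[OF xV] trace0[OF vert_in[of w m]] by (simp add: sum.distrib)
    moreover have "det (\<chi> m. clip R (x * vert w m))
        = (if snd w = UNIV - {i0} then of_int (sign (fst w)) * (R * frame_det) else 0)"
      using det_flag[of "fst w" "snd w" x R] that xV by (simp add: clip log_abs_vert)
    ultimately show ?thesis unfolding g_rows_def rows_det_cvec by simp
  qed
  let ?c = "of_real (R * frame_det / (real ?n * R) ^ ?n) :: complex"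
  let ?P = "{s. s permutes UNIV - {i0}}"
  have "chain_sum 1 (\<lambda>i x. cvec (clip R x)) x
    = (\<Sum>(s, e)\<in>flags. if e = UNIV - {i0} then (-1) ^ card (UNIV - {i0}) * ?c else 0)"
  proof (rule sum.cong)
    fix w assume w: "w \<in> flags"
    obtain s e where se: "w = (s, e)" by (cases w)
    have "of_int (sign s) * of_int (sign s) = (1 :: complex)" by (simp add: sign_def)
    then show "of_int (fsign w) * g_rows 1 (\<lambda>i. cvec (clip R (x * vert w i)))
      = (case w of (s, e) \<Rightarrow> if e = UNIV - {i0} then (-1) ^ card (UNIV - {i0}) * ?c else 0)"
      unfolding inner[OF w] by (simp add: se fsign_def mult_ac)
  qed simp
  also have "\<dots> = (\<Sum>s\<in>?P. \<Sum>e\<in>Pow (UNIV - {i0}). if e = UNIV - {i0} then (-1) ^ card (UNIV - {i0}) * ?c else 0)"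
    unfolding flags_def by (rule sum.cartesian_product[symmetric])
  also have "\<dots> = of_nat (card ?P) * ((-1) ^ card (UNIV - {i0}) * ?c)" by simp
  also have "card ?P = fact (?n - 1)"
    by (rule card_permutations) (simp_all add: card_Diff_singleton)
  finally show ?thesis by (simp add: card_Diff_singleton)
qed

lemma pts_upper:
  assumes "x \<in> pts R" "0 \<le> R"
  shows "log_abs x $ i \<le> real CARD('n) * R"
proof -
  have x: "x \<in> V" "\<And>m. - R \<le> log_abs x $ m" using assms by (auto simp: pts_def)
  have "log_abs x $ i + (\<Sum>m\<in>UNIV - {i}. log_abs x $ m) = 0"
    using trace0[OF x(1)] by (simp add: sum.remove[of _ i])
  moreover have "of_nat (card (UNIV - {i})) * - R \<le> (\<Sum>m\<in>UNIV - {i}. log_abs x $ m)"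
    by (rule sum_bounded_below) (use x in auto)
  moreover have "real (card (UNIV - {i})) * R \<le> real CARD('n) * R"
    using assms by (intro mult_right_mono) (auto simp: card_mono)
  ultimately show ?thesis by simp
qed

text \<open>Clipping does not increase distances, so by \<open>det_differences\<close> the numerator
  is at most a multiple of \<open>R\<close>, while the denominator is at least
  \<open>R ^ CARD('n)\<close>.\<close>

lemma clip_boundary:
  obtains K where "\<And>R x. 1 \<le> R \<Longrightarrow> x \<in> pts (R + diam) \<Longrightarrow>
    norm (chain_sum 1 (\<lambda>i x. cvec (clip R x)) x) \<le> K / R ^ (CARD('n) - 1)"
proof -
  let ?n = "CARD('n)"
  define b where "b = (real ?n + 1) * (1 + diam)"
  define K0 where "K0 = fact ?n * (b * diam ^ (?n - 1))"
  show ?thesis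
  proof (rule that)
    fix R x assume R: "1 \<le> R" and x: "x \<in> pts (R + diam)"
    have xV: "x \<in> V" using x by (simp add: pts_def)
    have term_le: "norm (g_rows 1 (\<lambda>m. cvec (clip R (x * vert w m)))) \<le> K0 / R ^ (?n - 1)" for w
    proof -
      let ?y = "\<lambda>m. clip R (x * vert w m)"
      have y0: "\<bar>?y i0 $ j\<bar> \<le> b * R" for j
      proof -
        have "front i0 = {}" by (auto simp: front_def r_i0)
        then have "vert w i0 = 1" by (simp add: vert_def)
        moreover have "log_abs x $ j \<le> real ?n * (R + diam)"
          using pts_upper[OF x] R diam_nonneg by simp
        moreover have "real ?n * (R + diam) + R \<le> b * R"
        proof -
          have "diam \<le> diam * R" using R diam_nonneg by (simp add: mult_le_cancel_left1)
          then have "R + diam \<le> R + diam * R" by simp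
          then have "real ?n * (R + diam) \<le> real ?n * (R + diam * R)" by (rule mult_left_mono) simp
          moreover have "0 \<le> diam * R" using R diam_nonneg by simp
          ultimately show ?thesis unfolding b_def by (simp add: algebra_simps)
        qed
        moreover have "0 \<le> b * R" using R diam_nonneg by (simp add: b_def)
        ultimately show ?thesis by (simp add: clip_def)
      qed
      have yd: "\<bar>(?y m - ?y i0) $ j\<bar> \<le> diam" for m j
      proof -
        have "front i0 = {}" by (auto simp: front_def r_i0)
        then have "vert w i0 = 1" by (simp add: vert_def)
        then show ?thesis using log_abs_vert_bound[of w m j]
          by (simp add: clip_def log_abs_mult_in xV vert_in)
      qed
      have "norm (det (\<chi> m. ?y m)) \<le> fact ?n * (\<Prod>m\<in>UNIV. if m = i0 then b * R else diam)"
        unfolding det_differences[of ?y] by (rule norm_det_le) (use y0 yd in auto)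
      also have "(\<Prod>m\<in>UNIV. if m = i0 then b * R else diam) = b * R * diam ^ (?n - 1)"
        by (subst prod.remove[of _ i0]) (auto simp: card_Diff_singleton prod.If_cases)
      finally have d: "norm (rows_det (\<lambda>m. cvec (?y m))) \<le> K0 * R"
        unfolding rows_det_cvec by (simp add: K0_def mult_ac)
      have "R ^ ?n \<le> (\<Prod>m\<in>UNIV. \<Sum>i\<in>UNIV. ?y m $ i)"
      proof -
        have "R \<le> (\<Sum>i\<in>UNIV. ?y m $ i)" for m
        proof -
          have "R \<le> real ?n * R" using R by (simp add: mult_le_cancel_right1 Suc_le_eq)
          also have "\<dots> \<le> (\<Sum>i\<in>UNIV. ?y m $ i)" by (rule clip_trace[OF mult_in[OF xV vert_in]])
          finally show ?thesis .
        qed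
        then have "(\<Prod>m\<in>(UNIV :: 'n set). R) \<le> (\<Prod>m\<in>UNIV. \<Sum>i\<in>UNIV. ?y m $ i)"
          using R by (intro prod_mono) auto
        then show ?thesis by simp
      qed
      then have p: "R ^ ?n \<le> norm (\<Prod>m\<in>UNIV. Tr (cvec (?y m) * 1))"
        unfolding Tr_cvec by (simp flip: of_real_sum of_real_prod del: of_real_sum of_real_prod)
      have "norm (g_rows 1 (\<lambda>m. cvec (?y m))) \<le> K0 * R / R ^ ?n"
        unfolding g_rows_def norm_divide using d p R
        by (intro frac_le) (auto intro: order_trans[OF norm_ge_zero d])
      also have "\<dots> = K0 / R ^ (?n - 1)"
      proof -
        have "R ^ ?n = R * R ^ (?n - 1)" by (metis power_eq_if zero_less_card_finite less_not_refl)
        then show ?thesis using R by simp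
      qed
      finally show ?thesis .
    qed
    have "norm (chain_sum 1 (\<lambda>i x. cvec (clip R x)) x)
        \<le> (\<Sum>w\<in>flags. norm (of_int (fsign w) * g_rows 1 (\<lambda>m. cvec (clip R (x * vert w m)))))"
      by (rule norm_sum)
    also have "\<dots> \<le> (\<Sum>w\<in>flags. K0 / R ^ (?n - 1))"
    proof (rule sum_mono)
      fix w
      have "norm (of_int (fsign w) :: complex) = 1"
        by (simp add: fsign_def sign_def norm_mult norm_power)
      then show "norm (of_int (fsign w) * g_rows 1 (\<lambda>m. cvec (clip R (x * vert w m)))) \<le> K0 / R ^ (?n - 1)"
        using term_le[of w] by (simp add: norm_mult)
    qed
    also have "\<dots> = (card flags * K0) / R ^ (?n - 1)" by simp
    finally show "norm (chain_sum 1 (\<lambda>i x. cvec (clip R x)) x) \<le> (card flags * K0) / R ^ (?n - 1)" .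
  qed
qed

text \<open>
  The labels may be replaced by the clipped affine maps \<open>clip R\<close>, since far from the origin all rows
  have a common zero coordinate.  For large \<open>R\<close> the sum is then a number of lattice points times
  a volume.
\<close>

lemma label_sum:
  assumes S: "(chain_sum 1 (\<lambda>i. label) has_sum S) V"
  shows "S = of_real ((-1) ^ (CARD('n) - 1) * sgn frame_det)"
proof -
  let ?n = "CARD('n)"
  \<comment> \<open>\<open>A / R ^ (CARD('n) - 1)\<close> is the value found in
    \<open>clip_inside\<close>.\<close>
  define A where "A = (-1) ^ (?n - 1) * fact (?n - 1) * frame_det / real ?n ^ ?n"
  obtain K where K: "\<And>R x. 1 \<le> R \<Longrightarrow> x \<in> pts (R + diam) \<Longrightarrow>
    norm (chain_sum 1 (\<lambda>i x. cvec (clip R x)) x) \<le> K / R ^ (?n - 1)"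
    using clip_boundary by blast
  let ?N = "\<lambda>K R. real (card (pts (R + K))) / R ^ (?n - 1)"
  \<comment> \<open>The sum lives on \<open>pts (R + diam)\<close>. On \<open>pts (R - diam)\<close>
    the terms are one and the same constant, and the points in between contribute at most their
    number times the bound of \<open>clip_boundary\<close>.\<close>
  have est: "norm (S - of_real (A * ?N (- diam) R)) \<le> K * (?N diam R - ?N (- diam) R)" if R: "R \<ge> 1" for R
  proof -
    let ?f = "chain_sum 1 (\<lambda>i x. cvec (clip R x))"
    have sub: "pts (R + - diam) \<subseteq> pts (R + diam)" 
    proof
      fix x assume x: "x \<in> pts (R + - diam)"
      have "- (R + diam) \<le> log_abs x $ i" for i
      proof -
        have "- (R + - diam) \<le> log_abs x $ i" using x by (simp add: pts_def)
        then show ?thesis using diam_nonneg by linarith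
      qed
      then show "x \<in> pts (R + diam)" using x by (simp add: pts_def)
    qed
    have sV: "pts (R + diam) \<subseteq> V" by (auto simp: pts_def)
    have "(?f has_sum S) V" using clip_has_sum[OF _ S] R by simp
    then have "(?f has_sum S) (pts (R + diam))"
      using has_sum_cong_neutral[of "pts (R + diam)" V ?f ?f S] clip_outside sV by auto
    then have "S = sum ?f (pts (R + diam))"
      using finite_pts has_sum_finite has_sum_unique by blast
    also have "\<dots> = sum ?f (pts (R + diam) - pts (R + - diam)) + sum ?f (pts (R + - diam))"
      by (rule sum.subset_diff[OF sub finite_pts])
    also have "sum ?f (pts (R + - diam)) = of_real (A * ?N (- diam) R)"
    proof -
      have "R ^ ?n = R * R ^ (?n - 1)" by (metis power_eq_if zero_less_card_finite less_not_refl)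
      then have "(-1) ^ (?n - 1) * fact (?n - 1) * (R * frame_det) / (real ?n * R) ^ ?n = A / R ^ (?n - 1)"
        using R by (simp add: A_def power_mult_distrib)
      then have "?f x = of_real (A / R ^ (?n - 1))" if "x \<in> pts (R + - diam)" for x
        using clip_inside[of R x] that R by simp
      then have "sum ?f (pts (R + - diam)) = (\<Sum>x\<in>pts (R + - diam). of_real (A / R ^ (?n - 1)))"
        by (rule sum.cong[OF refl])
      then show ?thesis by simp
    qed
    finally have "norm (S - of_real (A * ?N (- diam) R)) = norm (sum ?f (pts (R + diam) - pts (R + - diam)))"
      by simp
    also have "\<dots> \<le> of_nat (card (pts (R + diam) - pts (R + - diam))) * (K / R ^ (?n - 1))"
      by (rule sum_norm_bound) (use K[OF R] in auto)
    also have "of_nat (card (pts (R + diam) - pts (R + - diam)))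
        = real (card (pts (R + diam))) - real (card (pts (R + - diam)))"
      using card_Diff_subset[OF finite_pts sub] card_mono[OF finite_pts sub] by simp
    also have "(a - b) * (K / p) = K * (a / p - b / p)" for a b p :: real
      by (simp add: diff_divide_distrib algebra_simps)
    finally show ?thesis .
  qed
  have "((\<lambda>R. K * (?N diam R - ?N (- diam) R)) \<longlongrightarrow> K * (density - density)) at_top"
    by (intro tendsto_intros pts_asymptotics)
  then have lim0: "((\<lambda>R. K * (?N diam R - ?N (- diam) R)) \<longlongrightarrow> 0) at_top" by simp
  have "\<forall>\<^sub>F R in at_top. norm (S - of_real (A * ?N (- diam) R)) \<le> K * (?N diam R - ?N (- diam) R)"
    using eventually_ge_at_top[of 1] by eventually_elim (rule est)
  then have "((\<lambda>R. S - of_real (A * ?N (- diam) R)) \<longlongrightarrow> 0) at_top"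
    by (rule Lim_null_comparison[OF _ lim0])
  moreover have "((\<lambda>R. S - of_real (A * ?N (- diam) R)) \<longlongrightarrow> S - of_real (A * density)) at_top"
    by (intro tendsto_intros pts_asymptotics)
  ultimately have "S - of_real (A * density) = 0"
    using tendsto_unique trivial_limit_at_top_linorder by blast
  \<comment> \<open>The density contains the inverse of the absolute value of
    \<open>frame_det\<close> and \<open>A\<close> contains \<open>frame_det\<close> itself; all
    other constants cancel up to sign.\<close>
  moreover have "A * density = (-1) ^ (?n - 1) * sgn frame_det"
  proof -
    have "fact ?n = real ?n * fact (?n - 1)" by (simp add: fact_reduce)
    then have "A * density = (-1) ^ (?n - 1) * (frame_det / \<bar>frame_det\<bar>)"
      using frame_det_nonzero by (simp add: A_def density_def)
    then show ?thesis by (simp add: sgn_if)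
  qed
  ultimately show ?thesis by simp
qed

end

section \<open>Comparison with the labelling\<close>

lemma norm_Tr_le: "norm (Tr (x * q)) \<le> norm x * (\<Sum>j\<in>UNIV. norm (q $ j))"
proof -
  have "norm (Tr (x * q)) \<le> (\<Sum>j\<in>UNIV. norm (x $ j * q $ j))"
    unfolding Tr_def by (simp add: norm_sum)
  also have "\<dots> \<le> (\<Sum>j\<in>UNIV. norm x * norm (q $ j))"
    by (rule sum_mono) (simp add: norm_mult mult_right_mono Finite_Cartesian_Product.norm_nth_le)
  finally show ?thesis by (simp add: sum_distrib_left)
qed

lemma norm_le_sum: "norm (x :: complex ^ 'n) \<le> (\<Sum>j\<in>UNIV. norm (x $ j))"
  unfolding norm_vec_def by (rule L2_set_le_sum) simp

text \<open>The determinant is zero unless \<open>m\<close> is a permutation, and then the product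
  of the traces is \<open>Nm z\<close>.\<close>

lemma g_rows_label: "g_rows z (\<lambda>i. axis (m i) 1) = g_rows 1 (\<lambda>i. axis (m i) 1) / Nm z"
proof (cases "inj m")
  case True
  then have "bij m" by (simp add: finite_UNIV_inj_surj bij_def)
  then have "(\<Prod>i\<in>UNIV. z $ m i) = Nm z"
    unfolding Nm_def by (rule prod.reindex_bij_betw)
  then show ?thesis unfolding g_rows_def Tr_axis by simp
next
  case False
  then obtain i j where "i \<noteq> j" "m i = m j" by (auto simp: inj_def)
  then have "rows_det (\<lambda>i. axis (m i) 1) = 0" by (intro rows_det_same[of i j]) auto
  then show ?thesis by (simp add: g_rows_def)
qed

context log_lattice
begin

lemma norm_pos_in: "x \<in> V \<Longrightarrow> 0 < norm x"
  using nz[of x i0] by auto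

text \<open>Multiplication by \<open>vert w i\<close> changes absolute values of coordinates by
  factors between \<open>exp (- diam)\<close> and \<open>exp diam\<close>, so a maximal coordinate
  of the product is maximal for \<open>x\<close> up to \<open>exp (2 * diam)\<close>.\<close>

lemma max_index_large:
  assumes x: "x \<in> V"
  shows "1 / norm (x $ max_index (x * vert w i)) \<le> real CARD('n) * exp (2 * diam) / norm x"
proof -
  let ?u = "vert w i" let ?a = "max_index (x * vert w i)"
  have u: "exp (- diam) \<le> norm (?u $ j)" "norm (?u $ j) \<le> exp diam" for j
  proof -
    have "norm (?u $ j) = exp (log_abs ?u $ j)" using nz[OF vert_in] by (simp add: log_abs_def)
    then show "exp (- diam) \<le> norm (?u $ j)" "norm (?u $ j) \<le> exp diam"
      using log_abs_vert_bound[of w i j] by auto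
  qed
  have "norm (x $ j) \<le> exp (2 * diam) * norm (x $ ?a)" for j
  proof -
    have "norm (x $ j) * exp (- diam) \<le> norm (x $ j) * norm (?u $ j)" by (intro mult_left_mono u) simp
    also have "\<dots> \<le> norm (x $ ?a) * norm (?u $ ?a)"
      using max_index[of "x * ?u" j] by (simp add: norm_mult)
    also have "\<dots> \<le> norm (x $ ?a) * exp diam" by (intro mult_left_mono u) simp
    finally have "norm (x $ j) * exp (- diam) * exp diam \<le> norm (x $ ?a) * exp diam * exp diam"
      by (rule mult_right_mono) simp
    moreover have "norm (x $ j) * exp (- diam) * exp diam = norm (x $ j)"
      by (simp add: mult.assoc flip: exp_add)
    moreover have "norm (x $ ?a) * exp diam * exp diam = exp (2 * diam) * norm (x $ ?a)"
      by (simp add: mult.assoc flip: exp_add)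
    ultimately show ?thesis by simp
  qed
  then have "norm x \<le> real CARD('n) * (exp (2 * diam) * norm (x $ ?a))"
    using norm_le_sum[of x] sum_bounded_above[of UNIV "\<lambda>j. norm (x $ j)"] by (smt (verit))
  moreover have "norm (x $ ?a) > 0" using nz[OF x] by simp
  ultimately show ?thesis using norm_pos_in[OF x]
    by (simp add: divide_le_eq le_divide_eq mult_ac)
qed

text \<open>A determinant with some rows replaced by labels is at most a constant times the term of
  the flag itself: each label row gains \<open>1 / norm x\<close>, the best possible size of the lost factor.\<close>

lemma mixed_bound:
  fixes z :: "complex ^ 'n" and p :: "'n \<Rightarrow> complex ^ 'n" and a :: "complex ^ 'n \<Rightarrow> 'n \<Rightarrow> 'n"
  assumes z: "\<And>i. z $ i \<noteq> 0" and reg: "\<And>x i. x \<in> V \<Longrightarrow> Tr (x * p i * z) \<noteq> 0"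
    and a: "\<And>x i. i \<in> I \<Longrightarrow> \<exists>m. a x i = max_index (x * vert w m)"
  obtains K where "\<And>x. x \<in> V \<Longrightarrow>
    norm (g_rows z (\<lambda>i. if i \<in> I then axis (a x i) 1 else x * vert w i * p i))
      \<le> K * (\<Prod>i\<in>UNIV. 1 / norm (Tr (x * vert w i * p i * z)))"
proof -
  define E where "E = real CARD('n) * exp (2 * diam)"
  define Q where "Q = (\<Sum>i\<in>UNIV. \<Sum>j\<in>UNIV. norm ((vert w i * p i * z) $ j))"
  define Z where "Z = (\<Sum>i\<in>UNIV. 1 / norm (z $ i))"
  define B where "B = 1 + (\<Sum>i\<in>UNIV. norm (vert w i * p i))"
  have nn: "0 \<le> E" "0 \<le> Q" "0 \<le> Z" "0 \<le> B"
    unfolding E_def Q_def Z_def B_def by (auto intro!: sum_nonneg add_nonneg_nonneg)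
  show ?thesis
  proof (rule that)
    fix x assume x: "x \<in> V"
    let ?y = "\<lambda>i. if i \<in> I then axis (a x i) 1 else x * vert w i * p i"
    let ?y' = "\<lambda>i. if i \<in> I then axis (a x i) 1 else vert w i * p i"
    let ?c = "\<lambda>i. if i \<in> I then 1 / (x $ a x i) else 1"
    let ?t = "\<lambda>i. norm (Tr (x * vert w i * p i * z))"
    have t: "?t i > 0" for i using reg[OF mult_in[OF x vert_in]] by simp
    \<comment> \<open>The factor \<open>x\<close> is taken out of every row, at the price
      \<open>1 / x $ a x i\<close> for a label row. Then \<open>Nm x\<close> has absolute value 1,
      and the remaining determinant is bounded independently of \<open>x\<close>.\<close>
    have "?y i = ?c i *s (x * ?y' i)" for i
      using nz[OF x] by (auto simp: vec_eq_iff axis_def mult.assoc)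
    then have "rows_det ?y = rows_det (\<lambda>i. ?c i *s (x * ?y' i))" by presburger
    also have "\<dots> = (\<Prod>i\<in>UNIV. ?c i) * (Nm x * rows_det ?y')"
      by (simp only: rows_det_scale rows_det_mult)
    finally have d: "norm (rows_det ?y) = (\<Prod>i\<in>UNIV. norm (?c i)) * norm (rows_det ?y')"
      by (simp add: norm_mult norm_Nm[OF x] flip: prod_norm)
    have "norm (rows_det ?y') \<le> fact CARD('n) * (\<Prod>i\<in>(UNIV :: 'n set). B)"
    proof (rule norm_det_le)
      fix i j
      have "norm (vert w i * p i) \<le> (\<Sum>i\<in>UNIV. norm (vert w i * p i))"
        by (rule member_le_sum) auto
      then have "norm ((vert w i * p i) $ j) \<le> B"
        using Finite_Cartesian_Product.norm_nth_le[of "vert w i * p i" j] unfolding B_def by linarith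
      moreover have "1 \<le> B" unfolding B_def by (simp add: sum_nonneg)
      ultimately show "norm (?y' i $ j) \<le> B" using nn by (auto simp: axis_def)
    qed
    then have d': "norm (rows_det ?y') \<le> fact CARD('n) * B ^ CARD('n)" by simp
    \<comment> \<open>For a label row, \<open>1 / norm x\<close> is at most \<open>Q / ?t i\<close>
      because a trace is at most a constant times \<open>norm x\<close>. The summand 1 in the
      constant serves the unchanged rows.\<close>
    have fac: "norm (?c i) / norm (Tr (?y i * z)) \<le> (1 + E * Q * Z) * (1 / ?t i)" for i
    proof (cases "i \<in> I")
      case False
      then show ?thesis using t[of i] nn by (simp add: field_simps)
    next
      case True
      obtain m where m: "a x i = max_index (x * vert w m)" using a[OF True] by blast
      have 1: "1 / norm (x $ a x i) \<le> E / norm x"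
        unfolding m E_def by (rule max_index_large[OF x])
      have 2: "1 / norm (z $ a x i) \<le> Z"
        unfolding Z_def by (rule member_le_sum) auto
      have "?t i \<le> norm x * Q"
      proof -
        have "?t i \<le> norm x * (\<Sum>j\<in>UNIV. norm ((vert w i * p i * z) $ j))"
          using norm_Tr_le[of x "vert w i * p i * z"] by (simp add: mult.assoc)
        also have "\<dots> \<le> norm x * Q" unfolding Q_def
          by (intro mult_left_mono member_le_sum) (auto intro: sum_nonneg)
        finally show ?thesis .
      qed
      then have 3: "1 / norm x \<le> Q * (1 / ?t i)"
        using t[of i] norm_pos_in[OF x] by (simp add: field_simps)
      have "norm (?c i) / norm (Tr (?y i * z)) = (1 / norm (x $ a x i)) * (1 / norm (z $ a x i))"
        using True by (simp add: Tr_axis norm_divide)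
      also have "\<dots> \<le> (E * (1 / norm x)) * Z" using 1 2 nn by (intro mult_mono) auto
      also have "\<dots> \<le> (E * (Q * (1 / ?t i))) * Z" using 3 nn by (intro mult_right_mono mult_left_mono) auto
      also have "\<dots> \<le> (1 + E * Q * Z) * (1 / ?t i)" using t[of i] by (simp add: field_simps)
      finally show ?thesis .
    qed
    have "norm (g_rows z ?y) = norm (rows_det ?y') * (\<Prod>i\<in>UNIV. norm (?c i) / norm (Tr (?y i * z)))"
      unfolding g_rows_def norm_divide d by (simp add: prod_dividef flip: prod_norm)
    also have "\<dots> \<le> (fact CARD('n) * B ^ CARD('n)) * (\<Prod>i\<in>UNIV. (1 + E * Q * Z) * (1 / ?t i))"
      using d' fac nn by (intro mult_mono prod_mono conjI) (auto intro!: prod_nonneg)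
    also have "\<dots> = (fact CARD('n) * B ^ CARD('n) * (1 + E * Q * Z) ^ CARD('n)) * (\<Prod>i\<in>UNIV. 1 / ?t i)"
      by (simp only: prod.distrib prod_constant mult.assoc)
    finally show "norm (g_rows z ?y) \<le> (fact CARD('n) * B ^ CARD('n) * (1 + E * Q * Z) ^ CARD('n)) * (\<Prod>i\<in>UNIV. 1 / ?t i)" .
  qed
qed

text \<open>\<open>mixed_bound\<close> supplies the summability demanded by
  \<open>replace_all\<close>, which leads to a sum of labels; by \<open>g_rows_label\<close> its
  dependence on \<open>z\<close> is the factor \<open>1 / Nm z\<close>, and \<open>label_sum\<close>
  gives the rest.\<close>

lemma flag_sum:
  assumes z: "\<And>i. z $ i \<noteq> 0" and reg: "\<And>x i. x \<in> V \<Longrightarrow> Tr (x * p i * z) \<noteq> 0"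
    and summ: "\<And>w. w \<in> flags \<Longrightarrow>
      (\<lambda>x. \<Prod>i\<in>UNIV. 1 / norm (Tr (x * vert w i * p i * z))) summable_on V"
  shows "(chain_sum z (\<lambda>i x. x * p i) has_sum (of_real ((-1) ^ (CARD('n) - 1) * sgn frame_det) / Nm z)) V"
proof -
  have summable: "(\<lambda>x. g_rows z (\<lambda>i. if i \<in> I then axis (a x i) 1 else x * vert w i * p i)) summable_on V"
    if w: "w \<in> flags" and a: "\<And>x i. i \<in> I \<Longrightarrow> \<exists>m. a x i = max_index (x * vert w m)" for w I a
  proof -
    obtain K where K: "\<And>x. x \<in> V \<Longrightarrow>
      norm (g_rows z (\<lambda>i. if i \<in> I then axis (a x i) 1 else x * vert w i * p i))
      \<le> K * (\<Prod>i\<in>UNIV. 1 / norm (Tr (x * vert w i * p i * z)))"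
      by (rule mixed_bound[where z = z and p = p and I = I and a = a and w = w]) (use z reg a in auto)
    have "(\<lambda>x. K * (\<Prod>i\<in>UNIV. 1 / norm (Tr (x * vert w i * p i * z)))) summable_on V"
      by (intro summable_on_cmult_right summ w)
    then have "(\<lambda>x. norm (g_rows z (\<lambda>i. if i \<in> I then axis (a x i) 1 else x * vert w i * p i))) summable_on V"
      by (rule summable_on_comparison_test) (use K in auto)
    then show ?thesis by (rule abs_summable_summable)
  qed
  have "(\<lambda>x. g_rows z (\<lambda>i. x * vert w i * p i)) summable_on V" if "w \<in> flags" for w
    using summable[of w "{}"] that by simp
  then have Gs: "((\<lambda>x. g_rows z (\<lambda>i. x * vert w i * p i)) has_sum infsum (\<lambda>x. g_rows z (\<lambda>i. x * vert w i * p i)) V) V"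
    if "w \<in> flags" for w using that by (intro has_sum_infsum)
  define S where "S = (\<Sum>w\<in>flags. of_int (fsign w) * infsum (\<lambda>x. g_rows z (\<lambda>i. x * vert w i * p i)) V)"
  have S: "(chain_sum z (\<lambda>i x. x * p i) has_sum S) V"
    unfolding S_def by (intro has_sum_sum finite_flags has_sum_cmult_right Gs)
  have "(chain_sum z (\<lambda>i. label) has_sum S) V"
  proof (rule replace_all[OF _ _ _ S])
    show "Tr (x * p i * z) \<noteq> 0" if "x \<in> V" for x i using reg[OF that] .
    show "Tr (label x * z) \<noteq> 0" for x unfolding label_def Tr_axis by (rule z)
    fix k w assume k: "k \<noteq> i0" and w: "w \<in> flags"
    \<comment> \<open>In the intermediate terms the row of type \<open>i0\<close> carries the label
      of the vertex of type \<open>k\<close>.\<close>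
    let ?a = "\<lambda>x i. max_index (x * vert w (if i = i0 then k else i))"
    have eq: "(\<lambda>i. if i = i0 then label (x * vert w k) else if r i < r k then label (x * vert w i)
        else x * vert w i * p i)
      = (\<lambda>i. if i \<in> {i. i = i0 \<or> r i < r k} then axis (?a x i) 1 else x * vert w i * p i)" for x
      by (auto simp: label_def fun_eq_iff)
    have "(\<lambda>x. g_rows z (\<lambda>i. if i \<in> {i. i = i0 \<or> r i < r k} then axis (?a x i) 1 else x * vert w i * p i))
      summable_on V"
      by (rule summable[OF w]) auto
    then show "(\<lambda>x. g_rows z (\<lambda>i. if i = i0 then label (x * vert w k)
         else if r i < r k then label (x * vert w i) else x * vert w i * p i)) summable_on V"
      unfolding eq .
  qed
  moreover have "chain_sum z (\<lambda>i. label) x = (1 / Nm z) * chain_sum 1 (\<lambda>i. label) x" for x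
    unfolding sum_distrib_left label_def by (rule sum.cong) (simp_all add: g_rows_label[of z])
  ultimately have *: "((\<lambda>x. (1 / Nm z) * chain_sum 1 (\<lambda>i. label) x) has_sum S) V" by simp
  have N: "Nm z \<noteq> 0" using z by (simp add: Nm_def)
  have "((\<lambda>x. Nm z * ((1 / Nm z) * chain_sum 1 (\<lambda>i. label) x)) has_sum (Nm z * S)) V"
    by (rule has_sum_cmult_right[OF *])
  then have "(chain_sum 1 (\<lambda>i. label) has_sum (Nm z * S)) V" using N by simp
  from label_sum[OF this] have "S = of_real ((-1) ^ (CARD('n) - 1) * sgn frame_det) / Nm z"
    using N by (simp add: field_simps)
  then show ?thesis using S by simp
qed

end

section \<open>Choice of the data\<close>

lemma ctorus_inverse:
  assumes "subgroup V ctorus" "x \<in> V"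
  shows "\<exists>y\<in>V. x * y = 1"
proof -
  interpret group "ctorus :: (complex ^ 'a) monoid" by (rule group_ctorus)
  have "inv\<^bsub>ctorus\<^esub> x \<in> V" using assms by (rule subgroup.m_inv_closed)
  moreover have "x \<otimes>\<^bsub>ctorus\<^esub> inv\<^bsub>ctorus\<^esub> x = \<one>\<^bsub>ctorus\<^esub>"
    by (rule r_inv[OF subgroup.mem_carrier[OF assms]])
  ultimately show ?thesis by (auto simp: ctorus_def)
qed

lemma trace_zero_hyperplane_eq: "trace_zero_hyperplane = {x :: real ^ 'n. 1 \<bullet> x = 0}"
  by (simp add: trace_zero_hyperplane_def inner_vec_def)

text \<open>A lattice basis has \<open>CARD('n) - 1\<close> elements, the dimension of the
  hyperplane, so it can be indexed by all indices except \<open>i0\<close>; lifts of its elements to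
  \<open>V\<close> are the generators.\<close>

lemma ctorus_lattice_log_lattice:
  fixes V :: "(complex ^ 'n) set"
  assumes "ctorus_lattice V"
  shows "\<exists>r i0 v. log_lattice V r i0 v"
proof -
  have sub: "subgroup V ctorus" and inj: "inj_on log_abs V"
    using assms by (auto simp: ctorus_lattice_def)
  obtain b where b: "independent b" "span b = (trace_zero_hyperplane :: (real ^ 'n) set)"
    and L: "log_abs ` V = {(\<Sum>x\<in>b. of_int (c x) *\<^sub>R x) | c :: real ^ 'n \<Rightarrow> int. True}"
    using assms by (auto simp: ctorus_lattice_def lattice_in_def)
  have Lc: "\<exists>c :: real ^ 'n \<Rightarrow> int. log_abs x = (\<Sum>y\<in>b. of_int (c y) *\<^sub>R y)" if "x \<in> V" for x
  proof -
    have "log_abs x \<in> log_abs ` V" using that by (rule imageI)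
    then show ?thesis unfolding L by simp
  qed
  have Lm: "(\<Sum>y\<in>b. of_int (c y) *\<^sub>R y) \<in> log_abs ` V" for c :: "real ^ 'n \<Rightarrow> int"
    unfolding L by (rule CollectI) (rule exI[of _ c], simp)
  have finb: "finite b" using b(1) by (rule finiteI_independent)
  have "card b = CARD('n) - 1"
  proof -
    have "card b = dim (trace_zero_hyperplane :: (real ^ 'n) set)"
      using dim_span_eq_card_independent[OF b(1)] b(2) by simp
    then show ?thesis unfolding trace_zero_hyperplane_eq
      by (subst (asm) dim_hyperplane) (auto simp: vec_eq_iff)
  qed
  obtain r :: "'n \<Rightarrow> nat" where r: "bij_betw r UNIV {..<CARD('n)}"
    using ex_bij_betw_finite_nat[of "UNIV :: 'n set"] by (auto simp: atLeast0LessThan)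
  obtain i0 where i0: "r i0 = 0"
    using r by (metis bij_betw_imp_surj_on imageE lessThan_iff zero_less_card_finite)
  have "card (UNIV - {i0}) = card b" using \<open>card b = _\<close> by (simp add: card_Diff_singleton)
  then obtain \<beta> where \<beta>: "bij_betw \<beta> (UNIV - {i0}) b"
    using finite_same_card_bij[of "UNIV - {i0}" b] finb by auto
  have mem: "y \<in> log_abs ` V" if "y \<in> b" for y
  proof -
    have "y = (\<Sum>x\<in>b. of_int (if x = y then 1 else 0) *\<^sub>R x)"
      using that finb by (simp add: if_distrib[of "\<lambda>t. t *\<^sub>R _"] if_distrib[of of_int] cong: if_cong)
    then show ?thesis using Lm[of "\<lambda>x. if x = y then 1 else 0"] by simp
  qed
  have one: "1 \<in> V" using subgroup.one_closed[OF sub] by (simp add: ctorus_def)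
  have "\<forall>k. \<exists>x\<in>V. k \<noteq> i0 \<longrightarrow> log_abs x = \<beta> k"
  proof
    fix k
    show "\<exists>x\<in>V. k \<noteq> i0 \<longrightarrow> log_abs x = \<beta> k"
    proof (cases "k = i0")
      case False
      then have "\<beta> k \<in> log_abs ` V" using \<beta> mem by (auto simp: bij_betw_def)
      then show ?thesis by (metis imageE)
    qed (use one in auto)
  qed
  then obtain v' where v': "\<And>k. v' k \<in> V" "\<And>k. k \<noteq> i0 \<Longrightarrow> log_abs (v' k) = \<beta> k" by metis
  define v where "v k = (if k = i0 then 1 else v' k)" for k
  have log1: "log_abs (1 :: complex ^ 'n) = 0" by (simp add: log_abs_def vec_eq_iff)
  have lv: "log_abs (v k) = (if k = i0 then 0 else \<beta> k)" for k
    by (simp add: v_def v' log1)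
  have comb: "(\<Sum>k\<in>UNIV. c k *\<^sub>R log_abs (v k)) = (\<Sum>k\<in>UNIV - {i0}. c k *\<^sub>R \<beta> k)" for c :: "'n \<Rightarrow> real"
    by (subst sum.remove[of _ i0]) (auto simp: lv intro!: sum.cong)
  have re: "(\<Sum>k\<in>UNIV - {i0}. c (\<beta> k) *\<^sub>R \<beta> k) = (\<Sum>x\<in>b. c x *\<^sub>R x)" for c :: "real ^ 'n \<Rightarrow> real"
    by (rule sum.reindex_bij_betw[OF \<beta>])
  define \<gamma> where "\<gamma> = the_inv_into (UNIV - {i0}) \<beta>"
  have \<gamma>: "\<gamma> (\<beta> k) = k" if "k \<noteq> i0" for k
    unfolding \<gamma>_def using \<beta> that by (auto simp: bij_betw_def the_inv_into_f_f)
  have comb': "(\<Sum>k\<in>UNIV. c k *\<^sub>R log_abs (v k)) = (\<Sum>x\<in>b. c (\<gamma> x) *\<^sub>R x)" for c :: "'n \<Rightarrow> real"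
    unfolding comb re[of "\<lambda>x. c (\<gamma> x)", symmetric] by (rule sum.cong) (auto simp: \<gamma>)
  have "log_lattice V r i0 v"
  proof
    show "1 \<in> V" by (rule one)
    show "x * y \<in> V" if "x \<in> V" "y \<in> V" for x y
      using subgroup.m_closed[OF sub that] by (simp add: ctorus_def)
    show "\<exists>y\<in>V. x * y = 1" if "x \<in> V" for x using that by (rule ctorus_inverse[OF sub])
    show "v k \<in> V" for k using one v' by (simp add: v_def)
    show "x $ i \<noteq> 0" if "x \<in> V" for x i
      using subgroup.mem_carrier[OF sub that] by (simp add: ctorus_def)
    show "v i0 = 1" by (simp add: v_def)
    show "(\<Sum>i\<in>UNIV. log_abs x $ i) = 0" if xV: "x \<in> V" for x
    proof -
      obtain c :: "real ^ 'n \<Rightarrow> int" where "log_abs x = (\<Sum>x\<in>b. of_int (c x) *\<^sub>R x)"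
        using Lc[OF xV] by blast
      moreover have "(\<Sum>x\<in>b. of_int (c x) *\<^sub>R x) \<in> span b"
        by (intro span_sum span_scale span_base)
      ultimately have "log_abs x \<in> span b" by simp
      then show ?thesis using b by (simp add: trace_zero_hyperplane_def)
    qed
    show "\<exists>c :: 'n \<Rightarrow> int. log_abs x = (\<Sum>k\<in>UNIV. of_int (c k) *\<^sub>R log_abs (v k))" if xV: "x \<in> V" for x
    proof -
      obtain c :: "real ^ 'n \<Rightarrow> int" where "log_abs x = (\<Sum>x\<in>b. of_int (c x) *\<^sub>R x)"
        using Lc[OF xV] by blast
      then have "log_abs x = (\<Sum>k\<in>UNIV. of_int (c (\<beta> k)) *\<^sub>R log_abs (v k))"
        unfolding comb re[of "\<lambda>x. of_int (c x)"] .
      then show ?thesis by (rule exI[of _ "\<lambda>k. c (\<beta> k)"])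
    qed
    show "\<exists>x\<in>V. log_abs x = (\<Sum>k\<in>UNIV. of_int (c k) *\<^sub>R log_abs (v k))" for c :: "'n \<Rightarrow> int"
    proof -
      have "(\<Sum>x\<in>b. of_int (c (\<gamma> x)) *\<^sub>R x) \<in> log_abs ` V" by (rule Lm)
      then show ?thesis unfolding comb'[of "\<lambda>k. of_int (c k)"] by auto
    qed
    show "c k = 0" if c: "(\<Sum>k\<in>UNIV. c k *\<^sub>R log_abs (v k)) = 0" and k: "k \<noteq> i0" for c k
    proof -
      have "\<beta> k \<in> b" using \<beta> k by (auto simp: bij_betw_def)
      moreover have "(\<Sum>x\<in>b. c (\<gamma> x) *\<^sub>R x) = 0" using c unfolding comb' .
      ultimately have "c (\<gamma> (\<beta> k)) = 0"
        using independentD[OF b(1) finb, of "\<lambda>x. c (\<gamma> x)"] by auto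
      then show ?thesis using \<gamma>[OF k] by simp
    qed
  qed (use r i0 inj in auto)
  then show ?thesis by blast
qed

section \<open>Traces against vectors in general position\<close>

lemma rows_det_independent:
  assumes "rows_det y \<noteq> 0"
  shows "inj y" "vec.independent (range y)"
proof -
  show "inj y" using rows_det_same assms by (metis injI)
  have "rows (\<chi> i. y i) = range y" by (auto simp: rows_def row_def)
  then show "vec.independent (range y)" using det_dependent_rows[of "\<chi> i. y i"] assms by metis
qed

text \<open>An invertible matrix is bounded below, so its rows cannot all be small on
  \<open>q\<close>. In this form general position limits the number of small denominators.\<close>

lemma rows_det_lower_bound:
  fixes y :: "'n \<Rightarrow> complex ^ 'n"
  assumes "rows_det y \<noteq> 0"
  shows "\<exists>\<eta>>0. \<forall>q. \<exists>k. \<eta> * norm q \<le> norm (Tr (y k * q))"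
proof -
  let ?f = "\<lambda>q. (\<chi> k. Tr (y k * q)) :: complex ^ 'n"
  have f: "?f q = (\<chi> i. y i) *v q" for q
    by (simp add: vec_eq_iff Tr_def matrix_vector_mult_def)
  have lin: "linear ?f"
    by (rule linearI) (simp_all add: vec_eq_iff Tr_def sum.distrib distrib_left scaleR_sum_right)
  have "inj ?f"
    unfolding f using assms by (simp add: inj_matrix_vector_mult invertible_det_nz)
  then obtain B where B: "B > 0" "\<And>q. B * norm q \<le> norm (?f q)"
    using linear_inj_bounded_below_pos[OF lin] by blast
  have "\<exists>k. B / CARD('n) * norm q \<le> norm (Tr (y k * q))" for q
  proof (rule ccontr)
    assume "\<not> ?thesis"
    then have lt: "norm (Tr (y k * q)) < B / CARD('n) * norm q" for k by (simp add: not_le)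
    have "norm (?f q) \<le> (\<Sum>k\<in>UNIV. norm (Tr (y k * q)))" using norm_le_sum[of "?f q"] by simp
    also have "\<dots> < (\<Sum>k\<in>(UNIV :: 'n set). B / CARD('n) * norm q)"
      by (rule sum_strict_mono) (use lt in auto)
    also have "\<dots> = B * norm q" by simp
    finally show False using B(2)[of q] by simp
  qed
  then show ?thesis using B(1) by (intro exI[of _ "B / CARD('n)"]) auto
qed

lemma uniform_lower_bound:
  fixes M :: "('n \<Rightarrow> complex ^ 'n) set"
  assumes "finite M" "\<And>y. y \<in> M \<Longrightarrow> rows_det y \<noteq> 0"
  shows "\<exists>\<eta>>0. \<forall>y\<in>M. \<forall>q. \<exists>k. \<eta> * norm q \<le> norm (Tr (y k * q))"
  using assms
proof (induction M rule: finite_induct)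
  case empty
  then show ?case by (intro exI[of _ 1]) auto
next
  case (insert y M)
  obtain a where a: "a > 0" "\<forall>y\<in>M. \<forall>q. \<exists>k. a * norm q \<le> norm (Tr (y k * q))" using insert.IH insert.prems by blast
  obtain b where b: "b > 0" "\<forall>q. \<exists>k. b * norm q \<le> norm (Tr (y k * q))"
    using rows_det_lower_bound[OF insert.prems[OF insertI1]] by blast
  have m: "min a b * norm q \<le> a * norm q" "min a b * norm q \<le> b * norm q" for q :: "complex ^ 'n"
    by (auto intro: mult_right_mono)
  have "\<exists>k. min a b * norm q \<le> norm (Tr (x k * q))" if "x \<in> insert y M" for x q
  proof (cases "x = y")
    case True
    then show ?thesis using b(2) m(2)[of q] by (meson order_trans)
  next
    case False
    then have "\<exists>k. a * norm q \<le> norm (Tr (x k * q))" using a(2) that by simp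
    then show ?thesis using m(1)[of q] by (meson order_trans)
  qed
  then show ?case using a(1) b(1) by (intro exI[of _ "min a b"]) simp
qed

text \<open>Two powers of 3 with exponents at most \<open>m\<close> have a sum below
  \<open>3 ^ (m + 1)\<close>, so the larger exponents on the two sides agree and can be cancelled:
  the powers of 3 form a Sidon set.\<close>

lemma power3_sum_eq:
  fixes a b c d :: nat
  assumes "(3::int) ^ a + 3 ^ d = 3 ^ c + 3 ^ b"
  shows "(a = c \<and> d = b) \<or> (a = b \<and> d = c)"
proof -
  have lt: False if "max a d < max b c" "(3::int) ^ a + 3 ^ d = 3 ^ c + 3 ^ b" for a b c d :: nat
  proof -
    have "(3::int) ^ a \<le> 3 ^ max a d" "(3::int) ^ d \<le> 3 ^ max a d" by (auto intro: power_increasing)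
    moreover have "(0::int) < 3 ^ max a d" by simp
    ultimately have "(3::int) ^ a + 3 ^ d < 3 ^ Suc (max a d)" unfolding power_Suc by linarith
    also have "\<dots> \<le> 3 ^ max b c" using that(1) by (intro power_increasing) auto
    also have "\<dots> \<le> 3 ^ c + 3 ^ b" by (simp add: max_def)
    finally show False using that(2) by simp
  qed
  have "max a d = max b c" using lt[of a d b c] lt[of c b d a] assms by (metis add.commute linorder_neqE_nat max.commute)
  then consider "a = b" | "a = c" | "d = b" | "d = c" by (metis max_def)
  then show ?thesis using assms by cases auto
qed

lemma gpow_add: "(\<And>i. g $ i \<noteq> 0) \<Longrightarrow> gpow g (a + b) = gpow g a * gpow g b"
  by (simp add: gpow_def vec_eq_iff power_int_add)

context log_lattice
begin

lemma gpow_in: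
  assumes g: "g \<in> V"
  shows "gpow g m \<in> V"
proof -
  have nat: "gpow g (int k) \<in> V" for k
  proof (induction k)
    case 0
    then show ?case using one_in by (simp add: gpow_def vec_eq_iff one_vec_def)
  next
    case (Suc k)
    have "gpow g (int (Suc k)) = g * gpow g (int k)" 
      by (simp add: gpow_def vec_eq_iff del: of_nat_Suc)
    then show ?case using Suc g mult_in by simp
  qed
  have "\<exists>k. m = int k \<or> m = - int k" by (metis int_cases2)
  then obtain k where k: "m = int k \<or> m = - int k" by blast
  then show ?thesis
  proof
    assume m: "m = - int k"
    obtain y where y: "y \<in> V" "gpow g (int k) * y = 1" using inverse_in[OF nat] by blast
    have "y = gpow g m"
    proof -
      have "gpow g m * gpow g (int k) = 1"
        using gpow_add[of g m "int k"] nz[OF g] m by (simp add: gpow_def vec_eq_iff one_vec_def)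
      then have "gpow g m * (gpow g (int k) * y) = y" by (simp add: mult.assoc[symmetric])
      then show ?thesis using y by simp
    qed
    then show ?thesis using y by simp
  qed (use nat in simp)
qed

text \<open>For \<open>i \<noteq> j\<close> some generator has different logarithms at the two
  indices, since otherwise \<open>frame_map\<close> would not be surjective. With coefficients
  \<open>(r k + 2) ^ t\<close> one base dominates each difference of logarithms, so a single large
  \<open>t\<close> works for all pairs.\<close>

lemma separating_element:
  obtains g where "g \<in> V" "inj (\<lambda>i. norm (g $ i))"
proof -
  have ev: "\<forall>\<^sub>F t in sequentially. (\<Sum>k\<in>UNIV. (real (r k) + 2) ^ t * (l k $ i - l k $ j)) \<noteq> 0" if ij: "i \<noteq> j" for i j
  proof -
    let ?S = "{k. l k $ i \<noteq> l k $ j}"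
    have "?S \<noteq> {}"
    proof
      assume "?S = {}"
      then have "frame_map c $ i = frame_map c $ j" for c by (simp add: frame_map_eq)
      moreover obtain c where "axis i 1 = frame_map c" using surj_frame_map by (metis surjD)
      ultimately have "axis i (1::real) $ i = axis i 1 $ j" by metis
      then show False using ij by (simp add: axis_def)
    qed
    then have "Max (r ` ?S) \<in> r ` ?S" by (intro Max_in) auto
    then obtain p where p: "p \<in> ?S" "r p = Max (r ` ?S)" by auto
    have "\<forall>\<^sub>F t in sequentially.
        (\<Sum>k\<in>?S. complex_of_real (l k $ i - l k $ j) * of_real (real (r k) + 2) ^ t) \<noteq> 0"
    proof (rule eventually_dominant_sum_nonzero[where p = p])
      fix q assume q: "q \<in> ?S" "q \<noteq> p"
      then have "r q \<le> r p" unfolding p(2) by (intro Max_ge) auto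
      then have "r q < r p" using q r_eq_iff[of q p] by simp
      then show "norm (complex_of_real (real (r q) + 2)) < norm (complex_of_real (real (r p) + 2))"
        by (simp only: norm_of_real)
    next
      show "complex_of_real (real (r p) + 2) \<noteq> 0" by (simp only: of_real_eq_0_iff)
    qed (use p in auto)
    moreover have "(\<Sum>k\<in>?S. complex_of_real (l k $ i - l k $ j) * of_real (real (r k) + 2) ^ t)
       = of_real (\<Sum>k\<in>UNIV. (real (r k) + 2) ^ t * (l k $ i - l k $ j))" for t
    proof -
      have "(\<Sum>k\<in>?S. (real (r k) + 2) ^ t * (l k $ i - l k $ j)) = (\<Sum>k\<in>UNIV. (real (r k) + 2) ^ t * (l k $ i - l k $ j))"
        by (rule sum.mono_neutral_left) auto
      from this[symmetric] show ?thesis by (simp only: of_real_sum of_real_mult of_real_power mult.commute)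
    qed
    ultimately show ?thesis by (simp only: of_real_eq_0_iff)
  qed
  then have "\<forall>\<^sub>F t in sequentially. \<forall>ij\<in>{(i, j). i \<noteq> j}.
      (\<Sum>k\<in>UNIV. (real (r k) + 2) ^ t * (l k $ fst ij - l k $ snd ij)) \<noteq> 0"
    by (intro eventually_ball_finite) auto
  from eventually_happens'[OF sequentially_bot this]
  obtain t where t0: "\<forall>ij\<in>{(i, j). i \<noteq> j}.
      (\<Sum>k\<in>UNIV. (real (r k) + 2) ^ t * (l k $ fst ij - l k $ snd ij)) \<noteq> 0" by blast
  have t: "(\<Sum>k\<in>UNIV. (real (r k) + 2) ^ t * (l k $ i - l k $ j)) \<noteq> 0" if "i \<noteq> j" for i j
    using bspec[OF t0, of "(i, j)"] that by simp
  obtain g where g: "g \<in> V" "log_abs g = (\<Sum>k\<in>UNIV. of_int ((int (r k) + 2) ^ t) *\<^sub>R l k)"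
    using coords_ex[of "\<lambda>k. (int (r k) + 2) ^ t"] by blast
  have "inj (\<lambda>i. norm (g $ i))"
  proof (rule injI, rule ccontr)
    fix i j assume eq: "norm (g $ i) = norm (g $ j)" and ij: "i \<noteq> j"
    have "log_abs g $ i - log_abs g $ j = 0" using eq by (simp add: log_abs_def)
    moreover have "log_abs g $ i - log_abs g $ j = (\<Sum>k\<in>UNIV. (real (r k) + 2) ^ t * (l k $ i - l k $ j))"
      unfolding g(2) by (simp add: sum_subtractf[symmetric] right_diff_distrib)
    ultimately show False using t[OF ij] by simp
  qed
  then show ?thesis using that g by blast
qed

text \<open>For \<open>p k = gpow g (t * r k)\<close> the exponents are distinct multiples of
  \<open>t\<close>, so each of finitely many determinants is nonzero for large \<open>t\<close>;
  \<open>r i0 = 0\<close> gives \<open>p i0 = 1\<close>.\<close>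

lemma generic_base_points:
  assumes g: "g \<in> V" "inj (\<lambda>i. norm (g $ i))"
  obtains p where "\<And>i. p i \<in> V" "p i0 = 1"
    "\<And>w E \<alpha>. w \<in> flags \<Longrightarrow> inj_on \<alpha> E \<Longrightarrow>
       rows_det (\<lambda>k. if k \<in> E then axis (\<alpha> k) 1 else vert w k * p k) \<noteq> 0"
proof -
  let ?D = "{(w, E, \<alpha>). w \<in> flags \<and> inj_on (\<alpha> :: 'n \<Rightarrow> 'n) E}"
  have "finite ?D"
    by (rule finite_subset[of _ "flags \<times> UNIV \<times> UNIV"]) (auto simp: finite_flags)
  moreover have "\<forall>\<^sub>F t in sequentially. rows_det (\<lambda>k. if k \<in> E then axis (\<alpha> k) 1
      else vert w k * gpow g (int t * int (r k))) \<noteq> 0" if "inj_on \<alpha> E" for w E \<alpha>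
    by (rule eventually_rows_det_nonzero[OF nz[OF g(1)] g(2) that])
      (auto simp: inj_on_def r_eq_iff nz[OF vert_in])
  ultimately have "\<forall>\<^sub>F t in sequentially. \<forall>(w, E, \<alpha>)\<in>?D. rows_det (\<lambda>k. if k \<in> E then axis (\<alpha> k) 1
      else vert w k * gpow g (int t * int (r k))) \<noteq> 0"
    by (intro eventually_ball_finite) auto
  from eventually_happens'[OF sequentially_bot this]
  obtain t where t: "\<forall>(w, E, \<alpha>)\<in>?D. rows_det (\<lambda>k. if k \<in> E then axis (\<alpha> k) 1
      else vert w k * gpow g (int t * int (r k))) \<noteq> 0" by blast
  show ?thesis
  proof (rule that[of "\<lambda>k. gpow g (int t * int (r k))"])
    show "gpow g (int t * int (r i0)) = 1" by (simp add: r_i0 gpow_def vec_eq_iff)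
  qed (use t in \<open>auto simp: gpow_in g\<close>)
qed

end

section \<open>Lines and formal chains\<close>

definition lines :: "('n \<Rightarrow> complex ^ 'n) \<Rightarrow> 'n \<Rightarrow> (complex ^ 'n) set" where
  "lines q i = vec.span {q i}"

lemma lines_proj_space: "q i \<noteq> 0 \<Longrightarrow> lines q i \<in> proj_space"
  unfolding proj_space_def lines_def
  using vec.dim_span_eq_card_independent[of "{q i}"] by simp

lemma is_lift_lines: "(\<And>i. q i \<noteq> 0) \<Longrightarrow> is_lift (lines q) q"
  by (simp add: is_lift_def lines_def vec.span_base)

lemma act_lines: "act x (lines q) = lines (\<lambda>i. x * q i)"
proof -
  have "x * (k *s q i) = k *s (x * q i)" for k i by (simp add: vec_eq_iff)
  then show ?thesis by (auto simp: act_def lines_def vec.span_singleton fun_eq_iff image_iff)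
qed

text \<open>A subfamily of \<open>CARD('n)\<close> members contains as many basis vectors as it
  omits vectors \<open>q k\<close>. Putting the basis vectors into the omitted rows \<open>E\<close>
  by a bijection turns independence into a determinant as in \<open>gen\<close>; other lifts only
  scale rows.\<close>

lemma lines_in_Ugen:
  fixes q :: "'n \<Rightarrow> complex ^ 'n"
  assumes gen: "\<And>E \<alpha>. inj_on \<alpha> E \<Longrightarrow> rows_det (\<lambda>k. if k \<in> E then axis (\<alpha> k) 1 else q k) \<noteq> 0"
  shows "lines q \<in> Ugen"
proof -
  have nz: "q i \<noteq> 0" for i
  proof
    assume "q i = 0"
    then have "rows_det q = 0" by (intro det_zero_row(1)[of i]) (simp add: row_def vec_eq_iff)
    then show False using gen[of id "{}"] by simp
  qed
  note pr = lines_proj_space[of q, OF nz]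
  have "inj_on (with_canonical f) S \<and> vec.independent (with_canonical f ` S)"
    if f: "is_lift (lines q) f" and S: "card S = CARD('n)" for f S
  proof -
    obtain \<kappa> where \<kappa>: "\<And>i. \<kappa> i \<noteq> 0" "\<And>i. f i = \<kappa> i *s q i"
      using is_lift_scale[OF pr is_lift_lines[of q, OF nz] f] by metis
    define E where "E = {k. Inr k \<notin> S}"
    define I where "I = {i. Inl i \<in> S}"
    have S_eq: "S = Inl ` I \<union> Inr ` (- E)"
    proof (intro equalityI subsetI)
      fix s assume "s \<in> S"
      then show "s \<in> Inl ` I \<union> Inr ` (- E)" by (cases s) (auto simp: E_def I_def)
    qed (auto simp: E_def I_def)
    have "card S = card (Inl ` I :: ('n + 'n) set) + card (Inr ` (- E) :: ('n + 'n) set)"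
      unfolding S_eq by (rule card_Un_disjoint) auto
    also have "\<dots> = card I + card (- E)" by (simp add: card_image)
    finally have "card S = card I + card (- E)" .
    moreover have "card E + card (- E) = CARD('n)"
      using card_Un_disjoint[of E "- E"] by (simp add: Compl_partition)
    ultimately have "card E = card I" using S by simp
    then obtain \<alpha> where \<alpha>: "bij_betw \<alpha> E I" using finite_same_card_bij[of E I] by auto
    define \<phi> :: "'n \<Rightarrow> 'n + 'n" where "\<phi> k = (if k \<in> E then Inl (\<alpha> k) else Inr k)" for k
    have "bij_betw (\<lambda>k. if k \<in> E then Inl (\<alpha> k) else Inr k) (E \<union> - E) (Inl ` I \<union> Inr ` (- E))"
    proof (rule bij_betw_disjoint_Un)
      show "bij_betw (\<lambda>k. Inl (\<alpha> k)) E (Inl ` I)"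
        using \<alpha> by (auto simp: bij_betw_def inj_on_def)
    qed (auto simp: bij_betw_def)
    then have \<phi>: "bij_betw \<phi> UNIV S" unfolding \<phi>_def[abs_def] S_eq by (simp add: Compl_partition)
    let ?y = "\<lambda>k. with_canonical f (\<phi> k)"
    have "?y k = (if k \<in> E then 1 else \<kappa> k) *s (if k \<in> E then axis (\<alpha> k) 1 else q k)" for k
      by (simp add: with_canonical_def \<phi>_def \<kappa>(2))
    then have "rows_det ?y = (\<Prod>k\<in>UNIV. if k \<in> E then 1 else \<kappa> k) * rows_det (\<lambda>k. if k \<in> E then axis (\<alpha> k) 1 else q k)"
      by (simp only: rows_det_scale)
    moreover have "(\<Prod>k\<in>UNIV. if k \<in> E then 1 else \<kappa> k) \<noteq> 0" using \<kappa>(1) by simp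
    ultimately have nzd: "rows_det ?y \<noteq> 0" using gen[of \<alpha> E] \<alpha> by (simp add: bij_betw_def)
    have img: "\<phi> ` UNIV = S" using \<phi> by (simp add: bij_betw_def)
    have "inj (with_canonical f \<circ> \<phi>)" using rows_det_independent(1)[OF nzd] by (simp add: comp_def)
    then have "inj_on (with_canonical f) S" unfolding img[symmetric] by (rule inj_on_imageI)
    moreover have "range ?y = with_canonical f ` S" unfolding img[symmetric] by auto
    ultimately show ?thesis using rows_det_independent(2)[OF nzd] by simp
  qed
  then show ?thesis using pr by (auto simp: Ugen_def)
qed

lemma frag_sum:
  assumes A: "finite A" and F: "inj_on F A" and c: "\<And>a. a \<in> A \<Longrightarrow> c a \<noteq> 0"
  shows "Poly_Mapping.keys (\<Sum>a\<in>A. frag_cmul (c a) (frag_of (F a))) = F ` A"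
    and "g_chain (\<Sum>a\<in>A. frag_cmul (c a) (frag_of (F a))) z = (\<Sum>a\<in>A. of_int (c a) * g_basis (F a) z)"
proof -
  let ?f = "\<Sum>a\<in>A. frag_cmul (c a) (frag_of (F a))"
  have l: "Poly_Mapping.lookup ?f (F b) = c b" if b: "b \<in> A" for b
  proof -
    have "Poly_Mapping.lookup ?f (F b) = (\<Sum>a\<in>A. if a = b then c a else 0)"
      unfolding lookup_sum by (rule sum.cong) (use b F in \<open>auto simp: inj_on_def\<close>)
    then show ?thesis using A b by simp
  qed
  have l0: "Poly_Mapping.lookup ?f y = 0" if "y \<notin> F ` A" for y
    unfolding lookup_sum by (rule sum.neutral) (use that in auto)
  show keys: "Poly_Mapping.keys ?f = F ` A"
    using l l0 c by (auto simp: in_keys_iff)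
  show "g_chain ?f z = (\<Sum>a\<in>A. of_int (c a) * g_basis (F a) z)"
    unfolding g_chain_def keys sum.reindex[OF F] by (rule sum.cong) (simp_all add: l)
qed

lemma frag_extend_sum_cmul:
  assumes "finite A"
  shows "frag_extend f (\<Sum>a\<in>A. frag_cmul (c a) (frag_of (F a))) = (\<Sum>a\<in>A. frag_cmul (c a) (f (F a)))"
  using assms by (induction A rule: finite_induct) (simp_all add: frag_extend_add frag_extend_cmul)

lemma sum_alternating: "(\<Sum>j<2 * n + 1. (- 1) ^ j) = (1 :: 'a::comm_ring_1)"
  by (induction n) auto

context log_lattice
begin

text \<open>The number of copies of a flag is at least \<open>CARD('n)\<close>, so that
  \<open>(w, r k)\<close> is a copy for every type \<open>k\<close>, and it is odd, so that
  alternating signs add up to 1.\<close>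

definition copies :: "((('n \<Rightarrow> 'n) \<times> 'n set) \<times> nat) set" where
  "copies = flags \<times> {..<2 * (CARD('n) - 1) + 1}"

lemma finite_copies: "finite copies"
  unfolding copies_def using finite_flags by simp

lemma r_copies: "r k < 2 * (CARD('n) - 1) + 1"
  using r_less[of k] by linarith

lemma gpow_eq_imp_norm_one:
  assumes g: "g \<in> V" and eq: "gpow g a = gpow g b" "a \<noteq> b"
  shows "norm (g $ i) = 1"
proof -
  have "gpow g (a - b) * gpow g b = gpow g b"
    using gpow_add[of g "a - b" b] nz[OF g] eq by simp
  then have "(g $ i) powi (a - b) * (g $ i) powi b = (g $ i) powi b"
    by (metis gpow_def vec_lambda_beta vector_mult_component)
  then have "(g $ i) powi (a - b) = 1" using nz[OF g, of i] by simp
  then have "norm (g $ i) powi (a - b) = 1" by (metis norm_power_int norm_one)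
  moreover have pos: "norm (g $ i) > 0" using nz[OF g] by simp
  moreover obtain m where m: "m = a - b" by blast
  ultimately have "norm (g $ i) powr real_of_int m = 1"
    using powr_real_of_int'[of "norm (g $ i)" m] by (simp del: of_int_diff)
  then have "real_of_int m * ln (norm (g $ i)) = 0" using pos by (simp add: powr_def)
  then show ?thesis using eq(2) pos by (simp add: m)
qed

text \<open>The exponents \<open>3 ^ a\<close> have pairwise distinct differences, so simplices coming from
  different copies of a target simplex are moved by pairwise distinct powers of \<open>g\<close>.\<close>

lemma generic_shifts:
  assumes g: "g \<in> V" "inj (\<lambda>i. norm (g $ i))" and p: "\<And>i. p i \<in> V"
  obtains h where "\<And>a. h a \<in> V" "inj_on h copies"
    "\<forall>w0\<in>flags. \<forall>a u h'. (\<forall>k. a k \<in> copies \<and> a k \<noteq> (w0, r k) \<and> h (w0, r k) * h' k = 1) \<longrightarrow>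
       rows_det (\<lambda>k. h' k * (h (a k) * vert (fst (a k)) (u k) * p (u k))) \<noteq> 0"
proof -
  obtain N :: "((('n \<Rightarrow> 'n) \<times> 'n set) \<times> nat) \<Rightarrow> nat" where N: "inj_on N copies"
    using finite_imp_inj_to_nat_seg[OF finite_copies] by blast
  define e :: "((('n \<Rightarrow> 'n) \<times> 'n set) \<times> nat) \<Rightarrow> int" where "e a = 3 ^ N a" for a
  let ?D = "{(w0, a, u). w0 \<in> flags \<and> (\<forall>k :: 'n. a k \<in> copies) \<and> (\<forall>k. a k \<noteq> (w0, r k)) \<and> u \<in> (UNIV :: ('n \<Rightarrow> 'n) set)}"
  have gnz: "\<And>i. g $ i \<noteq> 0" using nz[OF g(1)] .
  have "finite ?D"
  proof (rule finite_subset)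
    show "?D \<subseteq> flags \<times> PiE UNIV (\<lambda>_. copies) \<times> UNIV" by (auto simp: PiE_UNIV_domain)
    show "finite (flags \<times> PiE (UNIV :: 'n set) (\<lambda>_. copies) \<times> (UNIV :: ('n \<Rightarrow> 'n) set))"
      by (intro finite_cartesian_product finite_PiE finite_flags) (auto simp: finite_copies)
  qed
  moreover have "\<forall>\<^sub>F t in sequentially. rows_det (\<lambda>k. vert (fst (a k)) (u k) * p (u k) *
      gpow g (int t * (e (a k) - e (w0, r k)))) \<noteq> 0"
    if w0: "w0 \<in> flags" and a: "\<And>k. a k \<in> copies" "\<And>k. a k \<noteq> (w0, r k)" for w0 and a :: "'n \<Rightarrow> _" and u
  proof -
    have inj: "inj (\<lambda>k. e (a k) - e (w0, r k))"
    proof (rule injI)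
      fix k k' assume "e (a k) - e (w0, r k) = e (a k') - e (w0, r k')"
      then have "(3::int) ^ N (a k) + 3 ^ N (w0, r k') = 3 ^ N (a k') + 3 ^ N (w0, r k)"
        by (simp add: e_def)
      from power3_sum_eq[OF this]
      \<comment> \<open>Either \<open>a k\<close> is the excluded copy \<open>(w0, r k)\<close>, or
        the two copies of \<open>w0\<close> coincide and then \<open>k = k'\<close>.\<close>
      have "N (a k) = N (w0, r k) \<or> N (w0, r k') = N (w0, r k)" by auto
      moreover have "(w0, r k) \<in> copies" "(w0, r k') \<in> copies" for k k'
        using w0 r_copies by (auto simp: copies_def)
      ultimately have "a k = (w0, r k) \<or> (w0, r k') = (w0, r k)"
        using N a(1) by (meson inj_onD)
      then show "k = k'" using a(2)[of k] r_eq_iff[of k' k] by auto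
    qed
    have "\<forall>\<^sub>F t in sequentially. rows_det (\<lambda>k. if k \<in> {} then axis (id k) 1
      else vert (fst (a k)) (u k) * p (u k) * gpow g (int t * (e (a k) - e (w0, r k)))) \<noteq> 0"
      by (rule eventually_rows_det_nonzero[OF gnz g(2)]) (use inj in \<open>auto simp: nz[OF vert_in] nz[OF p]\<close>)
    then show ?thesis by simp
  qed
  ultimately have "\<forall>\<^sub>F t in sequentially. \<forall>(w0, a, u)\<in>?D. rows_det (\<lambda>k. vert (fst (a k)) (u k) * p (u k) *
      gpow g (int t * (e (a k) - e (w0, r k)))) \<noteq> 0"
    by (intro eventually_ball_finite) auto
  then have "\<forall>\<^sub>F t in sequentially. t > 0 \<and> (\<forall>(w0, a, u)\<in>?D. rows_det (\<lambda>k. vert (fst (a k)) (u k) * p (u k) *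
      gpow g (int t * (e (a k) - e (w0, r k)))) \<noteq> 0)"
    using eventually_gt_at_top[of "0::nat"] by eventually_elim auto
  from eventually_happens'[OF sequentially_bot this]
  obtain t where t: "t > 0" "\<forall>(w0, a, u)\<in>?D. rows_det (\<lambda>k. vert (fst (a k)) (u k) * p (u k) *
      gpow g (int t * (e (a k) - e (w0, r k)))) \<noteq> 0" by blast
  define h where "h a = gpow g (int t * e a)" for a
  show ?thesis
  proof (rule that[of h])
    show "h a \<in> V" for a unfolding h_def by (rule gpow_in[OF g(1)])
    show "inj_on h copies"
    proof (rule inj_onI, rule ccontr)
      fix a b assume ab: "a \<in> copies" "b \<in> copies" "h a = h b" "a \<noteq> b"
      then have "N a \<noteq> N b" using N by (auto dest: inj_onD)
      then have "int t * e a \<noteq> int t * e b" using t(1) by (simp add: e_def)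
      then have one: "norm (g $ i) = 1" for i
        using gpow_eq_imp_norm_one[OF g(1)] ab(3) unfolding h_def by blast
      \<comment> \<open>If every coordinate of \<open>g\<close> has absolute value 1, separation
        leaves only one index; then there is one flag with one copy, so \<open>copies\<close> has no
        two distinct elements.\<close>
      have all: "i = i0" for i using one[of i] one[of i0] g(2) by (metis injD)
      then have U: "(UNIV :: 'n set) = {i0}" by auto
      have "s = id" if "s permutes UNIV - {i0}" for s using all by (metis ext id_apply)
      moreover have "CARD('n) = 1" using U by (metis card.empty card_insert_disjoint empty_iff finite.emptyI One_nat_def)
      ultimately show False using ab U by (auto simp: copies_def flags_def)
    qed
    show "\<forall>w0\<in>flags. \<forall>a u h'. (\<forall>k. a k \<in> copies \<and> a k \<noteq> (w0, r k) \<and> h (w0, r k) * h' k = 1) \<longrightarrow>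
       rows_det (\<lambda>k. h' k * (h (a k) * vert (fst (a k)) (u k) * p (u k))) \<noteq> 0"
    proof (intro ballI allI impI)
      fix w0 a u h'
      assume w0: "w0 \<in> flags"
        and all: "\<forall>k. a k \<in> copies \<and> a k \<noteq> (w0, r k) \<and> h (w0, r k) * h' k = 1"
      then have a: "\<And>k. a k \<in> copies" "\<And>k. a k \<noteq> (w0, r k)" and h': "\<And>k. h (w0, r k) * h' k = 1" by auto
      have "h' k * (h (a k) * vert (fst (a k)) (u k) * p (u k))
        = vert (fst (a k)) (u k) * p (u k) * gpow g (int t * (e (a k) - e (w0, r k)))" for k
      proof -
        have "h (a k) = gpow g (int t * (e (a k) - e (w0, r k))) * h (w0, r k)"
          unfolding h_def by (subst gpow_add[OF gnz, symmetric]) (simp add: right_diff_distrib)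
        then have "h' k * h (a k) = gpow g (int t * (e (a k) - e (w0, r k))) * (h (w0, r k) * h' k)"
          by (simp add: mult_ac)
        then have "h' k * h (a k) = gpow g (int t * (e (a k) - e (w0, r k)))" by (simp add: h')
        then show ?thesis by (simp add: mult.assoc[symmetric] mult.commute)
      qed
      moreover have "(w0, a, u) \<in> ?D" using w0 a by simp
      then have "rows_det (\<lambda>k. vert (fst (a k)) (u k) * p (u k) * gpow g (int t * (e (a k) - e (w0, r k)))) \<noteq> 0"
        using bspec[OF t(2), of "(w0, a, u)"] by simp
      ultimately show "rows_det (\<lambda>k. h' k * (h (a k) * vert (fst (a k)) (u k) * p (u k))) \<noteq> 0"
        by presburger
    qed
  qed
qed

end

section \<open>Shintani decompositions\<close>

context log_lattice
begin

text \<open>Division by the nonzero coordinates of \<open>z\<close> bounds \<open>norm x\<close> by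
  a multiple of \<open>norm (x * z)\<close>, and \<open>norm x \<ge> 1\<close> on \<open>V\<close>
  allows the comparison of \<open>norm x\<close> with its power.\<close>

lemma inverse_power_norm_summable:
  assumes z: "\<And>i. z $ i \<noteq> 0"
  shows "(\<lambda>x. 1 / norm (x * z) ^ CARD('n)) summable_on V"
proof -
  define Z where "Z = (\<Sum>i\<in>UNIV. 1 / norm (z $ i))"
  have Z0: "0 \<le> Z" unfolding Z_def by (intro sum_nonneg) simp
  have bound: "1 / norm (x * z) ^ CARD('n) \<le> Z ^ CARD('n) * (1 / norm x)" if x: "x \<in> V" for x
  proof -
    have "norm x \<le> (\<Sum>i\<in>UNIV. norm (x $ i))" by (rule norm_le_sum)
    also have "\<dots> \<le> (\<Sum>i\<in>UNIV. norm (x * z) * (1 / norm (z $ i)))"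
    proof (rule sum_mono)
      fix i
      have "norm (x $ i) = norm ((x * z) $ i) * (1 / norm (z $ i))" using z by (simp add: norm_mult)
      also have "\<dots> \<le> norm (x * z) * (1 / norm (z $ i))"
        by (intro mult_right_mono Finite_Cartesian_Product.norm_nth_le) simp
      finally show "norm (x $ i) \<le> norm (x * z) * (1 / norm (z $ i))" .
    qed
    finally have le: "norm x \<le> norm (x * z) * Z" by (simp add: Z_def sum_distrib_left)
    have "(x * z) $ i0 \<noteq> 0" using z nz[OF x] by simp
    then have pos: "0 < norm (x * z)" by (metis zero_index zero_less_norm_iff)
    have "1 \<le> norm x"
      using norm_ge_exp[OF x, of "max_index x"] log_abs_max_index[OF x]
      by (meson one_le_exp_iff order_trans)
    then have "norm x \<le> norm x ^ CARD('n)" by (intro self_le_power) auto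
    also have "\<dots> \<le> (norm (x * z) * Z) ^ CARD('n)" by (intro power_mono le) simp
    finally show ?thesis using pos norm_pos_in[OF x]
      by (simp add: power_mult_distrib field_simps)
  qed
  have "(\<lambda>x. Z ^ CARD('n) * (1 / norm x)) summable_on V"
    by (intro summable_on_cmult_right summable_inverse_norm)
  then show ?thesis by (rule summable_on_comparison_test) (use bound in auto)
qed

lemma Shin_nonempty: "Shin V \<noteq> {}"
proof -
  let ?n = "CARD('n)"
  obtain g where g: "g \<in> V" "inj (\<lambda>i. norm (g $ i))" using separating_element by blast
  obtain p where p: "\<And>i. p i \<in> V" "p i0 = 1"
    and p_gen: "\<And>w E \<alpha>. w \<in> flags \<Longrightarrow> inj_on \<alpha> E \<Longrightarrow>
       rows_det (\<lambda>k. if k \<in> E then axis (\<alpha> k) 1 else vert w k * p k) \<noteq> 0"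
    by (rule generic_base_points[OF g]) (rule that, assumption+)
  obtain h where h: "\<And>a. h a \<in> V" "inj_on h copies"
    and h_gen: "\<forall>w0\<in>flags. \<forall>a u h'. (\<forall>k. a k \<in> copies \<and> a k \<noteq> (w0, r k) \<and> h (w0, r k) * h' k = 1) \<longrightarrow>
       rows_det (\<lambda>k. h' k * (h (a k) * vert (fst (a k)) (u k) * p (u k))) \<noteq> 0"
    by (rule generic_shifts[where p = p, OF g p(1)]) (rule that, assumption+)
  obtain hi where hi: "\<And>a. hi a \<in> V" "\<And>a. h a * hi a = 1" using inverse_in[OF h(1)] by metis
  define q where "q a i = h a * vert (fst a) i * p i" for a i
  have qV: "q a i \<in> V" for a i unfolding q_def by (intro mult_in h vert_in p)
  \<comment> \<open>The sign found in \<open>label_sum\<close>; used as a coefficient it normalises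
    the total to \<open>1 / Nm z\<close>, since its square is 1.\<close>
  define \<delta> :: int where "\<delta> = (-1) ^ (?n - 1) * (if frame_det > 0 then 1 else - 1)"
  have \<delta>: "complex_of_real ((-1) ^ (?n - 1) * sgn frame_det) = of_int \<delta>" "\<delta> * \<delta> = 1"
    using frame_det_nonzero by (auto simp: \<delta>_def sgn_if)
  define co where "co a = \<delta> * (fsign (fst a) * (-1) ^ snd a)" for a :: "(('n \<Rightarrow> 'n) \<times> 'n set) \<times> nat"
  have co_norm: "norm (of_int (co a) :: complex) = 1" for a
    by (simp add: co_def \<delta>_def fsign_def sign_def norm_mult norm_power)
  have co_nz: "co a \<noteq> 0" for a using co_norm[of a] by auto
  define c where "c = (\<Sum>a\<in>copies. frag_cmul (co a) (frag_of (lines (q a))))"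

  have q_det: "rows_det (\<lambda>k. if k \<in> E then axis (\<alpha> k) 1 else q a k) \<noteq> 0"
    if a: "a \<in> copies" and al: "inj_on \<alpha> E" for a E \<alpha>
  proof -
    have w: "fst a \<in> flags" using a by (auto simp: copies_def)
    let ?y = "\<lambda>k. if k \<in> E then axis (\<alpha> k) 1 else vert (fst a) k * p k"
    have "(if k \<in> E then axis (\<alpha> k) 1 else q a k)
      = (if k \<in> E then 1 / h a $ \<alpha> k else 1) *s (h a * ?y k)" for k
      using nz[OF h(1)] by (auto simp: vec_eq_iff axis_def q_def mult.assoc)
    then have "rows_det (\<lambda>k. if k \<in> E then axis (\<alpha> k) 1 else q a k)
      = (\<Prod>k\<in>UNIV. if k \<in> E then 1 / h a $ \<alpha> k else 1) * (Nm (h a) * rows_det ?y)"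
      by (simp only: rows_det_scale rows_det_mult)
    moreover have "(\<Prod>k\<in>UNIV. if k \<in> E then 1 / h a $ \<alpha> k else 1) \<noteq> 0"
      using nz[OF h(1)] by simp
    moreover have "Nm (h a) \<noteq> 0" using norm_Nm[OF h(1), of a] by auto
    ultimately show ?thesis using p_gen[OF w al] by simp
  qed
  have q_nz: "q a i \<noteq> 0" for a i using nz[OF qV, of a i i0] by (metis zero_index)
  \<comment> \<open>Distinct copies must remain distinct as tuples of lines, or their coefficients
    would be merged. The line of type \<open>i0\<close> is spanned by \<open>h a\<close>, and two
    elements of \<open>V\<close> on one line differ by a scalar of absolute value 1, so they have
    the same logarithm.\<close>
  have inj_lines: "inj_on (\<lambda>a. lines (q a)) copies"
  proof (rule inj_onI)
    fix a b assume ab: "a \<in> copies" "b \<in> copies" "lines (q a) = lines (q b)"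
    have "front i0 = {}" by (auto simp: front_def r_i0)
    then have q0: "q a i0 = h a" for a by (simp add: q_def vert_def p(2))
    have "h a \<in> vec.span {h b}"
      using ab(3) vec.span_base[of "h a" "{h a}"] by (metis insertI1 lines_def q0)
    then obtain \<kappa> where \<kappa>: "h a = \<kappa> *s h b" by (auto simp: vec.span_singleton)
    have "norm (Nm (h a)) = norm \<kappa> ^ ?n * norm (Nm (h b))"
      by (simp add: \<kappa> Nm_def prod.distrib norm_mult norm_power)
    then have "norm \<kappa> ^ ?n = 1" using norm_Nm[OF h(1)] by simp
    then have "norm \<kappa> = 1" using power_eq_imp_eq_base[of "norm \<kappa>" ?n 1] by simp
    then have "log_abs (h a) = log_abs (h b)" by (simp add: \<kappa> log_abs_def norm_mult)
    then have "h a = h b" by (rule inj_onD[OF inj_log]) (rule h)+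
    then show "a = b" by (rule inj_onD[OF h(2)]) (rule ab)+
  qed
  have "c \<in> carrier (free_Abelian_group Ugen)"
  proof -
    have "Poly_Mapping.keys c \<subseteq> Ugen"
      unfolding c_def frag_sum(1)[OF finite_copies inj_lines co_nz]
      using lines_in_Ugen[OF q_det] by auto
    then show ?thesis by simp
  qed
  moreover have "1 / Nm z = (\<Sum>\<^sub>\<infinity>x\<in>V. g_chain (act_chain x c) z)"
    if z: "z \<in> carrier ctorus" and conv: "series_converges_at V c z" for z
  proof -
    have znz: "z $ i \<noteq> 0" for i using z by (simp add: ctorus_def)
    have act: "act_chain x c = (\<Sum>a\<in>copies. frag_cmul (co a) (frag_of (lines (\<lambda>i. x * q a i))))" for x
      unfolding act_chain_def c_def frag_extend_sum_cmul[OF finite_copies] act_lines ..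
    have inj_x: "inj_on (\<lambda>a. lines (\<lambda>i. x * q a i)) copies" if x: "x \<in> V" for x
    proof (rule inj_onI)
      fix a b assume ab: "a \<in> copies" "b \<in> copies" "lines (\<lambda>i. x * q a i) = lines (\<lambda>i. x * q b i)"
      obtain y where y: "x * y = 1" using inverse_in[OF x] by blast
      have "act y (lines (\<lambda>i. x * q a i)) = lines (q a)" for a
        unfolding act_lines mult.assoc[symmetric] mult.commute[of y x] y by simp
      then have "lines (q a) = lines (q b)" using ab(3) by metis
      then show "a = b" by (rule inj_onD[OF inj_lines]) (rule ab)+
    qed
    have xq_nz: "x * q a i \<noteq> 0" if "x \<in> V" for x a i
      using nz[OF mult_in[OF that qV], of a i i0] by (metis zero_index)
    define Es where "Es x = (\<Sum>a\<in>copies. of_int (co a) * g_rows z (\<lambda>i. x * q a i))" for x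
    have Es: "g_chain (act_chain x c) z = Es x" if x: "x \<in> V" for x
    proof -
      have "g_basis (lines (\<lambda>i. x * q a i)) z = g_rows z (\<lambda>i. x * q a i)" for a
        using g_basis_eq[OF lines_proj_space[of "\<lambda>i. x * q a i", OF xq_nz[OF x]]
            is_lift_lines[of "\<lambda>i. x * q a i", OF xq_nz[OF x]]]
        by (simp add: g_lift_eq_G)
      then show ?thesis
        unfolding act frag_sum(2)[OF finite_copies inj_x[OF x] co_nz] Es_def by simp
    qed
    have reg: "Tr (x * q a i * z) \<noteq> 0" if "x \<in> V" "a \<in> copies" for x a i
    proof -
      have "lines (\<lambda>i. x * q a i) \<in> Poly_Mapping.keys (act_chain x c)"
        unfolding act frag_sum(1)[OF finite_copies inj_x[OF that(1)] co_nz] using that by blast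
      then have "regular_at (lines (\<lambda>i. x * q a i)) z"
        using conv that by (auto simp: series_converges_at_def)
      then show ?thesis
        using is_lift_lines[of "\<lambda>i. x * q a i", OF xq_nz[OF that(1)]] by (auto simp: regular_at_def)
    qed
    have w_ex: "\<exists>w. w \<in> flags" unfolding flags_def using permutes_id by blast
    \<comment> \<open>A vertex of a copy is \<open>p i\<close> times an element of \<open>V\<close>,
      so regularity along all of \<open>V\<close> carries over to \<open>x * p i\<close>.\<close>
    have reg_p: "Tr (x * p i * z) \<noteq> 0" if x: "x \<in> V" for x i
    proof -
      obtain w where w: "w \<in> flags" using w_ex by blast
      define a where "a = (w, 0 :: nat)"
      have a: "a \<in> copies" using w by (simp add: a_def copies_def)
      obtain y where y: "y \<in> V" "h a * vert (fst a) i * y = 1"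
        using inverse_in[OF mult_in[OF h(1) vert_in]] by blast
      have "x * y * q a i = x * p i * (h a * vert (fst a) i * y)" by (simp add: q_def mult_ac)
      then have "x * y * q a i = x * p i" by (simp add: y)
      then show ?thesis using reg[OF mult_in[OF x y(1)] a, of i] by simp
    qed
    have Es_summable: "Es summable_on V"
    proof -
      have "(\<lambda>x. g_chain (act_chain x c) z) summable_on V" using conv by (simp add: series_converges_at_def)
      then show ?thesis using summable_on_cong[of V "\<lambda>x. g_chain (act_chain x c) z" Es] Es by simp
    qed
    have summ: "(\<lambda>x. \<Prod>i\<in>UNIV. 1 / norm (Tr (x * vert w0 i * p i * z))) summable_on V"
      if w0: "w0 \<in> flags" for w0
    proof -
      \<comment> \<open>An element of \<open>?D\<close> names, for every \<open>k\<close>, a simplex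
        other than the copy \<open>(w0, r k)\<close> and one of its vertices: a candidate for a
        small denominator. The finitely many matrices \<open>?m\<close> are nonsingular by
        \<open>h_gen\<close>, so one \<eta> serves them all.\<close>
      let ?D = "{(a :: 'n \<Rightarrow> (('n \<Rightarrow> 'n) \<times> 'n set) \<times> nat, u :: 'n \<Rightarrow> 'n). (\<forall>k. a k \<in> copies) \<and> (\<forall>k. a k \<noteq> (w0, r k))}"
      let ?m = "\<lambda>(a, u) k. hi (w0, r k) * q (a k) (u k)"
      have "finite (?m ` ?D)"
      proof (rule finite_imageI, rule finite_subset)
        show "?D \<subseteq> PiE UNIV (\<lambda>_. copies) \<times> UNIV" by (auto simp: PiE_UNIV_domain)
        show "finite (PiE (UNIV :: 'n set) (\<lambda>_. copies) \<times> (UNIV :: ('n \<Rightarrow> 'n) set))"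
          by (intro finite_cartesian_product finite_PiE) (auto simp: finite_copies)
      qed
      moreover have "rows_det y \<noteq> 0" if "y \<in> ?m ` ?D" for y
      proof -
        obtain a u where y: "y = ?m (a, u)" and a: "\<And>k. a k \<in> copies" "\<And>k. a k \<noteq> (w0, r k)"
          using \<open>y \<in> ?m ` ?D\<close> by auto
        show ?thesis using bspec[OF h_gen w0, rule_format, of a "\<lambda>k. hi (w0, r k)" u] a hi(2)
          unfolding y q_def by simp
      qed
      ultimately obtain \<eta> where \<eta>: "\<eta> > 0"
        "\<And>y q. y \<in> ?m ` ?D \<Longrightarrow> \<exists>k. \<eta> * norm q \<le> norm (Tr (y k * q))"
        using uniform_lower_bound[of "?m ` ?D"] by blast
      define B where "B = (\<Sum>a\<in>copies. norm (rows_det (q a)))"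
      define D0 where "D0 = norm (rows_det (\<lambda>i. vert w0 i * p i))"
      have "D0 > 0" using p_gen[OF w0, of id "{}"] by (simp add: D0_def)
      define K where "K = real (card copies) * (B / \<eta> ^ ?n)"
      have bound: "(\<Prod>i\<in>UNIV. 1 / norm (Tr (x * vert w0 i * p i * z)))
          \<le> (1 / D0) * ((\<Sum>k\<in>UNIV. norm (Es (x * hi (w0, r k)))) + K * (1 / norm (x * z) ^ ?n))"
        if x: "x \<in> V" for x
      proof -
        have "(x * z) $ i0 \<noteq> 0" using znz nz[OF x] by simp
        then have xz: "0 < norm (x * z)" by (metis zero_index zero_less_norm_iff)
        \<comment> \<open>each copy of \<open>w0\<close> is spoilt by a small denominator in another simplex, and there are not
          enough small denominators to spoil them all\<close>
        obtain k where k: "\<And>a i. a \<in> copies \<Longrightarrow> a \<noteq> (w0, r k) \<Longrightarrow>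
            \<eta> * norm (x * z) \<le> norm (Tr (hi (w0, r k) * q a i * (x * z)))"
        proof (rule ccontr)
          assume "\<not> thesis"
          then have "\<forall>k. \<exists>a i. a \<in> copies \<and> a \<noteq> (w0, r k) \<and>
              norm (Tr (hi (w0, r k) * q a i * (x * z))) < \<eta> * norm (x * z)"
            using that by (meson not_le)
          then obtain a u where au: "\<And>k. a k \<in> copies" "\<And>k. a k \<noteq> (w0, r k)"
            "\<And>k. norm (Tr (hi (w0, r k) * q (a k) (u k) * (x * z))) < \<eta> * norm (x * z)" by metis
          then have "?m (a, u) \<in> ?m ` ?D" by (intro imageI) auto
          from \<eta>(2)[OF this, of "x * z"] show False using au(3) by (auto simp: not_le[symmetric])
        qed
        let ?b = "(w0, r k)" let ?x = "x * hi ?b"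
        have bc: "?b \<in> copies" using w0 r_copies by (simp add: copies_def)
        have xV: "?x \<in> V" by (rule mult_in[OF x hi(1)])
        \<comment> \<open>The translation by \<open>hi\<close> undoes the shift of the chosen copy,
          so that copy falls on the simplex of \<open>w0\<close> at \<open>x\<close>.\<close>
        have main: "?x * q ?b i = x * vert w0 i * p i" for i
        proof -
          have "?x * q ?b i = x * vert w0 i * p i * (h ?b * hi ?b)" by (simp add: q_def mult_ac)
          then show ?thesis by (simp add: hi)
        qed
        have small: "norm (of_int (co a) * g_rows z (\<lambda>i. ?x * q a i)) \<le> B / \<eta> ^ ?n * (1 / norm (x * z) ^ ?n)"
          if a: "a \<in> copies" "a \<noteq> ?b" for a
        proof -
          have eq: "?x * q a i * z = hi ?b * q a i * (x * z)" for i by (simp add: mult_ac)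
          have t: "\<eta> * norm (x * z) \<le> norm (Tr (?x * q a i * z))" for i
            unfolding eq by (rule k[OF a])
          have "(\<Prod>i\<in>(UNIV :: 'n set). \<eta> * norm (x * z)) \<le> (\<Prod>i\<in>UNIV. norm (Tr (?x * q a i * z)))"
            using t \<eta>(1) by (intro prod_mono) auto
          then have pr: "\<eta> ^ ?n * norm (x * z) ^ ?n \<le> norm (\<Prod>i\<in>UNIV. Tr (?x * q a i * z))"
            by (simp add: power_mult_distrib prod_norm)
          have num: "norm (rows_det (\<lambda>i. ?x * q a i)) \<le> B"
          proof -
            have "norm (rows_det (\<lambda>i. ?x * q a i)) = norm (rows_det (q a))"
              unfolding rows_det_mult by (simp add: norm_mult norm_Nm[OF xV])
            also have "\<dots> \<le> B" unfolding B_def by (rule member_le_sum) (use a finite_copies in auto)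
            finally show ?thesis .
          qed
          have "norm (g_rows z (\<lambda>i. ?x * q a i)) \<le> B / (\<eta> ^ ?n * norm (x * z) ^ ?n)"
            unfolding g_rows_def norm_divide using num pr \<eta>(1) xz
            by (intro frac_le) (auto intro: order_trans[OF norm_ge_zero num])
          then show ?thesis unfolding norm_mult co_norm by simp
        qed
        have "Es ?x = of_int (co ?b) * g_rows z (\<lambda>i. x * vert w0 i * p i)
            + (\<Sum>a\<in>copies - {?b}. of_int (co a) * g_rows z (\<lambda>i. ?x * q a i))"
          unfolding Es_def using bc finite_copies by (subst sum.remove[of _ ?b]) (simp_all add: main)
        then have *: "of_int (co ?b) * g_rows z (\<lambda>i. x * vert w0 i * p i)
            = Es ?x - (\<Sum>a\<in>copies - {?b}. of_int (co a) * g_rows z (\<lambda>i. ?x * q a i))" by simp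
        have "norm (of_int (co ?b) * g_rows z (\<lambda>i. x * vert w0 i * p i))
            \<le> norm (Es ?x) + norm (\<Sum>a\<in>copies - {?b}. of_int (co a) * g_rows z (\<lambda>i. ?x * q a i))"
          unfolding * by (rule norm_triangle_ineq4)
        also have "norm (\<Sum>a\<in>copies - {?b}. of_int (co a) * g_rows z (\<lambda>i. ?x * q a i))
            \<le> of_nat (card (copies - {?b})) * (B / \<eta> ^ ?n * (1 / norm (x * z) ^ ?n))"
          by (rule sum_norm_bound) (use small in auto)
        also have "\<dots> \<le> of_nat (card copies) * (B / \<eta> ^ ?n * (1 / norm (x * z) ^ ?n))"
          using finite_copies \<eta>(1) by (intro mult_right_mono)
            (auto intro!: card_mono mult_nonneg_nonneg divide_nonneg_nonneg sum_nonneg simp: B_def)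
        also have "\<dots> = K * (1 / norm (x * z) ^ ?n)" by (simp add: K_def)
        \<comment> \<open>The index \<open>k\<close> depends on \<open>x\<close>; summing over all
          \<open>k\<close> removes this dependence and leaves a summable bound.\<close>
        also have "norm (Es ?x) \<le> (\<Sum>k\<in>UNIV. norm (Es (x * hi (w0, r k))))"
          by (rule member_le_sum) auto
        finally have le: "norm (g_rows z (\<lambda>i. x * vert w0 i * p i))
            \<le> (\<Sum>k\<in>UNIV. norm (Es (x * hi (w0, r k)))) + K * (1 / norm (x * z) ^ ?n)"
          unfolding norm_mult co_norm by simp
        have "norm (g_rows z (\<lambda>i. x * vert w0 i * p i)) = D0 * (\<Prod>i\<in>UNIV. 1 / norm (Tr (x * vert w0 i * p i * z)))"
        proof -
          have "rows_det (\<lambda>i. x * vert w0 i * p i) = Nm x * rows_det (\<lambda>i. vert w0 i * p i)"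
            using rows_det_mult[of x "\<lambda>i. vert w0 i * p i"] by (simp add: mult.assoc)
          then show ?thesis
            by (simp add: g_rows_def norm_divide norm_mult norm_Nm[OF x] D0_def prod_dividef flip: prod_norm)
        qed
        then show ?thesis using le \<open>D0 > 0\<close> by (simp add: pos_le_divide_eq mult.commute)
      qed
      have "(\<lambda>x. norm (Es x)) summable_on V"
        using Es_summable by (simp add: summable_on_iff_abs_summable_on_complex)
      then have "(\<lambda>x. norm (Es (x * hi (w0, r k)))) summable_on V" for k
        using summable_on_reindex_bij_betw[OF bij_mult[OF hi(1)], of "\<lambda>x. norm (Es x)"] by simp
      note has_sum_sum[OF finite_class.finite_UNIV has_sum_infsum[OF this]]
      then have "(\<lambda>x. \<Sum>k\<in>UNIV. norm (Es (x * hi (w0, r k)))) summable_on V"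
        unfolding summable_on_def by (rule exI)
      then have "(\<lambda>x. (1 / D0) * ((\<Sum>k\<in>UNIV. norm (Es (x * hi (w0, r k)))) + K * (1 / norm (x * z) ^ ?n))) summable_on V"
        by (intro summable_on_cmult_right summable_on_add inverse_power_norm_summable znz)
      then show ?thesis by (rule summable_on_comparison_test) (use bound in \<open>auto intro!: prod_nonneg\<close>)
    qed
    have total: "(chain_sum z (\<lambda>i x. x * p i) has_sum (of_int \<delta> / Nm z)) V"
      using flag_sum[OF znz reg_p summ] unfolding \<delta> .
    define Gw where "Gw w x = g_rows z (\<lambda>i. x * vert w i * p i)" for w x
    have Gw: "(Gw w has_sum infsum (Gw w) V) V" if w: "w \<in> flags" for w
    proof (rule has_sum_infsum, rule abs_summable_summable)
      define D0 where "D0 = norm (rows_det (\<lambda>i. vert w i * p i))"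
      have "norm (Gw w x) = D0 * (\<Prod>i\<in>UNIV. 1 / norm (Tr (x * vert w i * p i * z)))" if x: "x \<in> V" for x
      proof -
        have "rows_det (\<lambda>i. x * vert w i * p i) = Nm x * rows_det (\<lambda>i. vert w i * p i)"
          using rows_det_mult[of x "\<lambda>i. vert w i * p i"] by (simp add: mult.assoc)
        then show ?thesis
          by (simp add: Gw_def g_rows_def norm_divide norm_mult norm_Nm[OF x] D0_def prod_dividef flip: prod_norm)
      qed
      then show "(\<lambda>x. norm (Gw w x)) summable_on V"
        using summable_on_cong[of V "\<lambda>x. norm (Gw w x)"] summable_on_cmult_right[OF summ[OF w], of D0] by simp
    qed
    have "(chain_sum z (\<lambda>i x. x * p i) has_sum (\<Sum>w\<in>flags. of_int (fsign w) * infsum (Gw w) V)) V"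
      using has_sum_sum[OF finite_flags has_sum_cmult_right[OF Gw]] by (simp add: Gw_def)
    then have eq: "(\<Sum>w\<in>flags. of_int (fsign w) * infsum (Gw w) V) = of_int \<delta> / Nm z"
      using total has_sum_unique by blast
    \<comment> \<open>A translation by \<open>h a\<close> permutes \<open>V\<close>, so each copy
      has the same sum as its flag.\<close>
    have "((\<lambda>x. of_int (co a) * Gw (fst a) (x * h a)) has_sum (of_int (co a) * infsum (Gw (fst a)) V)) V"
      if "a \<in> copies" for a
      using that by (intro has_sum_cmult_right) (auto simp: has_sum_mult[OF h(1)] copies_def intro: Gw)
    then have "((\<lambda>x. \<Sum>a\<in>copies. of_int (co a) * Gw (fst a) (x * h a)) has_sum
        (\<Sum>a\<in>copies. of_int (co a) * infsum (Gw (fst a)) V)) V"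
      by (intro has_sum_sum finite_copies)
    moreover have "Gw (fst a) (x * h a) = g_rows z (\<lambda>i. x * q a i)" for a x
      by (simp add: Gw_def q_def mult.assoc)
    ultimately have "(Es has_sum (\<Sum>a\<in>copies. of_int (co a) * infsum (Gw (fst a)) V)) V"
      by (simp add: Es_def[abs_def])
    also have "(\<Sum>a\<in>copies. of_int (co a) * infsum (Gw (fst a)) V) = 1 / Nm z"
    proof -
      have "(\<Sum>a\<in>copies. of_int (co a) * infsum (Gw (fst a)) V)
        = (\<Sum>w\<in>flags. \<Sum>j<2 * (?n - 1) + 1. of_int (co (w, j)) * infsum (Gw w) V)"
        unfolding copies_def sum.cartesian_product by (simp add: case_prod_beta)
      also have "\<dots> = (\<Sum>w\<in>flags. of_int \<delta> * (of_int (fsign w) * infsum (Gw w) V) * (\<Sum>j<2 * (?n - 1) + 1. (- 1) ^ j))"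
        unfolding sum_distrib_left by (intro sum.cong) (simp_all add: co_def)
      also have "\<dots> = of_int \<delta> * (\<Sum>w\<in>flags. of_int (fsign w) * infsum (Gw w) V)"
        unfolding sum_alternating by (simp add: sum_distrib_left)
      also have "\<dots> = of_int (\<delta> * \<delta>) / Nm z" unfolding eq by simp
      finally show ?thesis using \<delta>(2) by simp
    qed
    finally have "infsum Es V = 1 / Nm z" by (rule infsumI)
    moreover have "(\<Sum>\<^sub>\<infinity>x\<in>V. g_chain (act_chain x c) z) = infsum Es V" by (rule infsum_cong) (rule Es)
    ultimately show ?thesis by simp
  qed
  ultimately have "c \<in> Shin V" unfolding Shin_def by blast
  then show ?thesis by blast
qed

end

theorem proposition1p15:
  fixes V :: "(complex ^ 'n) set"
  assumes "ctorus_lattice V"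
  shows "Shin V \<noteq> {}"
proof -
  obtain r i0 v where "log_lattice V r i0 v"
    using ctorus_lattice_log_lattice[OF assms] by blast
  then show ?thesis by (rule log_lattice.Shin_nonempty)
qed

end
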